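(* Let $R$ be an ordinary standard differential ring of finite differential type that has either differential type zero or finite differential dimension. If $R$ is $\Delta$-arithmetical, then $R$ is a J-ring.
   Context: All rings are commutative with identity. A differential ring is a ring with finitely many pairwise commuting derivations; it is ordinary if it has exactly one distinguished derivation. An ideal is differential if it is stable under the derivations; $\operatorname{Spec}^{\Delta}R$ is the set of differential prime ideals of $R$, assumed nonempty. $R\{z_1,\dots,z_n\}$ is the ring of differential polynomials in $n$ differential indeterminates over $R$. $R$ is standard if for every differential prime $\mathfrak p$ of $R$ the residue field $R_{\mathfrak p}/\mathfrak pR_{\mathfrak p}$ has characteristic zero. A differential ring $A$ is $\Delta$-arithmetical if for every finitely generated ideal $\mathfrak a$ of $A$ and every differential prime $\mathfrak p$ of $A$ the ideal $\mathfrak aA_{\mathfrak p}$ is principal. Gap measure: for $X\subseteq\operatorname{Spec}^{\Delta}R$ there is a unique function $\mu$ with values in $\mathbb Z\cup\{\infty\}$ on pairs $(\mathfrak p,\mathfrak p')$ of elements of $X$ with $\mathfrak p\supseteq\mathfrak p'$ such that: (1) $\mu(\mathfrak p,\mathfrak p')\ge 0$; (2) $\mu(\mathfrak p,\mathfrak p')=0$ iff $\mathfrak p=\mathfrak p'$ or there is no infinite strictly descending chain $\mathfrak p=\mathfrak p_0\supsetneq\mathfrak p_1\supsetneq\cdots\supseteq\mathfrak p'$ in $X$; (3) for an integer $d>0$, $\mu(\mathfrak p,\mathfrak p')\ge d$ iff $\mathfrak p\ne\mathfrak p'$ and there is an infinite strictly descending sequence $\mathfrak p=\mathfrak p_0\supsetneq\mathfrak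 p_1\supsetneq\cdots\supseteq\mathfrak p'$ in $X$ (all terms containing $\mathfrak p'$) with $\mu(\mathfrak p_{i-1},\mathfrak p_i)\ge d-1$ for all $i\ge 1$. The differential type $\operatorname{type}^{\Delta}R$ is the supremum of all $\mu(\mathfrak p,\mathfrak p')$ with $\mathfrak p\supseteq\mathfrak p'$ in $X=\operatorname{Spec}^{\Delta}R$. The differential dimension $\dim^{\Delta}R$ is the supremum of the integers $k\ge 0$ such that there is a chain $\mathfrak p_0\supsetneq\cdots\supsetneq\mathfrak p_k$ in $\operatorname{Spec}^{\Delta}R$ with $\mu(\mathfrak p_{i-1},\mathfrak p_i)=\operatorname{type}^{\Delta}R$ for $i=1,\dots,k$. J-ring: a differential ring $R$ with $m$ derivations and finite differential type $t$ is a J-ring if for every $n>0$ one has $\operatorname{type}^{\Delta}R\{z_1,\dots,z_n\}=\max(t,m)$ and: (i) $\dim^{\Delta}R\{z_1,\dots,z_n\}=n$ if $t<m$; (ii) $\dim^{\Delta}R<\infty$ and $\dim^{\Delta}R\{z_1,\dots,z_n\}=n+\dim^{\Delta}R$ if $t=m$; (iii) $\dim^{\Delta}R<\infty$ and $\dim^{\Delta}R\{z_1,\dots,z_n\}=\dim^{\Delta}R$ if $t>m$. (Here $m=1$.) *)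

theory Defs
  imports "HOL-Algebra.Algebra" "HOL-Library.Extended_Nat"
begin

section \<open>Ordinary differential rings\<close>

record 'a diff_ring = "'a ring" +
  der :: "'a \<Rightarrow> 'a" (\<open>\<delta>\<index>\<close>)

locale ordinary_diff_ring = cring R for R :: "('a, 'm) diff_ring_scheme" (structure) +
  assumes der_closed [simp, intro]: "a \<in> carrier R \<Longrightarrow> \<delta> a \<in> carrier R"
    and der_add: "\<lbrakk> a \<in> carrier R; b \<in> carrier R \<rbrakk> \<Longrightarrow> \<delta> (a \<oplus> b) = \<delta> a \<oplus> \<delta> b"
    and der_mult: "\<lbrakk> a \<in> carrier R; b \<in> carrier R \<rbrakk> \<Longrightarrow> \<delta> (a \<otimes> b) = \<delta> a \<otimes> b \<oplus> a \<otimes> \<delta> b"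

definition diff_Spec :: "('a, 'm) diff_ring_scheme \<Rightarrow> 'a set set"
  where "diff_Spec R = {p. primeideal p R \<and> (\<forall>a\<in>p. \<delta>\<^bsub>R\<^esub> a \<in> p)}"


section \<open>Localization at a prime ideal\<close>

definition loc_rel :: "('a, 'm) ring_scheme \<Rightarrow> 'a set \<Rightarrow> (('a \<times> 'a) \<times> ('a \<times> 'a)) set"
  where "loc_rel R p =
    {((a, s), (b, t)). a \<in> carrier R \<and> b \<in> carrier R \<and> s \<in> carrier R - p \<and> t \<in> carrier R - p \<and>
       (\<exists>u \<in> carrier R - p. u \<otimes>\<^bsub>R\<^esub> (a \<otimes>\<^bsub>R\<^esub> t) = u \<otimes>\<^bsub>R\<^esub> (b \<otimes>\<^bsub>R\<^esub> s))}"

definition fraction :: "('a, 'm) ring_scheme \<Rightarrow> 'a set \<Rightarrow> 'a \<Rightarrow> 'a \<Rightarrow> ('a \<times> 'a) set"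
  where "fraction R p a s = loc_rel R p `` {(a, s)}"

definition localization :: "('a, 'm) ring_scheme \<Rightarrow> 'a set \<Rightarrow> ('a \<times> 'a) set ring"
  where "localization R p =
    \<lparr> carrier = (carrier R \<times> (carrier R - p)) // loc_rel R p,
      monoid.mult = (\<lambda>A B. \<Union>(a, s)\<in>A. \<Union>(b, t)\<in>B.
               fraction R p (a \<otimes>\<^bsub>R\<^esub> b) (s \<otimes>\<^bsub>R\<^esub> t)),
      one = fraction R p \<one>\<^bsub>R\<^esub> \<one>\<^bsub>R\<^esub>,
      ring.zero = fraction R p \<zero>\<^bsub>R\<^esub> \<one>\<^bsub>R\<^esub>,
      ring.add = (\<lambda>A B. \<Union>(a, s)\<in>A. \<Union>(b, t)\<in>B.
               fraction R p (a \<otimes>\<^bsub>R\<^esub> t \<oplus>\<^bsub>R\<^esub> b \<otimes>\<^bsub>R\<^esub> s) (s \<otimes>\<^bsub>R\<^esub> t)) \<rparr>"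

lemma (in primeideal) one_notin: "\<one> \<notin> I"
  using I_notcarr one_imp_carrier by blast

lemma (in primeideal) compl_mult:
  "s \<in> carrier R - I \<Longrightarrow> t \<in> carrier R - I \<Longrightarrow> s \<otimes> t \<in> carrier R - I"
  using I_prime by auto

lemma loc_rel_iff: "((a, s), (b, t)) \<in> loc_rel R p \<longleftrightarrow>
    a \<in> carrier R \<and> b \<in> carrier R \<and> s \<in> carrier R - p \<and> t \<in> carrier R - p \<and>
       (\<exists>u \<in> carrier R - p. u \<otimes>\<^bsub>R\<^esub> (a \<otimes>\<^bsub>R\<^esub> t) = u \<otimes>\<^bsub>R\<^esub> (b \<otimes>\<^bsub>R\<^esub> s))"
  by (simp add: loc_rel_def)

lemma (in primeideal) equiv_loc_rel: "equiv (carrier R \<times> (carrier R - I)) (loc_rel R I)"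
proof (rule equivI)
  show "loc_rel R I \<subseteq> (carrier R \<times> (carrier R - I)) \<times> (carrier R \<times> (carrier R - I))"
    by (auto simp: loc_rel_def)
  show "refl_on (carrier R \<times> (carrier R - I)) (loc_rel R I)"
    using one_notin by (auto simp: loc_rel_iff refl_on_def intro!: bexI[of _ \<one>])
  show "sym (loc_rel R I)"
    by (rule symI, clarsimp simp: loc_rel_iff, metis DiffI)
  show "trans (loc_rel R I)"
  proof (rule transI)
    fix x y z assume "(x, y) \<in> loc_rel R I" "(y, z) \<in> loc_rel R I"
    then obtain a s b t c r u v where
      xyz: "x = (a,s)" "y = (b,t)" "z = (c,r)" and
      [simp]: "a \<in> carrier R" "b \<in> carrier R" "c \<in> carrier R" and
      n: "s \<in> carrier R - I" "t \<in> carrier R - I" "r \<in> carrier R - I"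
        "u \<in> carrier R - I" "v \<in> carrier R - I" and
      e: "u \<otimes> (a \<otimes> t) = u \<otimes> (b \<otimes> s)" "v \<otimes> (b \<otimes> r) = v \<otimes> (c \<otimes> t)"
      by (auto simp: loc_rel_def)
    have [simp]: "s \<in> carrier R" "t \<in> carrier R" "r \<in> carrier R" "u \<in> carrier R" "v \<in> carrier R"
      using n by auto
    have "(u \<otimes> v \<otimes> t) \<otimes> (a \<otimes> r) = (u \<otimes> (a \<otimes> t)) \<otimes> (v \<otimes> r)"
      by (simp add: m_ac)
    also have "\<dots> = (v \<otimes> (b \<otimes> r)) \<otimes> (u \<otimes> s)"
      unfolding e(1) by (simp add: m_ac)
    also have "\<dots> = (u \<otimes> v \<otimes> t) \<otimes> (c \<otimes> s)"
      unfolding e(2) by (simp add: m_ac)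
    finally have "(u \<otimes> v \<otimes> t) \<otimes> (a \<otimes> r) = (u \<otimes> v \<otimes> t) \<otimes> (c \<otimes> s)" .
    moreover have "u \<otimes> v \<otimes> t \<in> carrier R - I" using n compl_mult by blast
    ultimately show "(x, z) \<in> loc_rel R I"
      using n \<open>a \<in> carrier R\<close> \<open>c \<in> carrier R\<close> unfolding xyz loc_rel_iff by blast
  qed
qed

lemma (in primeideal) fraction_eq_iff:
  assumes "a \<in> carrier R" "b \<in> carrier R" "s \<in> carrier R - I" "t \<in> carrier R - I"
  shows "fraction R I a s = fraction R I b t \<longleftrightarrow>
    (\<exists>u \<in> carrier R - I. u \<otimes> (a \<otimes> t) = u \<otimes> (b \<otimes> s))"
  unfolding fraction_def using assms
  by (subst eq_equiv_class_iff[OF equiv_loc_rel]) (auto simp: loc_rel_def)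

lemma (in primeideal) fraction_eqI:
  assumes "a \<in> carrier R" "b \<in> carrier R" "s \<in> carrier R - I" "t \<in> carrier R - I"
    "(a \<otimes> t) = (b \<otimes> s)"
  shows "fraction R I a s = fraction R I b t"
  using assms one_notin by (subst fraction_eq_iff) auto

lemma (in primeideal) fraction_closed:
  "a \<in> carrier R \<Longrightarrow> s \<in> carrier R - I \<Longrightarrow> fraction R I a s \<in> carrier (localization R I)"
  by (simp add: localization_def fraction_def quotientI)

lemma (in primeideal) localization_cases:
  assumes "x \<in> carrier (localization R I)"
  obtains a s where "a \<in> carrier R" "s \<in> carrier R - I" "x = fraction R I a s"
  using assms by (auto simp: localization_def fraction_def quotient_def)

lemma (in primeideal) mult_fraction:
  assumes "a \<in> carrier R" "b \<in> carrier R" "s \<in> carrier R - I" "t \<in> carrier R - I"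
  shows "fraction R I a s \<otimes>\<^bsub>localization R I\<^esub> fraction R I b t = fraction R I (a \<otimes> b) (s \<otimes> t)"
proof -
  have "(\<lambda>x y. case x of (a, s) \<Rightarrow> case y of (b, t) \<Rightarrow> fraction R I (a \<otimes> b) (s \<otimes> t)) respects2 loc_rel R I"
  proof (rule congruent2_commuteI[OF equiv_loc_rel], goal_cases)
    case (1 y z) then show ?case by (auto simp: m_comm split: prod.splits)
  next
    case (2 y z w)
    then obtain a s b t c r u where
      yzw: "y = (a,s)" "z = (b,t)" "w = (c,r)" and
      [simp]: "a \<in> carrier R" "b \<in> carrier R" "c \<in> carrier R" and
      n: "s \<in> carrier R - I" "t \<in> carrier R - I" "r \<in> carrier R - I"
        "u \<in> carrier R - I"  and
      e: "u \<otimes> (a \<otimes> t) = u \<otimes> (b \<otimes> s)"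
      by (auto simp: loc_rel_def)
    have [simp]: "s \<in> carrier R" "t \<in> carrier R" "r \<in> carrier R" "u \<in> carrier R" 
      using n by auto
    have "u \<otimes> (c \<otimes> a \<otimes> (r \<otimes> t)) = (u \<otimes> (a \<otimes> t)) \<otimes> (c \<otimes> r)" by (simp add: m_ac)
    also have "\<dots> = u \<otimes> (c \<otimes> b \<otimes> (r \<otimes> s))" unfolding e by (simp add: m_ac)
    finally show ?case unfolding yzw using n compl_mult
      by (auto simp: fraction_eq_iff)
  qed
  from UN_equiv_class2[OF equiv_loc_rel equiv_loc_rel this, of "(a,s)" "(b,t)"] assms
  show ?thesis unfolding localization_def fraction_def[of R I a s] fraction_def[of R I b t]
    by (simp add: case_prod_unfold)
qed

lemma (in primeideal) add_fraction:
  assumes "a \<in> carrier R" "b \<in> carrier R" "s \<in> carrier R - I" "t \<in> carrier R - I"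
  shows "fraction R I a s \<oplus>\<^bsub>localization R I\<^esub> fraction R I b t = fraction R I (a \<otimes> t \<oplus> b \<otimes> s) (s \<otimes> t)"
proof -
  have "(\<lambda>x y. case x of (a, s) \<Rightarrow> case y of (b, t) \<Rightarrow> fraction R I (a \<otimes> t \<oplus> b \<otimes> s) (s \<otimes> t)) respects2 loc_rel R I"
  proof (rule congruent2_commuteI[OF equiv_loc_rel], goal_cases)
    case (1 y z) then show ?case by (auto simp: m_comm a_comm split: prod.splits)
  next
    case (2 y z w)
    then obtain a s b t c r u where
      yzw: "y = (a,s)" "z = (b,t)" "w = (c,r)" and
      [simp]: "a \<in> carrier R" "b \<in> carrier R" "c \<in> carrier R" and
      n: "s \<in> carrier R - I" "t \<in> carrier R - I" "r \<in> carrier R - I"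
        "u \<in> carrier R - I"  and
      e: "u \<otimes> (a \<otimes> t) = u \<otimes> (b \<otimes> s)"
      by (auto simp: loc_rel_def)
    have [simp]: "s \<in> carrier R" "t \<in> carrier R" "r \<in> carrier R" "u \<in> carrier R" 
      using n by auto
    have "u \<otimes> ((c \<otimes> s \<oplus> a \<otimes> r) \<otimes> (r \<otimes> t)) = u \<otimes> (c \<otimes> s \<otimes> (r \<otimes> t)) \<oplus> (u \<otimes> (a \<otimes> t)) \<otimes> (r \<otimes> r)" 
      by (simp add: m_ac l_distr r_distr)
    also have "\<dots> = u \<otimes> ((c \<otimes> t \<oplus> b \<otimes> r) \<otimes> (r \<otimes> s))" unfolding e by (simp add: m_ac l_distr r_distr)
    finally show ?case unfolding yzw using n compl_mult
      by (auto simp: fraction_eq_iff)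
  qed
  from UN_equiv_class2[OF equiv_loc_rel equiv_loc_rel this, of "(a,s)" "(b,t)"] assms
  show ?thesis unfolding localization_def fraction_def[of R I a s] fraction_def[of R I b t]
    by (simp add: case_prod_unfold)
qed

lemma (in primeideal) cring_localization: "cring (localization R I)"
proof -
  have oz: "\<one>\<^bsub>localization R I\<^esub> = fraction R I \<one> \<one>" "\<zero>\<^bsub>localization R I\<^esub> = fraction R I \<zero> \<one>"
    by (simp_all add: localization_def)
  have o: "\<one> \<in> carrier R - I" using one_notin by simp
  note [simp] = mult_fraction add_fraction oz 
  note m = compl_mult[simplified] one_notin
  show ?thesis
  proof (rule cringI)
    show "abelian_group (localization R I)"
    proof (rule abelian_groupI, goal_cases)
      case (1 x y) then show ?case
        by (elim localization_cases) (simp add: m fraction_closed)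
    next case 2 show ?case using o by (auto intro: fraction_closed)
    next case (3 x y z) then show ?case
        by (elim localization_cases) ((simp add: m; fail) | (simp add: m, rule fraction_eqI; (simp add: m; fail | algebra)))
    next case (4 x y) then show ?case
        by (elim localization_cases) ((simp add: m; fail) | (simp add: m, rule fraction_eqI; (simp add: m; fail | algebra)))
    next case (5 x) then show ?case
        by (elim localization_cases) ((simp add: m; fail) | (simp add: m, rule fraction_eqI; (simp add: m; fail | algebra)))
    next case (6 x) then show ?case
      proof (elim localization_cases)
        fix a s assume *: "a \<in> carrier R" "s \<in> carrier R - I" "x = fraction R I a s"
        then show ?thesis 
          by (intro bexI[of _ "fraction R I (\<ominus> a) s"]; simp add: m fraction_closed)
             (rule fraction_eqI; (simp add: m; fail | algebra))
      qed
    qed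
    show "comm_monoid (localization R I)"
    proof (rule comm_monoidI, goal_cases)
      case (1 x y) then show ?case
        by (elim localization_cases) (simp add: m fraction_closed)
    next case 2 show ?case using o by (auto intro: fraction_closed)
    next case (3 x y z) then show ?case
        by (elim localization_cases) ((simp add: m; fail) | (simp add: m, rule fraction_eqI; (simp add: m; fail | algebra)))
    next case (4 x) then show ?case
        by (elim localization_cases) ((simp add: m; fail) | (simp add: m, rule fraction_eqI; (simp add: m; fail | algebra)))
    next case (5 x y) then show ?case
        by (elim localization_cases) ((simp add: m; fail) | (simp add: m, rule fraction_eqI; (simp add: m; fail | algebra)))
    qed
    show "(x \<oplus>\<^bsub>localization R I\<^esub> y) \<otimes>\<^bsub>localization R I\<^esub> z =
       x \<otimes>\<^bsub>localization R I\<^esub> z \<oplus>\<^bsub>localization R I\<^esub> y \<otimes>\<^bsub>localization R I\<^esub> z"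
      if "x \<in> carrier (localization R I)" "y \<in> carrier (localization R I)" "z \<in> carrier (localization R I)"
      for x y z
      using that
        by (elim localization_cases) ((simp add: m; fail) | (simp add: m, rule fraction_eqI; (simp add: m; fail | algebra)))
  qed
qed

definition extended_ideal :: "('a, 'm) ring_scheme \<Rightarrow> 'a set \<Rightarrow> 'a set \<Rightarrow> ('a \<times> 'a) set set"
  where "extended_ideal R p I = Idl\<^bsub>localization R p\<^esub> ((\<lambda>a. fraction R p a \<one>\<^bsub>R\<^esub>) ` I)"

definition residue_field :: "('a, 'm) ring_scheme \<Rightarrow> 'a set \<Rightarrow> ('a \<times> 'a) set set ring"
  where "residue_field R p = localization R p Quot extended_ideal R p p"

definition characteristic_zero :: "('a, 'm) ring_scheme \<Rightarrow> bool"
  where "characteristic_zero K \<longleftrightarrow> (\<forall>n::nat. n > 0 \<longrightarrow> [n] \<cdot>\<^bsub>K\<^esub> \<one>\<^bsub>K\<^esub> \<noteq> \<zero>\<^bsub>K\<^esub>)"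

definition standard_diff_ring :: "('a, 'm) diff_ring_scheme \<Rightarrow> bool"
  where "standard_diff_ring R \<longleftrightarrow> (\<forall>p \<in> diff_Spec R. characteristic_zero (residue_field R p))"

definition Delta_arithmetical :: "('a, 'm) diff_ring_scheme \<Rightarrow> bool"
  where "Delta_arithmetical A \<longleftrightarrow>
    (\<forall>F p. finite F \<and> F \<subseteq> carrier A \<and> p \<in> diff_Spec A \<longrightarrow>
       principalideal (extended_ideal A p (Idl\<^bsub>A\<^esub> F)) (localization A p))"


section \<open>Gap measure\<close>

definition descending_chain :: "'a set set \<Rightarrow> 'a set \<Rightarrow> 'a set \<Rightarrow> (nat \<Rightarrow> 'a set) \<Rightarrow> bool"
  where "descending_chain S p p' c \<longleftrightarrow>
    c 0 = p \<and> (\<forall>i. c i \<in> S \<and> p' \<subseteq> c i \<and> c (Suc i) \<subset> c i)"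

text \<open>Nonnegativity of the values is built into the type \<^typ>\<open>enat\<close>.\<close>

definition is_gap_measure :: "'a set set \<Rightarrow> ('a set \<Rightarrow> 'a set \<Rightarrow> enat) \<Rightarrow> bool"
  where "is_gap_measure S \<mu> \<longleftrightarrow>
    (\<forall>p\<in>S. \<forall>p'\<in>S. p' \<subseteq> p \<longrightarrow>
       (\<mu> p p' = 0 \<longleftrightarrow> p = p' \<or> (\<nexists>c. descending_chain S p p' c)) \<and>
       (\<forall>d::nat. d > 0 \<longrightarrow>
          (enat d \<le> \<mu> p p' \<longleftrightarrow>
             p \<noteq> p' \<and> (\<exists>c. descending_chain S p p' c \<and>
                         (\<forall>i\<ge>1. enat (d - 1) \<le> \<mu> (c (i - 1)) (c i))))))"

text \<open>
  The axioms determine \<open>\<mu> p p'\<close> only for \<open>p, p' \<in> S\<close> with \<open>p' \<subseteq> p\<close>;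
  the value is fixed to \<open>0\<close> at all other arguments, so that the function is unique.
\<close>

definition gap_measure :: "'a set set \<Rightarrow> 'a set \<Rightarrow> 'a set \<Rightarrow> enat"
  where "gap_measure S =
    (THE \<mu>. is_gap_measure S \<mu> \<and>
       (\<forall>p p'. \<not> (p \<in> S \<and> p' \<in> S \<and> p' \<subseteq> p) \<longrightarrow> \<mu> p p' = 0))"

primrec gap_ge :: "'a set set \<Rightarrow> nat \<Rightarrow> 'a set \<Rightarrow> 'a set \<Rightarrow> bool"
  where
    "gap_ge S 0 p p' \<longleftrightarrow> True"
  | "gap_ge S (Suc d) p p' \<longleftrightarrow>
       p \<noteq> p' \<and> (\<exists>c. descending_chain S p p' c \<and> (\<forall>i. gap_ge S d (c i) (c (Suc i))))"

lemma gap_ge_Suc_imp: "gap_ge S (Suc d) p p' \<Longrightarrow> gap_ge S d p p'"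
proof (induction d arbitrary: p p')
  case (Suc d)
  then obtain c where "p \<noteq> p'" "descending_chain S p p' c"
    "\<forall>i. gap_ge S (Suc d) (c i) (c (Suc i))"
    by auto
  with Suc.IH show ?case
    by auto
qed simp

lemma gap_ge_antimono: "d \<le> e \<Longrightarrow> gap_ge S e p p' \<Longrightarrow> gap_ge S d p p'"
  by (induction e rule: dec_induct) (auto dest: gap_ge_Suc_imp simp del: gap_ge.simps)

lemma enat_le_SUP_iff:
  assumes "P 0" "\<And>d e. d \<le> e \<Longrightarrow> P e \<Longrightarrow> P d"
  shows "enat d \<le> (SUP e\<in>Collect P. enat e) \<longleftrightarrow> P d"
proof
  assume le: "enat d \<le> (SUP e\<in>Collect P. enat e)"
  show "P d"
  proof (rule ccontr)
    assume nP: "\<not> P d"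
    have "e < d" if "P e" for e
      using assms(2)[of d e] nP that by (meson not_le)
    moreover have "d > 0"
      using nP assms(1) by (cases d) auto
    ultimately have "(SUP e\<in>Collect P. enat e) \<le> enat (d - 1)"
      by (intro SUP_least) force
    with le have "enat d \<le> enat (d - 1)"
      by (rule order_trans)
    with \<open>d > 0\<close> show False
      by simp
  qed
qed (auto intro: SUP_upper)

lemma enat_leI: "a \<le> b" if "\<And>d. enat d \<le> a \<Longrightarrow> enat d \<le> b"
proof (cases b)
  case (enat n)
  then have "\<not> enat (Suc n) \<le> a"
    using that[of "Suc n"] by auto
  then show ?thesis
    using enat by (cases a) auto
qed simp

lemma is_gap_measure_iff:
  "is_gap_measure S \<mu> \<longleftrightarrow>
     (\<forall>p\<in>S. \<forall>p'\<in>S. p' \<subseteq> p \<longrightarrow> (\<forall>d. enat d \<le> \<mu> p p' \<longleftrightarrow> gap_ge S d p p'))"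
  (is "_ \<longleftrightarrow> ?rhs")
proof
  assume gm: "is_gap_measure S \<mu>"
  have "enat d \<le> \<mu> p p' \<longleftrightarrow> gap_ge S d p p'" if "p \<in> S" "p' \<in> S" "p' \<subseteq> p" for p p' d
    using that
  proof (induction d arbitrary: p p')
    case 0
    then show ?case by (simp add: zero_enat_def[symmetric])
  next
    case (Suc d)
    have step: "enat d \<le> \<mu> (c i) (c (Suc i)) \<longleftrightarrow> gap_ge S d (c i) (c (Suc i))"
      if "descending_chain S p p' c" for c i
      using that by (intro Suc.IH) (auto simp: descending_chain_def)
    have "enat (Suc d) \<le> \<mu> p p' \<longleftrightarrow>
        p \<noteq> p' \<and> (\<exists>c. descending_chain S p p' c \<and>
                    (\<forall>i\<ge>1. enat d \<le> \<mu> (c (i - 1)) (c i)))"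
      using gm Suc.prems unfolding is_gap_measure_def by force
    also have "\<dots> \<longleftrightarrow> p \<noteq> p' \<and> (\<exists>c. descending_chain S p p' c \<and>
                    (\<forall>i. enat d \<le> \<mu> (c i) (c (Suc i))))"
      by (metis One_nat_def Suc_le_D diff_Suc_1 le_add1 plus_1_eq_Suc)
    also have "\<dots> \<longleftrightarrow> gap_ge S (Suc d) p p'"
      using step by auto
    finally show ?case .
  qed
  then show ?rhs by blast
next
  assume rhs: ?rhs
  have step: "enat d \<le> \<mu> (c i) (c (Suc i)) \<longleftrightarrow> gap_ge S d (c i) (c (Suc i))"
    if "descending_chain S p p' c" for c i d p p'
    using that rhs by (auto simp: descending_chain_def)
  have pos: "enat (Suc d) \<le> \<mu> p p' \<longleftrightarrow>
      p \<noteq> p' \<and> (\<exists>c. descending_chain S p p' c \<and> (\<forall>i\<ge>1. enat d \<le> \<mu> (c (i - 1)) (c i)))"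
    if "p \<in> S" "p' \<in> S" "p' \<subseteq> p" for p p' d
  proof -
    have "enat (Suc d) \<le> \<mu> p p' \<longleftrightarrow> gap_ge S (Suc d) p p'"
      using rhs that by blast
    also have "\<dots> \<longleftrightarrow> p \<noteq> p' \<and> (\<exists>c. descending_chain S p p' c \<and>
                    (\<forall>i. enat d \<le> \<mu> (c i) (c (Suc i))))"
      using step by auto
    also have "\<dots> \<longleftrightarrow> p \<noteq> p' \<and> (\<exists>c. descending_chain S p p' c \<and>
                    (\<forall>i\<ge>1. enat d \<le> \<mu> (c (i - 1)) (c i)))"
      by (metis One_nat_def Suc_le_D diff_Suc_1 le_add1 plus_1_eq_Suc)
    finally show ?thesis .
  qed
  have zero: "\<mu> p p' = 0 \<longleftrightarrow> p = p' \<or> (\<nexists>c. descending_chain S p p' c)"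
    if "p \<in> S" "p' \<in> S" "p' \<subseteq> p" for p p'
  proof -
    have "\<mu> p p' \<noteq> 0 \<longleftrightarrow> enat (Suc 0) \<le> \<mu> p p'"
      by (metis One_nat_def ileI1 not_one_le_zero one_eSuc one_enat_def zero_less_iff_neq_zero)
    also have "\<dots> \<longleftrightarrow> p \<noteq> p' \<and> (\<exists>c. descending_chain S p p' c)"
      using pos[OF that, of 0] by (simp add: zero_enat_def[symmetric])
    finally show ?thesis by blast
  qed
  show "is_gap_measure S \<mu>"
    unfolding is_gap_measure_def
  proof (intro ballI impI conjI allI)
    fix p p' and d :: nat
    assume *: "p \<in> S" "p' \<in> S" "p' \<subseteq> p"
    show "\<mu> p p' = 0 \<longleftrightarrow> p = p' \<or> (\<nexists>c. descending_chain S p p' c)"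
      by (rule zero[OF *])
    assume "d > 0"
    then show "enat d \<le> \<mu> p p' \<longleftrightarrow> p \<noteq> p' \<and> (\<exists>c. descending_chain S p p' c \<and>
                    (\<forall>i\<ge>1. enat (d - 1) \<le> \<mu> (c (i - 1)) (c i)))"
      using pos[OF *, of "d - 1"] by simp
  qed
qed

lemma ex1_gap_measure:
  "\<exists>!\<mu>. is_gap_measure S \<mu> \<and> (\<forall>p p'. \<not> (p \<in> S \<and> p' \<in> S \<and> p' \<subseteq> p) \<longrightarrow> \<mu> p p' = 0)"
proof -
  define \<mu> where "\<mu> = (\<lambda>p p'. if p \<in> S \<and> p' \<in> S \<and> p' \<subseteq> p
                               then SUP d\<in>{d. gap_ge S d p p'}. enat d else 0)"
  have ge: "enat d \<le> (SUP d\<in>{d. gap_ge S d p p'}. enat d) \<longleftrightarrow> gap_ge S d p p'" for d p p'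
    by (rule enat_le_SUP_iff) (auto intro: gap_ge_antimono)
  show ?thesis
  proof (rule ex1I[of _ \<mu>])
    show "is_gap_measure S \<mu> \<and> (\<forall>p p'. \<not> (p \<in> S \<and> p' \<in> S \<and> p' \<subseteq> p) \<longrightarrow> \<mu> p p' = 0)"
      unfolding is_gap_measure_iff by (auto simp: \<mu>_def ge)
  next
    fix \<nu> :: "'a set \<Rightarrow> 'a set \<Rightarrow> enat"
    assume \<nu>: "is_gap_measure S \<nu> \<and> (\<forall>p p'. \<not> (p \<in> S \<and> p' \<in> S \<and> p' \<subseteq> p) \<longrightarrow> \<nu> p p' = 0)"
    have "\<nu> p p' = \<mu> p p'" for p p'
    proof (cases "p \<in> S \<and> p' \<in> S \<and> p' \<subseteq> p")
      case True
      then have "enat d \<le> \<nu> p p' \<longleftrightarrow> enat d \<le> \<mu> p p'" for d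
        using \<nu> by (auto simp: is_gap_measure_iff \<mu>_def ge)
      then show ?thesis
        by - (rule antisym; rule enat_leI; simp)
    qed (use \<nu> in \<open>auto simp: \<mu>_def\<close>)
    then show "\<nu> = \<mu>" by blast
  qed
qed


section \<open>Differential type and dimension\<close>

definition diff_type :: "('a, 'm) diff_ring_scheme \<Rightarrow> enat"
  where "diff_type R =
    Sup {gap_measure (diff_Spec R) p p' |p p'. p \<in> diff_Spec R \<and> p' \<in> diff_Spec R \<and> p' \<subseteq> p}"

definition diff_dim :: "('a, 'm) diff_ring_scheme \<Rightarrow> enat"
  where "diff_dim R =
    Sup {enat k |k. \<exists>p. (\<forall>i\<le>k. p i \<in> diff_Spec R) \<and>
                       (\<forall>i\<in>{1..k}. p i \<subset> p (i - 1) \<and>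
                          gap_measure (diff_Spec R) (p (i - 1)) (p i) = diff_type R)}"


section \<open>Differential polynomials\<close>

text \<open>
  The pair \<open>(i, j)\<close> with \<open>i < n\<close> stands for the \<open>j\<close>-th derivative of the indeterminate
  \<open>z\<^sub>i\<^sub>+\<^sub>1\<close>.  As in \<^theory>\<open>HOL-Algebra.Indexed_Polynomials\<close>, a polynomial maps each
  monomial, a multiset of such pairs, to its coefficient.

  Collecting the terms of \<open>\<Sum>c\<^sub>m \<cdot> m\<close> after applying the product rule, the coefficient of \<open>m\<close>
  in the derivative gets \<open>\<delta> c\<^sub>m\<close> together with, for each \<open>(i, Suc j)\<close> in \<open>m\<close>, a contribution from
  the monomial \<open>m'\<close> obtained from \<open>m\<close> by replacing one factor \<open>(i, Suc j)\<close> by \<open>(i, j)\<close>; the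
  multiplicity of \<open>(i, j)\<close> in \<open>m'\<close> is one more than in \<open>m\<close>.
\<close>

type_synonym diff_monomial = "(nat \<times> nat) multiset"

definition mpoly_mult ::
    "('a, 'm) ring_scheme \<Rightarrow> ('c multiset \<Rightarrow> 'a) \<Rightarrow> ('c multiset \<Rightarrow> 'a) \<Rightarrow> ('c multiset \<Rightarrow> 'a)"
  where "mpoly_mult R P Q = (\<lambda>m. \<Oplus>\<^bsub>R\<^esub>k\<in>{k. k \<subseteq># m}. P k \<otimes>\<^bsub>R\<^esub> Q (m - k))"

definition mpoly_der ::
    "('a, 'm) diff_ring_scheme \<Rightarrow> (diff_monomial \<Rightarrow> 'a) \<Rightarrow> (diff_monomial \<Rightarrow> 'a)"
  where "mpoly_der R P = (\<lambda>m. \<delta>\<^bsub>R\<^esub> (P m) \<oplus>\<^bsub>R\<^esub>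
    finsum R (\<lambda>(i, j). [Suc (count m (i, j))] \<cdot>\<^bsub>R\<^esub> P (m - {#(i, Suc j)#} + {#(i, j)#}))
      {(i, j). (i, Suc j) \<in># m})"

definition diff_poly_ring ::
    "('a, 'm) diff_ring_scheme \<Rightarrow> nat \<Rightarrow> (diff_monomial \<Rightarrow> 'a) diff_ring"
  where "diff_poly_ring R n =
    \<lparr> carrier = ring.indexed_pset R ({..<n} \<times> UNIV) (carrier R),
      monoid.mult = mpoly_mult R,
      one = ring.indexed_const R \<one>\<^bsub>R\<^esub>,
      ring.zero = ring.indexed_const R \<zero>\<^bsub>R\<^esub>,
      ring.add = ring.indexed_padd R,
      der = mpoly_der R \<rparr>"


lemma finite_submultisets: "finite {k. k \<subseteq># (m::'c multiset)}"
proof (rule finite_subset)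
  show "{k. k \<subseteq># m} \<subseteq> mset ` {xs. set xs \<subseteq> set_mset m \<and> length xs \<le> size m}"
  proof
    fix k assume "k \<in> {k. k \<subseteq># m}"
    moreover obtain xs where "mset xs = k" using ex_mset by blast
    ultimately show "k \<in> mset ` {xs. set xs \<subseteq> set_mset m \<and> length xs \<le> size m}"
      by (intro image_eqI[of _ _ xs]) (auto dest: mset_subset_eqD size_mset_mono)
  qed
qed (simp add: finite_lists_length_le)

lemma diff_diff_submultiset [simp]: "k \<subseteq># m \<Longrightarrow> m - (m - k) = (k :: 'c multiset)"
  by (simp add: multiset_eq_iff mset_subset_eq_count)

context cring begin

lemma mpoly_mult_closed: "carrier_coeff P \<Longrightarrow> carrier_coeff Q \<Longrightarrow> carrier_coeff (mpoly_mult R P Q)"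
  unfolding carrier_coeff_def mpoly_mult_def by (auto intro!: finsum_closed)

lemma mpoly_mult_const:
  assumes "carrier_coeff P" "c \<in> carrier R"
  shows "mpoly_mult R P (indexed_const c) = (\<lambda>m. P m \<otimes> c)"
proof
  fix m
  have "mpoly_mult R P (indexed_const c) m = (\<Oplus>k\<in>{k. k \<subseteq># m}. if m = k then P k \<otimes> c else \<zero>)"
    unfolding mpoly_mult_def indexed_const_def using assms
    by (intro finsum_cong') (auto simp: carrier_coeff_def Diff_eq_empty_iff_mset subset_mset.antisym)
  also have "\<dots> = P m \<otimes> c"
    using assms by (intro finsum_singleton) (auto simp: carrier_coeff_def finite_submultisets)
  finally show "mpoly_mult R P (indexed_const c) m = P m \<otimes> c" .
qed

lemma mpoly_mult_comm:
  fixes P Q :: "'c multiset \<Rightarrow> 'a"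
  assumes "carrier_coeff P" "carrier_coeff Q"
  shows "mpoly_mult R P Q = mpoly_mult R Q P"
proof
  fix m :: "'c multiset"
  have im: "(\<lambda>k. m - k) ` {k. k \<subseteq># m} = {k. k \<subseteq># m}"
  proof (intro equalityI subsetI)
    fix k assume "k \<in> {k. k \<subseteq># m}"
    then show "k \<in> (\<lambda>k. m - k) ` {k. k \<subseteq># m}"
      by (intro image_eqI[of _ _ "m - k"]) (simp_all add: multiset_eq_iff mset_subset_eq_count)
  qed auto
  have inj: "inj_on (\<lambda>k. m - k) {k. k \<subseteq># m}"
    by (rule inj_on_inverseI[of _ "\<lambda>k. m - k"]) auto
  have "mpoly_mult R P Q m = (\<Oplus>k\<in>(\<lambda>k. m - k) ` {k. k \<subseteq># m}. P k \<otimes> Q (m - k))"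
    unfolding mpoly_mult_def im ..
  also have "\<dots> = (\<Oplus>k\<in>{k. k \<subseteq># m}. P (m - k) \<otimes> Q (m - (m - k)))"
    using assms by (intro finsum_reindex inj) (auto simp: carrier_coeff_def)
  also have "\<dots> = mpoly_mult R Q P m"
    unfolding mpoly_mult_def using assms by (intro finsum_cong') (auto simp: carrier_coeff_def m_comm)
  finally show "mpoly_mult R P Q m = mpoly_mult R Q P m" .
qed

lemma mpoly_mult_add:
  assumes "carrier_coeff P" "carrier_coeff Q" "carrier_coeff Q'"
  shows "mpoly_mult R P (indexed_padd Q Q') = indexed_padd (mpoly_mult R P Q) (mpoly_mult R P Q')"
proof
  fix m
  have "mpoly_mult R P (indexed_padd Q Q') m = (\<Oplus>k\<in>{k. k \<subseteq># m}. P k \<otimes> Q (m - k) \<oplus> P k \<otimes> Q' (m - k))"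
    unfolding mpoly_mult_def indexed_padd_def using assms
    by (intro finsum_cong') (auto simp: carrier_coeff_def r_distr)
  also have "\<dots> = indexed_padd (mpoly_mult R P Q) (mpoly_mult R P Q') m"
    unfolding mpoly_mult_def indexed_padd_def using assms
    by (intro finsum_addf) (auto simp: carrier_coeff_def)
  finally show "mpoly_mult R P (indexed_padd Q Q') m = indexed_padd (mpoly_mult R P Q) (mpoly_mult R P Q') m" .
qed

lemma mpoly_mult_pmult:
  assumes "carrier_coeff P" "carrier_coeff Q" 
  shows "mpoly_mult R P (indexed_pmult Q i) = indexed_pmult (mpoly_mult R P Q) i"
proof
  fix m
  show "mpoly_mult R P (indexed_pmult Q i) m = indexed_pmult (mpoly_mult R P Q) i m"
  proof (cases "i \<in># m")
    case False
    then have "i \<notin># m - k" for k by (meson in_diffD)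
    then show ?thesis using False assms
      by (auto simp: mpoly_mult_def indexed_pmult_def carrier_coeff_def)
  next
    case True
    then obtain n where m: "m = add_mset i n" by (meson multi_member_split)
    have "mpoly_mult R P (indexed_pmult Q i) m =
       (\<Oplus>k\<in>{k. k \<subseteq># m}. P k \<otimes> (if i \<in># m - k then Q (m - k - {#i#}) else \<zero>))"
      by (simp add: mpoly_mult_def indexed_pmult_def)
    also have "\<dots> = (\<Oplus>k\<in>{k. k \<subseteq># n}. P k \<otimes> Q (n - k))"
    proof (rule add.finprod_mono_neutral_cong)
      fix k assume k: "k \<in> {k. k \<subseteq># m} - {k. k \<subseteq># n}"
      have "i \<notin># m - k"
      proof
        assume "i \<in># m - k"
        then have "count k i < count m i" by (simp add: in_diff_count)
        have "k \<subseteq># n"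
        proof (rule mset_subset_eqI)
          fix x
          have "count k x \<le> count m x" using k by (simp add: mset_subset_eq_count)
          then show "count k x \<le> count n x"
            using \<open>count k i < count m i\<close> by (cases "x = i") (auto simp: m)
        qed
        then show False using k by simp
      qed
      then show "P k \<otimes> (if i \<in># m - k then Q (m - k - {#i#}) else \<zero>) = \<zero>"
        using assms by (auto simp: carrier_coeff_def)
    next
      fix k assume k: "k \<in> {k. k \<subseteq># m} \<inter> {k. k \<subseteq># n}"
      then have "m - k = add_mset i (n - k)" unfolding m
      by (auto simp: multiset_eq_iff Suc_diff_le mset_subset_eq_count)
      then show "P k \<otimes> (if i \<in># m - k then Q (m - k - {#i#}) else \<zero>) = P k \<otimes> Q (n - k)" by simp
    next
      fix k assume "k \<in> {k. k \<subseteq># n} - {k. k \<subseteq># m}"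
      then show "P k \<otimes> Q (n - k) = \<zero>" unfolding m
        by (auto dest: subset_mset.order_trans[OF _ multi_psub_of_add_self[THEN subset_mset.less_imp_le]])
    qed (use assms in \<open>auto simp: finite_submultisets carrier_coeff_def\<close>)
    also have "\<dots> = indexed_pmult (mpoly_mult R P Q) i m"
      unfolding m by (simp add: mpoly_mult_def indexed_pmult_def)
    finally show ?thesis .
  qed
qed

abbreviation "mpoly_set I \<equiv> indexed_pset I (carrier R)"

lemma mpoly_set_carrier_coeff: "P \<in> mpoly_set I \<Longrightarrow> carrier_coeff P"
  using indexed_pset_in_carrier by blast

lemma mpoly_set_scale: "P \<in> mpoly_set (I :: 'c set) \<Longrightarrow> c \<in> carrier R \<Longrightarrow> (\<lambda>m. P m \<otimes> c) \<in> mpoly_set I"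
proof (induction rule: indexed_pset.induct)
  case (indexed_const k)
  have "(\<lambda>m :: 'c multiset. indexed_const k m \<otimes> c) = indexed_const (k \<otimes> c)" using indexed_const by (auto simp: indexed_const_def)
  moreover have "indexed_const (k \<otimes> c) \<in> mpoly_set I"
    using indexed_const by (intro indexed_pset.indexed_const) simp
  ultimately show ?case by (simp only:)
next
  case (indexed_padd P Q)
  have "(\<lambda>m. indexed_padd P Q m \<otimes> c) = indexed_padd (\<lambda>m. P m \<otimes> c) (\<lambda>m. Q m \<otimes> c)"
    using indexed_padd mpoly_set_carrier_coeff[of P] mpoly_set_carrier_coeff[of Q] by (auto simp: indexed_padd_def l_distr carrier_coeff_def)
  then show ?case using indexed_padd by (simp add: indexed_pset.indexed_padd)
next
  case (indexed_pmult P i)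
  have "(\<lambda>m. indexed_pmult P i m \<otimes> c) = indexed_pmult (\<lambda>m. P m \<otimes> c) i"
    using indexed_pmult by (auto simp: indexed_pmult_def)
  then show ?case using indexed_pmult by (simp add: indexed_pset.indexed_pmult)
qed

lemma mpoly_set_mult:
  assumes "Q \<in> mpoly_set I" "P \<in> mpoly_set I" 
  shows "mpoly_mult R P Q \<in> mpoly_set I"
  using assms
proof (induction rule: indexed_pset.induct)
  case (indexed_const k) then show ?case by (simp add: mpoly_mult_const mpoly_set_carrier_coeff mpoly_set_scale)
next
  case (indexed_padd Q Q')
  then show ?case by (simp add: mpoly_mult_add mpoly_set_carrier_coeff indexed_pset.indexed_padd)
next
  case (indexed_pmult Q i)
  then show ?case by (simp add: mpoly_mult_pmult mpoly_set_carrier_coeff indexed_pset.indexed_pmult)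
qed

lemma mpoly_set_assoc:
  assumes "S \<in> mpoly_set I" "P \<in> mpoly_set I" "Q \<in> mpoly_set I"
  shows "mpoly_mult R (mpoly_mult R P Q) S = mpoly_mult R P (mpoly_mult R Q S)"
  using assms
proof (induction rule: indexed_pset.induct)
  case (indexed_const k)
  have c: "carrier_coeff P" "carrier_coeff Q" using indexed_const mpoly_set_carrier_coeff by auto
  show ?case
  proof
    fix m
    have "mpoly_mult R (mpoly_mult R P Q) (ring.indexed_const R k) m = mpoly_mult R P Q m \<otimes> k"
      using c indexed_const by (simp add: mpoly_mult_const mpoly_mult_closed)
    also have "\<dots> = (\<Oplus>j\<in>{j. j \<subseteq># m}. P j \<otimes> Q (m - j) \<otimes> k)"
      unfolding mpoly_mult_def using c indexed_const
      by (intro finsum_ldistr) (auto simp: carrier_coeff_def finite_submultisets)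
    also have "\<dots> = mpoly_mult R P (\<lambda>m. Q m \<otimes> k) m"
      unfolding mpoly_mult_def using c indexed_const
      by (intro finsum_cong') (auto simp: carrier_coeff_def m_assoc)
    finally show "mpoly_mult R (mpoly_mult R P Q) (ring.indexed_const R k) m = mpoly_mult R P (mpoly_mult R Q (ring.indexed_const R k)) m"
      using c indexed_const by (simp add: mpoly_mult_const mpoly_mult_closed)
  qed
next
  case (indexed_padd S S')
  then show ?case by (simp add: mpoly_mult_add mpoly_set_carrier_coeff mpoly_mult_closed)
next
  case (indexed_pmult S i)
  then show ?case by (simp add: mpoly_mult_pmult mpoly_set_carrier_coeff mpoly_mult_closed)
qed
end

context ordinary_diff_ring begin

lemma der_zero: "\<delta> \<zero> = \<zero>"
  by (metis add.l_cancel_one' der_add der_closed l_zero zero_closed)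

lemma der_one: "\<delta> \<one> = \<zero>"
  by (metis add.l_cancel_one' der_mult der_closed l_one one_closed r_one)

definition der_index :: "diff_monomial \<Rightarrow> (nat \<times> nat) set"
  where "der_index m = {(i, j). (i, Suc j) \<in># m}"

lemma finite_der_index: "finite (der_index m)"
proof -
  have "der_index m \<subseteq> (\<lambda>(i,j). (i, j - 1)) ` set_mset m" by (force simp: der_index_def)
  then show ?thesis by (meson finite_imageI finite_set_mset finite_subset)
qed

definition der_term :: "(diff_monomial \<Rightarrow> 'a) \<Rightarrow> diff_monomial \<Rightarrow> nat \<times> nat \<Rightarrow> 'a"
  where "der_term P m = (\<lambda>(i, j). [Suc (count m (i, j))] \<cdot> P (m - {#(i, Suc j)#} + {#(i, j)#}))"

lemma mpoly_der_alt: "mpoly_der R P m = \<delta> (P m) \<oplus> finsum R (der_term P m) (der_index m)"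
  unfolding mpoly_der_def der_index_def der_term_def ..

lemma der_term_closed: "carrier_coeff P \<Longrightarrow> der_term P m v \<in> carrier R"
  by (auto simp: der_term_def carrier_coeff_def split: prod.splits)

lemma mpoly_der_closed: "carrier_coeff P \<Longrightarrow> carrier_coeff (mpoly_der R P)"
  using der_term_closed[of P] unfolding carrier_coeff_def mpoly_der_alt by (auto intro!: finsum_closed)

lemma mpoly_der_const: "c \<in> carrier R \<Longrightarrow> mpoly_der R (indexed_const c) = indexed_const (\<delta> c)"
proof
  fix m :: diff_monomial assume c: "c \<in> carrier R"
  have "der_term (indexed_const c) m v = \<zero>" for v by (auto simp: der_term_def indexed_const_def split: prod.splits)
  then have "finsum R (der_term (indexed_const c) m) (der_index m) = \<zero>" by (intro add.finprod_one_eqI) auto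
  then show "mpoly_der R (indexed_const c) m = indexed_const (\<delta> c) m" using c
    unfolding mpoly_der_alt by (auto simp: indexed_const_def der_zero)
qed

lemma mpoly_der_padd:
  assumes "carrier_coeff P" "carrier_coeff Q"
  shows "mpoly_der R (indexed_padd P Q) = indexed_padd (mpoly_der R P) (mpoly_der R Q)"
proof
  fix m
  have "der_term (indexed_padd P Q) m = (\<lambda>v. der_term P m v \<oplus> der_term Q m v)"
    using assms by (auto simp: der_term_def indexed_padd_def carrier_coeff_def add.nat_pow_distrib a_ac split: prod.splits intro!: ext)
  moreover have "finsum R (\<lambda>v. der_term P m v \<oplus> der_term Q m v) (der_index m) = finsum R (der_term P m) (der_index m) \<oplus> finsum R (der_term Q m) (der_index m)"
    by (rule finsum_addf) (auto intro: der_term_closed assms)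
  ultimately have "finsum R (der_term (indexed_padd P Q) m) (der_index m) = finsum R (der_term P m) (der_index m) \<oplus> finsum R (der_term Q m) (der_index m)"
    by simp
  moreover have "finsum R (der_term P m) (der_index m) \<in> carrier R" "finsum R (der_term Q m) (der_index m) \<in> carrier R"
     using der_term_closed assms by (auto intro!: finsum_closed)
  ultimately show "mpoly_der R (indexed_padd P Q) m = indexed_padd (mpoly_der R P) (mpoly_der R Q) m"
    using assms unfolding mpoly_der_alt
    by (simp add: indexed_padd_def carrier_coeff_def der_add a_ac)
qed

lemma mpoly_der_pmult:
  assumes P: "carrier_coeff P"
  shows "mpoly_der R (indexed_pmult P (a, b)) =
    indexed_padd (indexed_pmult (mpoly_der R P) (a, b)) (indexed_pmult P (a, Suc b))"
proof
  fix m :: diff_monomial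
  let ?Q = "indexed_pmult P (a, b)" and ?v = "(a, b)" and ?v' = "(a, Suc b)"
  have Q: "carrier_coeff ?Q" using P by (rule indexed_pmult_in_carrier)
  have [simp]: "P k \<in> carrier R" for k using P by (simp add: carrier_coeff_def)
  define Y where "Y = (if ?v' \<in># m then P (m - {#?v'#}) else \<zero>)"
  have Y[simp]: "Y \<in> carrier R" by (simp add: Y_def)
  show "mpoly_der R ?Q m = indexed_padd (indexed_pmult (mpoly_der R P) ?v) (indexed_pmult P ?v') m"
  proof (cases "?v \<in># m")
    case False
    have "finsum R (der_term ?Q m) (der_index m) = Y"
    proof (cases "?v \<in> der_index m")
      case True
      have "finsum R (der_term ?Q m) (der_index m) = (\<Oplus>w\<in>der_index m. if ?v = w then der_term ?Q m w else \<zero>)"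
      proof (rule finsum_cong')
        fix w assume "w \<in> der_index m"
        show "der_term ?Q m w = (if ?v = w then der_term ?Q m w else \<zero>)"
        proof (cases "w = ?v")
          case False
          obtain i j where w: "w = (i, j)" by (cases w)
          have "?v \<notin># m - {#(i, Suc j)#} + {#(i, j)#}"
            using False \<open>?v \<notin># m\<close> by (auto simp: w dest: in_diffD)
          then have "?Q (m - {#(i, Suc j)#} + {#(i, j)#}) = \<zero>" unfolding indexed_pmult_def by (simp only: if_False)
          then show ?thesis using False by (auto simp: der_term_def w)
        qed auto
      qed (use der_term_closed[OF Q] in auto)
      also have "\<dots> = der_term ?Q m ?v"
        using True der_term_closed[OF Q] by (intro finsum_singleton finite_der_index) auto
      also have "\<dots> = Y" using True False by (simp add: der_term_def Y_def der_index_def indexed_pmult_def not_in_iff)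
      finally show ?thesis .
    next
      case nv: False
      have "finsum R (der_term ?Q m) (der_index m) = \<zero>"
      proof (rule add.finprod_one_eqI)
        fix w assume "w \<in> der_index m"
        then have "w \<noteq> ?v" using nv by auto
        obtain i j where w: "w = (i, j)" by (cases w)
        have "?v \<notin># m - {#(i, Suc j)#} + {#(i, j)#}"
          using \<open>w \<noteq> ?v\<close> \<open>?v \<notin># m\<close> by (auto simp: w dest: in_diffD)
        then have "?Q (m - {#(i, Suc j)#} + {#(i, j)#}) = \<zero>" unfolding indexed_pmult_def by (simp only: if_False)
        then show "der_term ?Q m w = \<zero>" by (simp add: der_term_def w)
      qed
      then show ?thesis using nv by (simp add: Y_def der_index_def)
    qed
    then show ?thesis using False
      by (simp add: mpoly_der_alt indexed_padd_def indexed_pmult_def der_zero flip: Y_def)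
  next
    case True
    then obtain n where m: "m = add_mset ?v n" by (meson multi_member_split)
    have "finsum R (der_term ?Q m) (der_index m) = finsum R (\<lambda>w. (if w \<in> der_index n then der_term P n w else \<zero>) \<oplus> (if ?v = w then Y else \<zero>)) (der_index m)"
    proof (rule finsum_cong')
      fix w assume w: "w \<in> der_index m"
      obtain i j where ij: "w = (i, j)" by (cases w)
      show "der_term ?Q m w = (if w \<in> der_index n then der_term P n w else \<zero>) \<oplus> (if ?v = w then Y else \<zero>)"
      proof (cases "w = ?v")
        case True
        then have v': "?v' \<in># n" using w by (auto simp: der_index_def m)
        then obtain n' where n: "n = add_mset ?v' n'" by (meson multi_member_split)
        show ?thesis using True v'
          by (simp add: der_term_def der_index_def Y_def indexed_pmult_def m n add.nat_pow_Suc)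
      next
        case False
        show ?thesis
        proof (cases "(i, Suc j) \<in># n")
          case True
          then obtain n' where n: "n = add_mset (i, Suc j) n'" by (meson multi_member_split)
          show ?thesis using False by (auto simp: der_term_def der_index_def ij indexed_pmult_def m n)
        next
          case nT: False
          then have "(i, Suc j) = ?v" using w by (auto simp: ij der_index_def m)
          then have "i = a" "b = Suc j" by auto
          then have "?v \<notin># m - {#(i, Suc j)#} + {#(i, j)#}" using nT by (auto simp: m)
          then show ?thesis using False nT by (auto simp: der_term_def der_index_def ij indexed_pmult_def)
        qed
      qed
    qed (use der_term_closed[OF P] in auto)
    also have "\<dots> = finsum R (\<lambda>w. (if w \<in> der_index n then der_term P n w else \<zero>)) (der_index m) \<oplus> finsum R (\<lambda>w. (if ?v = w then Y else \<zero>)) (der_index m)"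
      using der_term_closed[OF P] by (intro finsum_addf) auto
    also have "finsum R (\<lambda>w. (if w \<in> der_index n then der_term P n w else \<zero>)) (der_index m) = finsum R (der_term P n) (der_index n)"
      using der_term_closed[OF P] by (intro add.finprod_mono_neutral_cong finite_der_index) (auto simp: m der_index_def)
    also have "finsum R (\<lambda>w. (if ?v = w then Y else \<zero>)) (der_index m) = Y"
    proof (cases "?v \<in> der_index m")
      case True then show ?thesis by (intro finsum_singleton finite_der_index) auto
    next
      case False
      then have "Y = \<zero>" by (simp add: Y_def der_index_def)
      then show ?thesis by (simp only: if_cancel) (rule finsum_zero)
    qed
    finally have *: "finsum R (der_term ?Q m) (der_index m) = finsum R (der_term P n) (der_index n) \<oplus> Y" .
    have "finsum R (der_term P n) (der_index n) \<in> carrier R" using der_term_closed[OF P] by (auto intro!: finsum_closed)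
    then show ?thesis 
      unfolding mpoly_der_alt * by (simp add: indexed_padd_def indexed_pmult_def m mpoly_der_alt a_assoc Y_def)
  qed
qed

lemma mpoly_der_var: "mpoly_der R (indexed_var (i, j)) = indexed_var (i, Suc j)"
proof -
  have "carrier_coeff (indexed_const \<one> :: diff_monomial \<Rightarrow> 'a)"
    by (simp add: carrier_coeff_def indexed_const_def)
  then show ?thesis
    by (simp add: indexed_var_def mpoly_der_pmult mpoly_der_const der_one)
       (auto simp: indexed_padd_def indexed_pmult_def indexed_const_def)
qed

lemma mpoly_set_der:
  assumes "P \<in> mpoly_set (I \<times> UNIV)" shows "mpoly_der R P \<in> mpoly_set (I \<times> UNIV)"
  using assms
proof (induction rule: indexed_pset.induct)
  case (indexed_const k) then show ?case by (simp add: mpoly_der_const indexed_pset.indexed_const)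
next
  case (indexed_padd Q Q')
  then show ?case by (simp add: mpoly_der_padd mpoly_set_carrier_coeff indexed_pset.indexed_padd)
next
  case (indexed_pmult Q i)
  obtain a b where "i = (a, b)" by (cases i)
  with indexed_pmult show ?case by (auto simp: mpoly_der_pmult mpoly_set_carrier_coeff intro!: indexed_pset.indexed_padd indexed_pset.indexed_pmult)
qed

lemma indexed_padd_assoc: "carrier_coeff P \<Longrightarrow> carrier_coeff Q \<Longrightarrow> carrier_coeff S \<Longrightarrow>
  indexed_padd (indexed_padd P Q) S = indexed_padd P (indexed_padd Q S)"
  by (auto simp: indexed_padd_def carrier_coeff_def a_assoc)
lemma indexed_padd_comm: "carrier_coeff P \<Longrightarrow> carrier_coeff Q \<Longrightarrow>
  indexed_padd P Q = indexed_padd Q P"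
  by (auto simp: indexed_padd_def carrier_coeff_def a_comm)
lemma indexed_pmult_padd: "indexed_pmult (indexed_padd P Q) i = indexed_padd (indexed_pmult P i) (indexed_pmult Q i)"
  by (auto simp: indexed_padd_def indexed_pmult_def)

lemma mpoly_set_leibniz:
  assumes "Q \<in> mpoly_set (I \<times> UNIV)" "P \<in> mpoly_set (I \<times> UNIV)"
  shows "mpoly_der R (mpoly_mult R P Q) = indexed_padd (mpoly_mult R (mpoly_der R P) Q) (mpoly_mult R P (mpoly_der R Q))"
  using assms
proof (induction rule: indexed_pset.induct)
  case (indexed_const k)
  have P: "carrier_coeff P" using indexed_const mpoly_set_carrier_coeff by auto
  then have [simp]: "P m \<in> carrier R" for m by (simp add: carrier_coeff_def)
  have dP: "carrier_coeff (mpoly_der R P)" using P mpoly_der_closed by auto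
  show ?case
  proof
    fix m
    have "finsum R (der_term (\<lambda>m. P m \<otimes> k) m) (der_index m) = finsum R (\<lambda>v. der_term P m v \<otimes> k) (der_index m)"
      using indexed_const der_term_closed[OF P]
      by (intro finsum_cong') (auto simp: der_term_def add_pow_ldistr l_distr split: prod.splits)
    also have "\<dots> = finsum R (der_term P m) (der_index m) \<otimes> k"
      using indexed_const der_term_closed[OF P] finite_der_index by (subst finsum_ldistr) auto
    finally have "finsum R (der_term (\<lambda>m. P m \<otimes> k) m) (der_index m) = finsum R (der_term P m) (der_index m) \<otimes> k" .
    moreover have "finsum R (der_term P m) (der_index m) \<in> carrier R" using der_term_closed[OF P] by (auto intro!: finsum_closed)
    ultimately show "mpoly_der R (mpoly_mult R P (indexed_const k)) m =
      indexed_padd (mpoly_mult R (mpoly_der R P) (indexed_const k)) (mpoly_mult R P (mpoly_der R (indexed_const k))) m"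
      using indexed_const by (simp add: P dP mpoly_mult_const mpoly_der_const)
        (simp add: mpoly_der_alt indexed_padd_def der_mult l_distr a_ac)
  qed
next
  case (indexed_padd Q Q')
  have [simp]: "carrier_coeff P" "carrier_coeff Q" "carrier_coeff Q'" using indexed_padd mpoly_set_carrier_coeff by auto
  note [simp] = mpoly_mult_closed mpoly_der_closed indexed_padd_in_carrier
  have "indexed_padd (indexed_padd A B) (indexed_padd C D) = indexed_padd (indexed_padd A C) (indexed_padd B D)"
    if "carrier_coeff A" "carrier_coeff B" "carrier_coeff C" "carrier_coeff D" for A B C D :: "diff_monomial \<Rightarrow> 'a"
    using that by (auto simp: indexed_padd_def carrier_coeff_def a_ac)
  then show ?case using indexed_padd
    by (simp add: mpoly_mult_add mpoly_der_padd)
next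
  case (indexed_pmult Q i)
  obtain a b where i: "i = (a, b)" by (cases i)
  have [simp]: "carrier_coeff P" "carrier_coeff Q" using indexed_pmult mpoly_set_carrier_coeff by auto
  note [simp] = mpoly_mult_closed mpoly_der_closed indexed_padd_in_carrier indexed_pmult_in_carrier
  show ?case using indexed_pmult unfolding i
    by (simp add: mpoly_mult_pmult mpoly_der_pmult mpoly_mult_add indexed_pmult_padd indexed_padd_assoc)
qed

lemma ordinary_diff_ring_diff_poly_ring: "ordinary_diff_ring (diff_poly_ring R n)"
proof -
  let ?A = "diff_poly_ring R n" and ?I = "{..<n} \<times> (UNIV :: nat set)"
  have s: "carrier ?A = mpoly_set ?I" "monoid.mult ?A = mpoly_mult R" "monoid.one ?A = indexed_const \<one>"
    "ring.zero ?A = indexed_const \<zero>" "ring.add ?A = indexed_padd" "der ?A = mpoly_der R"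
    by (simp_all add: diff_poly_ring_def)
  have one: "mpoly_mult R P (indexed_const \<one>) = P" if "P \<in> mpoly_set ?I" for P
    using mpoly_set_carrier_coeff[OF that] by (simp add: mpoly_mult_const carrier_coeff_def)
  have neg: "\<exists>Q\<in>mpoly_set ?I. indexed_padd Q P = indexed_const \<zero>" if "P \<in> mpoly_set ?I" for P
    using mpoly_set_carrier_coeff[OF that] mpoly_set_scale[OF that, of "\<ominus> \<one>"]
    by (intro bexI[of _ "\<lambda>m. P m \<otimes> \<ominus> \<one>"]) (auto simp: indexed_padd_def indexed_zero_def carrier_coeff_def r_minus l_neg)
  interpret A: cring ?A
  proof (rule cringI)
    show "abelian_group ?A"
    proof (rule abelian_groupI, unfold s, goal_cases)
      case (3 x y z) then show ?case using mpoly_set_carrier_coeff indexed_padd_assoc by blast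
    next case (4 x y) then show ?case using mpoly_set_carrier_coeff indexed_padd_comm by blast
    next case (5 x) then show ?case using mpoly_set_carrier_coeff indexed_padd_zero by blast
    next case (6 x) then show ?case using neg by blast
    qed (auto intro: indexed_pset.intros)
    show "comm_monoid ?A"
    proof (rule comm_monoidI, unfold s, goal_cases)
      case (1 x y) then show ?case using mpoly_set_mult by blast
    next case (3 x y z) then show ?case using mpoly_set_assoc by blast
    next case (4 x)
      then have "mpoly_mult R (indexed_const \<one>) x = mpoly_mult R x (indexed_const \<one>)"
        by (intro mpoly_mult_comm mpoly_set_carrier_coeff[of _ ?I]) (auto intro: indexed_pset.intros)
      then show ?case using one[OF 4] by simp
    next case (5 x y) then show ?case using mpoly_set_carrier_coeff mpoly_mult_comm by blast
    qed (auto intro: indexed_pset.intros)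
    show "(x \<oplus>\<^bsub>?A\<^esub> y) \<otimes>\<^bsub>?A\<^esub> z = x \<otimes>\<^bsub>?A\<^esub> z \<oplus>\<^bsub>?A\<^esub> y \<otimes>\<^bsub>?A\<^esub> z"
      if "x \<in> carrier ?A" "y \<in> carrier ?A" "z \<in> carrier ?A" for x y z
      using that mpoly_set_carrier_coeff[of x ?I] mpoly_set_carrier_coeff[of y ?I] mpoly_set_carrier_coeff[of z ?I]
      by (simp add: s mpoly_mult_comm[of _ z] indexed_padd_in_carrier mpoly_mult_add)
  qed
  show ?thesis
    by unfold_locales (auto simp: s mpoly_set_der mpoly_der_padd mpoly_set_carrier_coeff mpoly_set_leibniz)
qed

end


section \<open>J-rings\<close>

text \<open>The constant \<open>1\<close> below is the number of derivations.\<close>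

definition J_ring :: "('a, 'm) diff_ring_scheme \<Rightarrow> bool"
  where "J_ring R \<longleftrightarrow> ordinary_diff_ring R \<and> diff_type R \<noteq> \<infinity> \<and>
    (\<forall>n>0.
       diff_type (diff_poly_ring R n) = max (diff_type R) 1 \<and>
       (diff_type R < 1 \<longrightarrow> diff_dim (diff_poly_ring R n) = enat n) \<and>
       (diff_type R = 1 \<longrightarrow>
          diff_dim R \<noteq> \<infinity> \<and> diff_dim (diff_poly_ring R n) = enat n + diff_dim R) \<and>
       (diff_type R > 1 \<longrightarrow>
          diff_dim R \<noteq> \<infinity> \<and> diff_dim (diff_poly_ring R n) = diff_dim R))"

end

theory Submission
  imports Defs "HOL-Library.Multiset_Order"
begin

text \<open>
  Write \<open>A\<close> for the ring of differential polynomials in \<open>n\<close> indeterminates over \<open>R\<close>.  Type and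
  dimension of \<open>A\<close> are compared with those of \<open>R\<close> by contracting differential primes of \<open>A\<close> to
  \<open>R\<close>.  The size of the fibres is measured by the differential rank of a prime \<open>P\<close>: the largest
  number of indeterminates which, together with all their derivatives, satisfy modulo \<open>P\<close> only the
  trivial relations, those with all coefficients in the contraction of \<open>P\<close>.  It is at most \<open>n\<close>, and
  two facts about it carry the proof.

  First, the rank can only grow when a prime shrinks (\<open>independent_mod_subset\<close>).  This is where \<open>R\<close>
  being arithmetical enters.  Locally at a differential prime, finitely many elements are all
  divisible by one of them.  So if \<open>P \<subseteq> Q\<close>, a nontrivial relation modulo \<open>P\<close> can be divided by a
  coefficient that divides all the others; it then has a coefficient outside the contraction of \<open>Q\<close> and is
  nontrivial modulo \<open>Q\<close> as well.

  Second, below a prime \<open>P\<close> an infinite strictly descending chain inside one fibre, bounded from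
  below by \<open>P'\<close>, forces the rank of \<open>P'\<close> to exceed that of \<open>P\<close> (\<open>diff_rank_jump\<close>).  Suppose it does
  not, and fix a maximal set of independent indeterminates for \<open>P\<close>; it stays independent and maximal
  down to \<open>P'\<close>.  Each of the other indeterminates satisfies a nontrivial relation modulo \<open>P'\<close>, hence
  one of the same bounded order \<open>< N\<close> modulo every member of the chain.  Differentiating it shows
  that all derivatives of order at least \<open>N\<close> are algebraic over those of lower order, because the
  separant does not vanish in characteristic zero (\<open>algebraic_mod_der\<close>).  Two nested primes with
  the same trace on a subring also have the same trace after adjoining an element that is algebraic
  modulo the smaller one (\<open>agree_on_adjunction_if_algebraic\<close>, by division with remainder).
  Consequently the members of the chain are distinguished by their traces on the polynomials in
  the independent variables and finitely many further ones.  These traces become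
  stationary, because adjoining one variable preserves stationarity, whether
  or not the variable is eventually transcendental (\<open>chain_stabilizes_finite_extension\<close>).  So the
  chain is not strictly descending after all.

  It follows that a gap of measure at least one in \<open>A\<close> either raises the rank or comes from such a
  gap in \<open>R\<close>.  As the rank is bounded, it is eventually constant along an infinite chain, so a gap
  of measure \<open>d \<ge> 2\<close> in \<open>A\<close> contracts to a gap of measure at least \<open>d\<close> in \<open>R\<close>.  This gives the upper
  bounds.  For the lower bounds, primes of \<open>R\<close> extend to \<open>A\<close> with strict inclusions preserved, and
  above each extended prime there is a ladder of \<open>n\<close> gaps of measure at least one, obtained by killing the
  derivatives of one indeterminate after the other (\<open>extension_ladder\<close>).
\<close>

section \<open>The gap relation and chains of large gap\<close>

lemma enat_le_gap_measure_iff: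
  assumes "p \<in> S" "p' \<in> S" "p' \<subseteq> p"
  shows "enat d \<le> gap_measure S p p' \<longleftrightarrow> gap_ge S d p p'"
proof -
  have "is_gap_measure S (gap_measure S)"
    using theI'[OF ex1_gap_measure[of S]] unfolding gap_measure_def by (rule conjunct1)
  then show ?thesis
    using assms unfolding is_gap_measure_iff by blast
qed

lemma enat_le_Sup_iff:
  assumes "Z \<noteq> {}"
  shows "enat d \<le> Sup Z \<longleftrightarrow> (\<exists>x\<in>Z. enat d \<le> x)"
proof
  assume le: "enat d \<le> Sup Z"
  show "\<exists>x\<in>Z. enat d \<le> x"
  proof (rule ccontr)
    assume none: "\<not> ?thesis"
    with assms have d: "d > 0"
      by (cases d) (auto simp: zero_enat_def[symmetric])
    have "x \<le> enat (d - 1)" if "x \<in> Z" for x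
      using none that d by (cases x) (auto simp: not_le)
    then have "Sup Z \<le> enat (d - 1)"
      by (rule Sup_least)
    with le have "enat d \<le> enat (d - 1)"
      by (rule order_trans)
    with d show False
      by simp
  qed
next
  assume "\<exists>x\<in>Z. enat d \<le> x"
  then show "enat d \<le> Sup Z"
    by (meson Sup_upper order_trans)
qed

lemma gap_ge_Suc_iff:
  "gap_ge S (Suc d) p p' \<longleftrightarrow>
     (\<exists>c. descending_chain S p p' c \<and> (\<forall>i. gap_ge S d (c i) (c (Suc i))))"
proof -
  have "p \<noteq> p'" if "descending_chain S p p' c" for c
    using that[unfolded descending_chain_def]
    by (metis psubset_subset_trans less_irrefl)
  then show ?thesis by auto
qed

text \<open>
  The top of a witnessing chain may be replaced by a larger prime: only the first step changes.
\<close>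

lemma gap_ge_mono:
  assumes "gap_ge S d q q'" "q \<subseteq> p" "p \<in> S" "p' \<subseteq> q'"
  shows "gap_ge S d p p'"
  using assms
proof (induction d arbitrary: q q' p p')
  case (Suc d)
  from Suc.prems(1) obtain c where c: "descending_chain S q q' c"
    and gap: "\<And>i. gap_ge S d (c i) (c (Suc i))"
    unfolding gap_ge_Suc_iff by blast
  have c0: "c 0 = q" and cS: "c i \<in> S" and cq: "q' \<subseteq> c i" and cc: "c (Suc i) \<subset> c i" for i
    using c unfolding descending_chain_def by blast+
  define c' where "c' = case_nat p (\<lambda>i. c (Suc i))"
  have "gap_ge S d p (c (Suc 0))"
    by (rule Suc.IH[OF gap[of 0]]) (use c0 Suc.prems(2,3) in auto)
  with gap have "gap_ge S d (c' i) (c' (Suc i))" for i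
    by (cases i) (simp_all add: c'_def)
  moreover have "c' i \<in> S" "p' \<subseteq> c' i" "c' (Suc i) \<subset> c' i" for i
    using cS cq cc[of 0] cc[of i] c0 Suc.prems(2-4) unfolding c'_def by (cases i; force)+
  then have "descending_chain S p p' c'"
    by (simp add: descending_chain_def c'_def)
  ultimately show ?case
    unfolding gap_ge_Suc_iff by blast
qed simp

lemma gap_ge_strict: "gap_ge S (Suc d) p p' \<Longrightarrow> p' \<subseteq> p \<Longrightarrow> p' \<subset> p"
  by auto

declare gap_ge.simps(2) [simp del]

lemma gap_ge_image:
  assumes "gap_ge S d p p'"
    and "\<And>p. p \<in> S \<Longrightarrow> e p \<in> S'"
    and "\<And>p q. p \<in> S \<Longrightarrow> q \<in> S \<Longrightarrow> p \<subset> q \<Longrightarrow> e p \<subset> e q"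
    and "p' \<in> S"
  shows "gap_ge S' d (e p) (e p')"
  using assms(1,4)
proof (induction d arbitrary: p p')
  case (Suc d)
  from Suc.prems(1) obtain c where c: "descending_chain S p p' c"
    and gap: "\<And>i. gap_ge S d (c i) (c (Suc i))"
    unfolding gap_ge_Suc_iff by blast
  have S: "c i \<in> S" "p' \<subset> c i" "c (Suc i) \<subset> c i" for i
    using c unfolding descending_chain_def by (blast intro: subset_psubset_trans)+
  have "descending_chain S' (e p) (e p') (\<lambda>i. e (c i))"
    using c S assms(2,3) Suc.prems(2) unfolding descending_chain_def by (meson psubset_imp_subset)
  with gap S(1) Suc.IH show ?case
    unfolding gap_ge_Suc_iff by blast
qed simp

text \<open>
  Chains of length \<open>k\<close> with smallest member \<open>q\<close> all of whose steps have gap measure at least \<open>t\<close>;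
  the recursion removes the smallest member.
\<close>

primrec gap_chain :: "'a set set \<Rightarrow> nat \<Rightarrow> nat \<Rightarrow> 'a set \<Rightarrow> bool" where
  "gap_chain S t 0 q \<longleftrightarrow> q \<in> S"
| "gap_chain S t (Suc k) q \<longleftrightarrow>
     q \<in> S \<and> (\<exists>q'. gap_chain S t k q' \<and> q \<subset> q' \<and> gap_ge S t q' q)"

lemma gap_chain_in: "gap_chain S t k q \<Longrightarrow> q \<in> S"
  by (cases k) auto

lemma gap_chain_antimono: "gap_chain S t k q \<Longrightarrow> l \<le> k \<Longrightarrow> \<exists>q. gap_chain S t l q"
proof (induction k arbitrary: q)
  case (Suc k)
  then show ?case
    unfolding gap_chain.simps(2) le_Suc_eq by (metis gap_chain.simps(2))
qed auto

lemma gap_chain_iff: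
  "gap_chain S t k q \<longleftrightarrow>
     (\<exists>p. p k = q \<and> (\<forall>i\<le>k. p i \<in> S) \<and>
       (\<forall>i<k. p (Suc i) \<subset> p i \<and> gap_ge S t (p i) (p (Suc i))))"
proof (induction k arbitrary: q)
  case (Suc k)
  show ?case (is "_ \<longleftrightarrow> (\<exists>p. ?R p)")
  proof
    assume "gap_chain S t (Suc k) q"
    then obtain q' where q': "gap_chain S t k q'" "q \<in> S" "q \<subset> q'" "gap_ge S t q' q"
      unfolding gap_chain.simps by blast
    then obtain p where p: "p k = q'" "\<forall>i\<le>k. p i \<in> S"
      "\<forall>i<k. p (Suc i) \<subset> p i \<and> gap_ge S t (p i) (p (Suc i))"
      unfolding Suc.IH by blast
    define p' where "p' i = (if i \<le> k then p i else q)" for i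
    have "?R p'"
      unfolding p'_def less_Suc_eq using p q' by (simp add: le_Suc_eq)
    then show "\<exists>p. ?R p" by (rule exI[of _ p'])
  next
    assume "\<exists>p. ?R p"
    then obtain p where p: "?R p" ..
    then have "gap_chain S t k (p k)"
      unfolding Suc.IH by (intro exI[of _ p]) simp
    moreover from p have "q \<subset> p k" "gap_ge S t (p k) q" "q \<in> S"
      by blast+
    ultimately show "gap_chain S t (Suc k) q"
      unfolding gap_chain.simps by blast
  qed
next
  case 0
  have "\<exists>p. p 0 = q" by (rule exI[of _ "\<lambda>_. q"]) simp
  then show ?case by auto
qed

lemma enat_le_diff_type_iff:
  assumes "diff_Spec R \<noteq> {}"
  shows "enat d \<le> diff_type R \<longleftrightarrow>
    (\<exists>p\<in>diff_Spec R. \<exists>p'\<in>diff_Spec R. p' \<subseteq> p \<and> gap_ge (diff_Spec R) d p p')"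
proof -
  let ?V = "{gap_measure (diff_Spec R) p p' |p p'. p \<in> diff_Spec R \<and> p' \<in> diff_Spec R \<and> p' \<subseteq> p}"
  have "?V \<noteq> {}"
    using assms by blast
  then have "enat d \<le> diff_type R \<longleftrightarrow> (\<exists>x\<in>?V. enat d \<le> x)"
    unfolding diff_type_def by (rule enat_le_Sup_iff)
  also have "\<dots> \<longleftrightarrow> (\<exists>p\<in>diff_Spec R. \<exists>p'\<in>diff_Spec R. p' \<subseteq> p \<and>
      enat d \<le> gap_measure (diff_Spec R) p p')"
    by blast
  also have "\<dots> \<longleftrightarrow>
      (\<exists>p\<in>diff_Spec R. \<exists>p'\<in>diff_Spec R. p' \<subseteq> p \<and> gap_ge (diff_Spec R) d p p')"
    by (intro bex_cong refl conj_cong enat_le_gap_measure_iff)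
  finally show ?thesis .
qed

text \<open>
  The type is an upper bound for the gap measure, so equality means being at least \<open>t\<close>; this
  replaces the gap measure by the relation \<open>gap_ge\<close>.
\<close>

lemma gap_measure_eq_diff_type_iff:
  assumes "diff_type R = enat t" "p \<in> diff_Spec R" "p' \<in> diff_Spec R" "p' \<subseteq> p"
  shows "gap_measure (diff_Spec R) p p' = diff_type R \<longleftrightarrow> gap_ge (diff_Spec R) t p p'"
proof -
  have "gap_measure (diff_Spec R) p p' \<le> diff_type R"
    unfolding diff_type_def using assms(2-4) by (intro Sup_upper) blast
  then have "gap_measure (diff_Spec R) p p' = diff_type R \<longleftrightarrow>
      enat t \<le> gap_measure (diff_Spec R) p p'"
    using assms(1) by auto
  then show ?thesis
    unfolding enat_le_gap_measure_iff[OF assms(2-4)] .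
qed

lemma enat_le_diff_dim_iff:
  assumes "diff_Spec R \<noteq> {}" "diff_type R = enat t"
  shows "enat k \<le> diff_dim R \<longleftrightarrow> (\<exists>q. gap_chain (diff_Spec R) t k q)"
proof -
  let ?S = "diff_Spec R"
  have *: "(\<exists>p. (\<forall>i\<le>k. p i \<in> ?S) \<and> (\<forall>i\<in>{1..k}. p i \<subset> p (i - 1) \<and>
            gap_measure ?S (p (i - 1)) (p i) = diff_type R)) \<longleftrightarrow>
         (\<exists>q. gap_chain ?S t k q)" for k
  proof -
    have shift: "(\<forall>i\<in>{1..k}. B i (i - 1)) \<longleftrightarrow> (\<forall>i<k. B (Suc i) i)" for B :: "nat \<Rightarrow> nat \<Rightarrow> bool"
    proof -
      have "(\<forall>i\<in>Suc ` {..<k}. B i (i - 1)) \<longleftrightarrow> (\<forall>i<k. B (Suc i) i)"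
        unfolding ball_simps by (simp add: lessThan_iff Ball_def)
      then show ?thesis unfolding image_Suc_lessThan .
    qed
    have "((\<forall>i\<le>k. p i \<in> ?S) \<and> (\<forall>i\<in>{1..k}. p i \<subset> p (i - 1) \<and>
            gap_measure ?S (p (i - 1)) (p i) = diff_type R)) \<longleftrightarrow>
        ((\<forall>i\<le>k. p i \<in> ?S) \<and>
          (\<forall>i<k. p (Suc i) \<subset> p i \<and> gap_ge ?S t (p i) (p (Suc i))))" for p
    proof (rule conj_cong[OF refl])
      assume p: "\<forall>i\<le>k. p i \<in> ?S"
      have "gap_measure ?S (p i) (p (Suc i)) = diff_type R \<longleftrightarrow> gap_ge ?S t (p i) (p (Suc i))"
        if "p (Suc i) \<subset> p i" "i < k" for i
        using p that by (intro gap_measure_eq_diff_type_iff[OF assms(2)]) auto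
      then show "(\<forall>i\<in>{1..k}. p i \<subset> p (i - 1) \<and>
            gap_measure ?S (p (i - 1)) (p i) = diff_type R) \<longleftrightarrow>
          (\<forall>i<k. p (Suc i) \<subset> p i \<and> gap_ge ?S t (p i) (p (Suc i)))"
        by (subst shift[of "\<lambda>i j. p i \<subset> p j \<and> gap_measure ?S (p j) (p i) = diff_type R"]) blast
    qed
    then show ?thesis
      by (simp only: gap_chain_iff) simp
  qed
  have "enat k \<le> diff_dim R \<longleftrightarrow> (\<exists>x\<in>{enat k |k. \<exists>q. gap_chain ?S t k q}. enat k \<le> x)"
    unfolding diff_dim_def *
  proof (rule enat_le_Sup_iff)
    show "{enat k |k. \<exists>q. gap_chain ?S t k q} \<noteq> {}"
      using assms(1) gap_chain.simps(1) by blast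
  qed
  also have "\<dots> \<longleftrightarrow> (\<exists>q. gap_chain ?S t k q)"
    using gap_chain_antimono enat_ord_simps(1) by blast
  finally show ?thesis .
qed

section \<open>Transfer of type and dimension along a fibration of spectra\<close>

text \<open>
  The part of the argument that only concerns inclusions of primes.  Here \<open>Z\<close> and \<open>Y\<close> are the
  differential spectra of the polynomial ring and of \<open>R\<close>, and \<open>rank\<close> bounds what can happen within
  a fibre of \<open>contr\<close>.
\<close>

locale spectral_fibration =
  fixes Z :: "'b set set" and Y :: "'a set set"
    and contr :: "'b set \<Rightarrow> 'a set" and ext :: "'a set \<Rightarrow> 'b set"
    and rank :: "'b set \<Rightarrow> nat" and n :: nat
  assumes contr_in: "P \<in> Z \<Longrightarrow> contr P \<in> Y"
    and contr_mono: "P \<in> Z \<Longrightarrow> Q \<in> Z \<Longrightarrow> P \<subseteq> Q \<Longrightarrow> contr P \<subseteq> contr Q"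
    and rank_antimono: "P \<in> Z \<Longrightarrow> Q \<in> Z \<Longrightarrow> P \<subseteq> Q \<Longrightarrow> rank Q \<le> rank P"
    and rank_le: "P \<in> Z \<Longrightarrow> rank P \<le> n"
    and rank_jump: "P' \<in> Z \<Longrightarrow> descending_chain Z P P' c \<Longrightarrow> (\<And>i. contr (c i) = contr P) \<Longrightarrow>
       rank P < rank P'"
    and ext_in: "p \<in> Y \<Longrightarrow> ext p \<in> Z"
    and ext_strict_mono: "p \<in> Y \<Longrightarrow> q \<in> Y \<Longrightarrow> p \<subset> q \<Longrightarrow> ext p \<subset> ext q"
    and ladder: "p \<in> Y \<Longrightarrow> gap_chain Z 1 n (ext p)"
begin

lemma descending_chain_le:
  assumes "descending_chain Z P P' c" "i \<le> j"
  shows "c j \<subseteq> c i"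
  using assms(1) by (intro lift_Suc_antimono_le[OF _ \<open>i \<le> j\<close>]) (auto simp: descending_chain_def)

text \<open>
  Contract a chain witnessing the gap.  If it becomes stationary, its tail lies in one fibre and the
  rank jumps; otherwise a strictly descending subsequence witnesses a gap in the base.
\<close>

lemma gap_one_cases:
  assumes "P' \<in> Z" "gap_ge Z 1 P P'"
  shows "rank P < rank P' \<or> gap_ge Y 1 (contr P) (contr P')"
proof -
  from assms(2) obtain c where c: "descending_chain Z P P' c"
    unfolding One_nat_def gap_ge_Suc_iff by blast
  have cX: "c i \<in> Z" "P' \<subseteq> c i" and c0: "c 0 = P" for i
    using c by (auto simp: descending_chain_def)
  show ?thesis
  proof (cases "\<exists>N. \<forall>i\<ge>N. contr (c i) = contr (c N)")
    case True
    then obtain N where N: "\<And>i. i \<ge> N \<Longrightarrow> contr (c i) = contr (c N)" by blast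
    have "descending_chain Z (c N) P' (\<lambda>i. c (N + i))"
      using c by (simp add: descending_chain_def)
    then have "rank (c N) < rank P'"
      by (rule rank_jump[OF assms(1)]) (rule N, rule le_add1)
    moreover have "rank P \<le> rank (c N)"
      using rank_antimono cX c0 descending_chain_le[OF c, of 0 N] by force
    ultimately show ?thesis by simp
  next
    case False
    have "\<exists>j. contr (c j) \<subset> contr (c i)" for i
    proof -
      obtain j where "j \<ge> i" "contr (c j) \<noteq> contr (c i)"
        using False by blast
      then show ?thesis
        using contr_mono cX descending_chain_le[OF c] by blast
    qed
    then obtain h where h: "\<And>i. contr (c (h i)) \<subset> contr (c i)" by metis
    have "descending_chain Y (contr P) (contr P') (\<lambda>k. contr (c ((h ^^ k) 0)))"
      using h contr_in contr_mono cX c0 assms(1) by (auto simp: descending_chain_def)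
    then show ?thesis
      unfolding One_nat_def gap_ge_Suc_iff by auto
  qed
qed

text \<open>
  A finite initial part of a witnessing chain may be discarded.
\<close>

lemma contr_gap_ge_Suc:
  assumes "P' \<in> Z" "descending_chain Z P P' c"
    and "\<And>i. N \<le> i \<Longrightarrow> gap_ge Y (Suc d) (contr (c i)) (contr (c (Suc i)))"
  shows "gap_ge Y (Suc (Suc d)) (contr P) (contr P')"
proof (rule gap_ge_mono)
  have cX: "c i \<in> Z" "P' \<subseteq> c i" "c (Suc i) \<subseteq> c i" "c 0 = P" for i
    using assms(2) by (auto simp: descending_chain_def)
  have "contr (c (Suc i)) \<subset> contr (c i)" if "N \<le> i" for i
    using gap_ge_strict[OF assms(3)[OF that]] contr_mono cX by blast
  then have "descending_chain Y (contr (c N)) (contr P') (\<lambda>i. contr (c (N + i)))"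
    using contr_in contr_mono cX assms(1) by (simp add: descending_chain_def)
  then show "gap_ge Y (Suc (Suc d)) (contr (c N)) (contr P')"
    unfolding gap_ge_Suc_iff[of _ "Suc d"] using assms(3) by force
  show "contr (c N) \<subseteq> contr P"
    using contr_mono[OF cX(1) cX(1)] descending_chain_le[OF assms(2) le0] cX(4) by metis
  show "contr P \<in> Y"
    using contr_in cX by blast
qed simp

text \<open>
  Along a chain witnessing a gap of measure two the rank is bounded and increasing, hence
  eventually constant.  From there on, every step of measure one comes from the base.
\<close>

lemma contr_gap_ge:
  assumes "P' \<in> Z" "gap_ge Z (Suc (Suc d)) P P'"
  shows "gap_ge Y (Suc (Suc d)) (contr P) (contr P')"
  using assms
proof (induction d arbitrary: P P')
  case 0
  from 0(2) obtain c where c: "descending_chain Z P P' c"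
    and gap: "\<And>i. gap_ge Z 1 (c i) (c (Suc i))"
    unfolding gap_ge_Suc_iff[of _ "Suc 0"] One_nat_def by blast
  have cX: "c i \<in> Z" for i
    using c by (auto simp: descending_chain_def)
  have mono: "rank (c i) \<le> rank (c j)" if "i \<le> j" for i j
    using rank_antimono cX descending_chain_le[OF c that] by blast
  have bounded: "finite (range (\<lambda>i. rank (c i)))"
    using rank_le cX by (auto intro: finite_subset[of _ "{..n}"])
  obtain N where N: "\<And>i. rank (c i) \<le> rank (c N)"
  proof -
    have "Max (range (\<lambda>i. rank (c i))) \<in> range (\<lambda>i. rank (c i))"
      by (rule Max_in[OF bounded]) simp
    then obtain N where "Max (range (\<lambda>i. rank (c i))) = rank (c N)"
      by blast
    then show ?thesis
      using Max_ge[OF bounded] by (intro that[of N]) (metis rangeI)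
  qed
  have "gap_ge Y (Suc 0) (contr (c i)) (contr (c (Suc i)))" if "N \<le> i" for i
    using gap_one_cases[OF cX gap, of i] mono[OF that] N[of "Suc i"] by fastforce
  then show ?case
    by (rule contr_gap_ge_Suc[OF 0(1) c])
next
  case (Suc d)
  from Suc.prems(2) obtain c where c: "descending_chain Z P P' c"
    and gap: "\<And>i. gap_ge Z (Suc (Suc d)) (c i) (c (Suc i))"
    unfolding gap_ge_Suc_iff[of _ "Suc (Suc d)"] by blast
  have "gap_ge Y (Suc (Suc d)) (contr (c i)) (contr (c (Suc i)))" for i
    using c gap by (intro Suc.IH) (auto simp: descending_chain_def)
  then show ?case
    by (rule contr_gap_ge_Suc[OF Suc.prems(1) c])
qed

text \<open>
  Each step of the chain either increases the rank, which is paid for by \<open>rank P\<close>, or contributes a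
  step in the base.
\<close>

lemma contr_gap_chain_one:
  assumes "gap_chain Z 1 k P"
  shows "\<exists>l q. gap_chain Y 1 l q \<and> contr P \<subseteq> q \<and> k \<le> rank P + l"
  using assms
proof (induction k arbitrary: P)
  case 0
  then show ?case
    using contr_in by (intro exI[of _ 0] exI[of _ "contr P"]) simp
next
  case (Suc k)
  then obtain P' where P': "gap_chain Z 1 k P'" "P \<subset> P'" "gap_ge Z 1 P' P" and P: "P \<in> Z"
    by auto
  obtain l q where q: "gap_chain Y 1 l q" "contr P' \<subseteq> q" "k \<le> rank P' + l"
    using Suc.IH P'(1) by blast
  have Z: "P' \<in> Z" using P'(1) by (rule gap_chain_in)
  have sub: "contr P \<subseteq> contr P'" using contr_mono P Z P'(2) by blast
  have r: "rank P' \<le> rank P" using rank_antimono P Z P'(2) by blast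
  show ?case
    using gap_one_cases[OF P P'(3)]
  proof
    assume "rank P' < rank P"
    then show ?thesis using q sub by (intro exI[of _ l] exI[of _ q]) auto
  next
    assume "gap_ge Y 1 (contr P') (contr P)"
    then have g: "gap_ge Y 1 q (contr P)"
      using q gap_chain_in by (blast intro: gap_ge_mono)
    have s: "contr P \<subset> q"
      using gap_ge_strict g q(2) sub by (metis One_nat_def order_trans)
    have "gap_chain Y 1 (Suc l) (contr P)"
      unfolding gap_chain.simps using g s q(1) contr_in[OF P] by blast
    then show ?thesis using q(3) r by (intro exI[of _ "Suc l"] exI[of _ "contr P"]) auto
  qed
qed

lemma contr_gap_chain:
  "gap_chain Z (Suc (Suc d)) k P \<Longrightarrow> gap_chain Y (Suc (Suc d)) k (contr P)"
proof (induction k arbitrary: P)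
  case (Suc k)
  then obtain P' where P': "gap_chain Z (Suc (Suc d)) k P'" "P \<subset> P'" "gap_ge Z (Suc (Suc d)) P' P" and P: "P \<in> Z"
    by auto
  have g: "gap_ge Y (Suc (Suc d)) (contr P') (contr P)"
    by (rule contr_gap_ge[OF P P'(3)])
  moreover have "contr P \<subset> contr P'"
    using gap_ge_strict[OF g] contr_mono P gap_chain_in[OF P'(1)] P'(2) by blast
  ultimately show ?case
    unfolding gap_chain.simps using Suc.IH[OF P'(1)] contr_in[OF P] by blast
qed (simp add: contr_in)

lemma ext_gap_chain:
  assumes "gap_chain Y t k p" "\<And>p. p \<in> Y \<Longrightarrow> gap_chain Z t m (ext p)"
  shows "gap_chain Z t (m + k) (ext p)"
  using assms(1)
proof (induction k arbitrary: p)
  case (Suc k)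
  then obtain p' where p': "gap_chain Y t k p'" "p \<subset> p'" "gap_ge Y t p' p" and p: "p \<in> Y"
    by auto
  have "gap_ge Z t (ext p') (ext p)"
    using p'(3) ext_in ext_strict_mono p by (rule gap_ge_image)
  moreover have "ext p \<subset> ext p'"
    using ext_strict_mono p gap_chain_in[OF p'(1)] p'(2) by blast
  ultimately show ?case
    unfolding add_Suc_right gap_chain.simps using Suc.IH[OF p'(1)] ext_in[OF p] by blast
qed (simp add: assms(2))

end

lemma enat_eqI: "a = b" if "\<And>d. enat d \<le> a \<longleftrightarrow> enat d \<le> b"
proof (rule antisym)
  show "a \<le> b" by (rule enat_leI) (rule iffD1[OF that])
  show "b \<le> a" by (rule enat_leI) (rule iffD2[OF that])
qed

text \<open>
  The three cases of the definition of a J-ring: for type zero only the rank contributes to the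
  dimension, for type one both rank and base do, and for larger type only the base does.
\<close>

lemma J_ring_if_spectral_fibration:
  assumes R: "ordinary_diff_ring R" and ne: "diff_Spec R \<noteq> {}"
    and fin: "diff_type R \<noteq> \<infinity>" "diff_type R = 0 \<or> diff_dim R \<noteq> \<infinity>"
    and fib: "\<And>n. \<exists>contr ext rank. spectral_fibration (diff_Spec (diff_poly_ring R n)) (diff_Spec R) contr ext rank n"
  shows "J_ring R"
proof -
  obtain t where t: "diff_type R = enat t" using fin(1) by auto
  let ?Y = "diff_Spec R"
  have main: "diff_type (diff_poly_ring R n) = max (diff_type R) 1 \<and>
       (diff_type R < 1 \<longrightarrow> diff_dim (diff_poly_ring R n) = enat n) \<and>
       (diff_type R = 1 \<longrightarrow> diff_dim (diff_poly_ring R n) = enat n + diff_dim R) \<and>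
       (diff_type R > 1 \<longrightarrow> diff_dim (diff_poly_ring R n) = diff_dim R)"
    if n: "n > 0" for n
  proof -
    let ?A = "diff_poly_ring R n" and ?Z = "diff_Spec (diff_poly_ring R n)"
    obtain contr ext rank where "spectral_fibration ?Z ?Y contr ext rank n"
      using fib by blast
    then interpret spectral_fibration ?Z ?Y contr ext rank n .
    have neX: "?Z \<noteq> {}" using ne ext_in by blast
    have type_R: "d \<le> t" if "gap_ge ?Y d p p'" "p \<in> ?Y" "p' \<in> ?Y" "p' \<subseteq> p" for d p p'
      using enat_le_diff_type_iff[OF ne, of d] that t by auto
    have type: "diff_type ?A = enat (max t 1)"
    proof (rule enat_eqI)
      fix d
      show "enat d \<le> diff_type ?A \<longleftrightarrow> enat d \<le> enat (max t 1)"
      proof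
        assume "enat d \<le> diff_type ?A"
        then obtain P P' where P: "P \<in> ?Z" "P' \<in> ?Z" "P' \<subseteq> P" "gap_ge ?Z d P P'"
          by (auto simp: enat_le_diff_type_iff[OF neX])
        show "enat d \<le> enat (max t 1)"
        proof (cases "d \<ge> 2")
          case True
          then obtain d' where "d = 2 + d'" using le_Suc_ex by blast
          then have "gap_ge ?Y d (contr P) (contr P')"
            using contr_gap_ge P by (simp add: numeral_2_eq_2)
          then have "d \<le> t" using type_R contr_in contr_mono P(1-3) by blast
          then show ?thesis by simp
        qed auto
      next
        assume "enat d \<le> enat (max t 1)"
        then consider "d \<le> t" | "d \<le> 1" by (auto simp: le_max_iff_disj)
        then show "enat d \<le> diff_type ?A"
        proof cases
          case 1
          then obtain p p' where p: "p \<in> ?Y" "p' \<in> ?Y" "p' \<subseteq> p" "gap_ge ?Y d p p'"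
            using enat_le_diff_type_iff[OF ne, of d] t by auto
          have "gap_ge ?Z d (ext p) (ext p')"
            using p(4) ext_in ext_strict_mono p(2) by (rule gap_ge_image)
          moreover have "ext p' \<subseteq> ext p"
            using ext_strict_mono p by blast
          ultimately show ?thesis
            using ext_in p enat_le_diff_type_iff[OF neX] by blast
        next
          case 2
          obtain p where "p \<in> ?Y" using ne by blast
          from ladder[OF this] n obtain Q Q' where Q: "gap_chain ?Z 1 (n - 1) Q'" "Q \<in> ?Z" "Q \<subset> Q'" "gap_ge ?Z 1 Q' Q"
            by (metis gap_chain.simps(2) Suc_pred')
          then have "gap_ge ?Z d Q' Q" using gap_ge_antimono 2 by blast
          then show ?thesis
            using Q gap_chain_in enat_le_diff_type_iff[OF neX] by blast
        qed
      qed
    qed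
    have dimA: "enat k \<le> diff_dim ?A \<longleftrightarrow> (\<exists>q. gap_chain ?Z (max t 1) k q)" for k
      using enat_le_diff_dim_iff[OF neX type] .
    have dimR: "enat k \<le> diff_dim R \<longleftrightarrow> (\<exists>q. gap_chain ?Y t k q)" for k
      using enat_le_diff_dim_iff[OF ne t] .
    have zero: "diff_dim ?A = enat n" if "t = 0"
    proof (rule enat_eqI)
      fix k
      have "k \<le> n" if P: "gap_chain ?Z 1 k P" for P
      proof -
        obtain l q where l: "gap_chain ?Y 1 l q" "k \<le> rank P + l"
          using contr_gap_chain_one[OF P] by blast
        have "l = 0"
        proof (cases l)
          case (Suc l')
          then obtain q' where "gap_chain ?Y 1 l' q'" "q \<in> ?Y" "q \<subset> q'" "gap_ge ?Y 1 q' q"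
            using l(1) by auto
          then have "1 \<le> t" using type_R gap_chain_in by blast
          then show ?thesis using \<open>t = 0\<close> by simp
        qed
        with l(2) rank_le[OF gap_chain_in[OF P]] show ?thesis by simp
      qed
      moreover have "\<exists>q. gap_chain ?Z 1 n q" using ladder ne by blast
      ultimately show "enat k \<le> diff_dim ?A \<longleftrightarrow> enat k \<le> enat n"
        using gap_chain_antimono unfolding dimA \<open>t = 0\<close> by auto
    qed
    have one: "diff_dim ?A = enat n + diff_dim R" if "t = 1"
    proof (rule enat_eqI)
      fix k
      have "diff_dim R \<noteq> \<infinity>" using fin(2) t that by (auto simp: zero_enat_def)
      then obtain r where r: "diff_dim R = enat r" by auto
      have "k \<le> n + r" if P: "gap_chain ?Z 1 k P" for P
      proof -
        obtain l q where l: "gap_chain ?Y 1 l q" "k \<le> rank P + l"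
          using contr_gap_chain_one[OF P] by blast
        from l(1) have "l \<le> r" using dimR[of l] r \<open>t = 1\<close> by auto
        with l(2) rank_le[OF gap_chain_in[OF P]] show ?thesis by simp
      qed
      moreover have "\<exists>q. gap_chain ?Z 1 (n + r) q"
        using ext_gap_chain[OF _ ladder] dimR[of r] r \<open>t = 1\<close> by auto
      ultimately show "enat k \<le> diff_dim ?A \<longleftrightarrow> enat k \<le> enat n + diff_dim R"
        using gap_chain_antimono unfolding dimA \<open>t = 1\<close> r by auto
    qed
    have many: "diff_dim ?A = diff_dim R" if "t > 1"
    proof (rule enat_eqI)
      fix k
      obtain d where "t = 2 + d" using le_Suc_ex[of 2 t] \<open>t > 1\<close> by auto
      then have d: "t = Suc (Suc d)" by simp
      have t1: "max t 1 = t" using \<open>t > 1\<close> by simp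
      have "gap_chain ?Z t k (ext q)" if "gap_chain ?Y t k q" for q
        using ext_gap_chain[OF that, of 0] ext_in by simp
      then show "enat k \<le> diff_dim ?A \<longleftrightarrow> enat k \<le> diff_dim R"
        unfolding dimA dimR t1 using contr_gap_chain[of d k] unfolding d by blast
    qed
    show ?thesis
      using type zero one many unfolding t by (auto simp: one_enat_def zero_enat_def max_def)
  qed
  moreover have "diff_dim R \<noteq> \<infinity>" if "diff_type R \<ge> 1"
    using fin(2) that by auto
  ultimately show ?thesis
    unfolding J_ring_def using R fin(1) by auto
qed

section \<open>Divisibility at a prime of an arithmetical ring\<close>

context primeideal begin

lemma extended_ideal_is_ideal:
  assumes "J \<subseteq> carrier R"
  shows "ideal (extended_ideal R I J) (localization R I)"
proof -
  interpret L: cring "localization R I" by (rule cring_localization)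
  show ?thesis
    unfolding extended_ideal_def using assms one_notin
    by (intro L.genideal_ideal) (auto intro!: fraction_closed)
qed

lemma fraction_mem_extended_ideal:
  assumes "J \<subseteq> carrier R" "a \<in> J"
  shows "fraction R I a \<one> \<in> extended_ideal R I J"
proof -
  interpret L: cring "localization R I" by (rule cring_localization)
  have "(\<lambda>a. fraction R I a \<one>) ` J \<subseteq> carrier (localization R I)"
    using assms(1) one_notin by (auto intro!: fraction_closed)
  from L.genideal_self[OF this] assms(2) show ?thesis
    unfolding extended_ideal_def by blast
qed

text \<open>
  Fractions with numerator in \<open>J\<close> already form an ideal of the localization.
\<close>

lemma extended_ideal_subset_fractions:
  assumes J: "ideal J R"
  shows "extended_ideal R I J \<subseteq> {fraction R I h s |h s. h \<in> J \<and> s \<in> carrier R - I}"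
    (is "_ \<subseteq> ?F")
proof -
  interpret L: cring "localization R I" by (rule cring_localization)
  interpret J: ideal J R by (rule J)
  have J_carr: "h \<in> carrier R" if "h \<in> J" for h
    using that J.Icarr by blast
  have one: "\<one> \<in> carrier R - I" using one_notin by simp
  have "ideal ?F (localization R I)"
  proof (rule idealI)
    show "ring (localization R I)" by (rule L.ring_axioms)
    show "subgroup ?F (add_monoid (localization R I))"
    proof (rule L.add.subgroupI)
      show "?F \<subseteq> carrier (localization R I)"
        using J_carr by (auto intro!: fraction_closed)
      show "?F \<noteq> {}"
        using J.zero_closed one by blast
    next
      fix x assume "x \<in> ?F"
      then obtain h s where x: "x = fraction R I h s" "h \<in> J" "s \<in> carrier R - I" by blast
      have s: "s \<in> carrier R" "s \<otimes> s \<in> carrier R - I" using x(3) compl_mult by auto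
      have "fraction R I (\<ominus> h) s \<oplus>\<^bsub>localization R I\<^esub> x = fraction R I (\<ominus> h \<otimes> s \<oplus> h \<otimes> s) (s \<otimes> s)"
        unfolding x(1) using x(2,3) J_carr by (intro add_fraction) auto
      also have "\<dots> = fraction R I \<zero> \<one>"
        using x(2) s one J_carr by (intro fraction_eqI) (auto simp: l_minus l_neg)
      also have "\<dots> = \<zero>\<^bsub>localization R I\<^esub>"
        by (simp add: localization_def)
      finally have "\<ominus>\<^bsub>localization R I\<^esub> x = fraction R I (\<ominus> h) s"
        using x J_carr by (intro L.minus_equality) (auto intro!: fraction_closed)
      then show "\<ominus>\<^bsub>localization R I\<^esub> x \<in> ?F"
        using x(2,3) J.a_inv_closed by blast
    next
      fix x y assume "x \<in> ?F" "y \<in> ?F"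
      then obtain h s k t where x: "x = fraction R I h s" "h \<in> J" "s \<in> carrier R - I"
        and y: "y = fraction R I k t" "k \<in> J" "t \<in> carrier R - I" by blast
      have "x \<oplus>\<^bsub>localization R I\<^esub> y = fraction R I (h \<otimes> t \<oplus> k \<otimes> s) (s \<otimes> t)"
        unfolding x(1) y(1) using x y J_carr by (intro add_fraction) auto
      moreover have "h \<otimes> t \<oplus> k \<otimes> s \<in> J"
        using x y by (auto intro!: J.a_closed J.I_r_closed)
      ultimately show "x \<oplus>\<^bsub>localization R I\<^esub> y \<in> ?F"
        using compl_mult[OF x(3) y(3)] by blast
    qed
  next
    fix x r assume x: "x \<in> ?F" and r: "r \<in> carrier (localization R I)"
    from x obtain h s where x: "x = fraction R I h s" "h \<in> J" "s \<in> carrier R - I" by blast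
    from r obtain k t where r: "r = fraction R I k t" "k \<in> carrier R" "t \<in> carrier R - I"
      by (rule localization_cases)
    have "r \<otimes>\<^bsub>localization R I\<^esub> x = fraction R I (k \<otimes> h) (t \<otimes> s)"
      unfolding x(1) r(1) using x r J_carr by (intro mult_fraction) auto
    then show 1: "r \<otimes>\<^bsub>localization R I\<^esub> x \<in> ?F"
      using compl_mult[OF r(3) x(3)] J.I_l_closed[OF x(2) r(2)] by blast
    show "x \<otimes>\<^bsub>localization R I\<^esub> r \<in> ?F"
      using 1 x r J_carr by (subst L.m_comm) (auto intro!: fraction_closed)
  qed
  moreover have "(\<lambda>a. fraction R I a \<one>) ` J \<subseteq> ?F"
    using one by blast
  ultimately show ?thesis
    unfolding extended_ideal_def by (rule L.genideal_minimal)
qed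

text \<open>
  In a local ring, a generator of the ideal generated by \<open>a\<close> and \<open>b\<close> can be chosen among \<open>a\<close> and \<open>b\<close>
  themselves.  The proof clears denominators: \<open>a\<close> and \<open>b\<close> are multiples \<open>\<xi> h\<close> and \<open>\<eta> h\<close> of some
  \<open>h = u a + v b\<close> up to factors outside the prime.  If \<open>\<xi>\<close> or \<open>\<eta>\<close> is a unit at the prime, it can be
  cancelled; if neither is, then \<open>h\<close> vanishes locally.
\<close>

lemma principal_extension_comparable:
  assumes principal: "principalideal (extended_ideal R I (Idl {a, b})) (localization R I)"
    and a: "a \<in> carrier R" and b: "b \<in> carrier R"
  shows "\<exists>s\<in>carrier R - I. \<exists>c\<in>carrier R. s \<otimes> a = c \<otimes> b \<or> s \<otimes> b = c \<otimes> a"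
proof -
  interpret L: cring "localization R I" by (rule cring_localization)
  let ?J = "Idl {a, b}" and ?E = "extended_ideal R I (Idl {a, b})"
  have J: "ideal ?J R" using a b by (intro genideal_ideal) auto
  have J_sub: "?J \<subseteq> carrier R" using ideal.Icarr[OF J] by blast
  have ab: "a \<in> ?J" "b \<in> ?J" using genideal_self[of "{a, b}"] a b by auto
  obtain g where g: "g \<in> carrier (localization R I)" "?E = Idl\<^bsub>localization R I\<^esub> {g}"
    using principalideal.generate[OF principal] by blast
  have E: "?E = {x \<otimes>\<^bsub>localization R I\<^esub> g |x. x \<in> carrier (localization R I)}"
    unfolding g(2) L.cgenideal_eq_genideal[OF g(1), symmetric] cgenideal_def ..
  have "g \<in> ?E"
    unfolding g(2) using L.genideal_self'[OF g(1)] .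
  then obtain h s where h: "g = fraction R I h s" "h \<in> ?J" "s \<in> carrier R - I"
    using extended_ideal_subset_fractions[OF J] by blast
  have hR: "h \<in> carrier R" using h(2) J_sub by blast
  have one: "\<one> \<in> carrier R - I" using one_notin by simp
  have multiple: "\<exists>\<sigma>\<in>carrier R - I. \<exists>\<xi>\<in>carrier R. \<sigma> \<otimes> r = \<xi> \<otimes> h" if "r \<in> ?J" for r
  proof -
    have r: "r \<in> carrier R" using that J_sub by blast
    have "fraction R I r \<one> \<in> ?E"
      using fraction_mem_extended_ideal[OF J_sub that] .
    then obtain x where x: "x \<in> carrier (localization R I)"
      "fraction R I r \<one> = x \<otimes>\<^bsub>localization R I\<^esub> g"
      unfolding E by blast
    from x(1) obtain k t where k: "k \<in> carrier R" "t \<in> carrier R - I" "x = fraction R I k t"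
      by (rule localization_cases)
    have "fraction R I r \<one> = fraction R I (k \<otimes> h) (t \<otimes> s)"
      unfolding x(2) k(3) h(1) using k h hR by (intro mult_fraction) auto
    then obtain u where u: "u \<in> carrier R - I" "u \<otimes> (r \<otimes> (t \<otimes> s)) = u \<otimes> (k \<otimes> h \<otimes> \<one>)"
      using fraction_eq_iff[of r "k \<otimes> h" \<one> "t \<otimes> s"] r k hR one compl_mult[OF k(2) h(3)]
      by auto
    have "u \<otimes> (t \<otimes> s) \<otimes> r = (u \<otimes> k) \<otimes> h"
      using u k(1,2) h(3) hR r by (simp add: m_ac)
    then show ?thesis
      using u(1) k compl_mult[OF u(1) compl_mult[OF k(2) h(3)]] by blast
  qed
  from multiple[OF ab(1)] obtain \<sigma> \<xi> where
    \<sigma>: "\<sigma> \<in> carrier R - I" "\<xi> \<in> carrier R" "\<sigma> \<otimes> a = \<xi> \<otimes> h" by blast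
  from multiple[OF ab(2)] obtain \<tau> \<eta> where
    \<tau>: "\<tau> \<in> carrier R - I" "\<eta> \<in> carrier R" "\<tau> \<otimes> b = \<eta> \<otimes> h" by blast
  have "ideal {u \<otimes> a \<oplus> v \<otimes> b |u v. u \<in> carrier R \<and> v \<in> carrier R} R" (is "ideal ?S R")
  proof (rule idealI)
    show "ring R" by (rule ring_axioms)
    show "subgroup ?S (add_monoid R)"
    proof (rule add.subgroupI)
      show "?S \<subseteq> carrier R" using a b by auto
      show "?S \<noteq> {}" by blast
    next
      fix x assume "x \<in> ?S"
      then obtain u v where x: "x = u \<otimes> a \<oplus> v \<otimes> b" "u \<in> carrier R" "v \<in> carrier R" by blast
      have "\<ominus> x = (\<ominus> u) \<otimes> a \<oplus> (\<ominus> v) \<otimes> b"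
        using x a b by (simp add: l_minus minus_add)
      then show "\<ominus> x \<in> ?S" using x by blast
    next
      fix x y assume "x \<in> ?S" "y \<in> ?S"
      then obtain u v u' v' where x: "x = u \<otimes> a \<oplus> v \<otimes> b" "u \<in> carrier R" "v \<in> carrier R"
        and y: "y = u' \<otimes> a \<oplus> v' \<otimes> b" "u' \<in> carrier R" "v' \<in> carrier R" by blast
      have "x \<oplus> y = (u \<oplus> u') \<otimes> a \<oplus> (v \<oplus> v') \<otimes> b"
        using x y a b by (simp add: l_distr a_ac)
      then show "x \<oplus> y \<in> ?S" using x y by blast
    qed
  next
    fix x r assume "x \<in> ?S" and r: "r \<in> carrier R"
    then obtain u v where x: "x = u \<otimes> a \<oplus> v \<otimes> b" "u \<in> carrier R" "v \<in> carrier R" by blast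
    have "r \<otimes> x = (r \<otimes> u) \<otimes> a \<oplus> (r \<otimes> v) \<otimes> b"
      using x a b r by (simp add: r_distr m_assoc)
    then show "r \<otimes> x \<in> ?S" using x r by blast
    moreover have "x \<otimes> r = r \<otimes> x" using x r a b by (simp add: m_comm)
    ultimately show "x \<otimes> r \<in> ?S" by simp
  qed
  moreover have "a \<in> ?S" "b \<in> ?S"
  proof -
    have "a = \<one> \<otimes> a \<oplus> \<zero> \<otimes> b" "b = \<zero> \<otimes> a \<oplus> \<one> \<otimes> b"
      using a b by simp_all
    then show "a \<in> ?S" "b \<in> ?S" by blast+
  qed
  ultimately have "?J \<subseteq> ?S" by (intro genideal_minimal) auto
  with h(2) obtain u v where uv: "h = u \<otimes> a \<oplus> v \<otimes> b" "u \<in> carrier R" "v \<in> carrier R"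
    by blast
  note [simp] = a b hR uv(2,3) \<sigma>(2) \<tau>(2)
  have [simp]: "\<sigma> \<in> carrier R" "\<tau> \<in> carrier R" using \<sigma>(1) \<tau>(1) by auto
  show ?thesis
  proof (cases "\<xi> \<in> I \<and> \<eta> \<in> I")
    case False
    then consider "\<xi> \<in> carrier R - I" | "\<eta> \<in> carrier R - I" by auto
    then show ?thesis
    proof cases
      case 1
      have "(\<xi> \<otimes> \<tau>) \<otimes> b = (\<eta> \<otimes> \<sigma>) \<otimes> a"
        using \<sigma>(3) \<tau>(3) by (simp add: m_assoc) (simp add: m_lcomm)
      then show ?thesis
        using compl_mult[OF 1 \<tau>(1)] by (intro bexI[of _ "\<xi> \<otimes> \<tau>"] bexI[of _ "\<eta> \<otimes> \<sigma>"]) auto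
    next
      case 2
      have "(\<eta> \<otimes> \<sigma>) \<otimes> a = (\<xi> \<otimes> \<tau>) \<otimes> b"
        using \<sigma>(3) \<tau>(3) by (simp add: m_assoc) (simp add: m_lcomm)
      then show ?thesis
        using compl_mult[OF 2 \<sigma>(1)] by (intro bexI[of _ "\<eta> \<otimes> \<sigma>"] bexI[of _ "\<xi> \<otimes> \<tau>"]) auto
    qed
  next
    case True
    (* the factor annihilating h, outside the prime because both multipliers lie inside *)
    define \<rho> where "\<rho> = \<sigma> \<otimes> \<tau> \<ominus> (u \<otimes> \<tau> \<otimes> \<xi> \<oplus> v \<otimes> \<sigma> \<otimes> \<eta>)"
    have in_I: "u \<otimes> \<tau> \<otimes> \<xi> \<oplus> v \<otimes> \<sigma> \<otimes> \<eta> \<in> I"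
      using True by (auto intro!: a_closed I_l_closed)
    have [simp]: "\<rho> \<in> carrier R" by (simp add: \<rho>_def)
    have "\<rho> \<notin> I"
    proof
      assume "\<rho> \<in> I"
      then have "\<rho> \<oplus> (u \<otimes> \<tau> \<otimes> \<xi> \<oplus> v \<otimes> \<sigma> \<otimes> \<eta>) \<in> I"
        using in_I additive_subgroup.a_closed[OF additive_subgroup_axioms] by blast
      also have "\<rho> \<oplus> (u \<otimes> \<tau> \<otimes> \<xi> \<oplus> v \<otimes> \<sigma> \<otimes> \<eta>) = \<sigma> \<otimes> \<tau>"
        unfolding \<rho>_def by (simp add: minus_eq a_assoc l_neg)
      finally show False using compl_mult[OF \<sigma>(1) \<tau>(1)] by blast
    qed
    have "\<sigma> \<otimes> \<tau> \<otimes> h = (u \<otimes> \<tau>) \<otimes> (\<sigma> \<otimes> a) \<oplus> (v \<otimes> \<sigma>) \<otimes> (\<tau> \<otimes> b)"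
      unfolding uv(1) by (simp add: r_distr m_ac)
    also have "\<dots> = (u \<otimes> \<tau> \<otimes> \<xi> \<oplus> v \<otimes> \<sigma> \<otimes> \<eta>) \<otimes> h"
      unfolding \<sigma>(3) \<tau>(3) by (simp add: l_distr r_distr m_ac)
    finally have "\<rho> \<otimes> h = \<zero>"
      unfolding \<rho>_def by (simp add: minus_eq l_distr l_minus r_neg)
    then have "(\<rho> \<otimes> \<sigma>) \<otimes> a = \<zero>"
      using \<sigma>(3) by (simp add: m_assoc m_lcomm[of \<rho> \<xi> h])
    moreover have "\<rho> \<otimes> \<sigma> \<in> carrier R - I"
      using compl_mult[OF _ \<sigma>(1), of \<rho>] \<open>\<rho> \<notin> I\<close> by simp
    ultimately show ?thesis
      by (intro bexI[of _ "\<rho> \<otimes> \<sigma>"] bexI[of _ \<zero>]) auto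
  qed
qed

lemma add_pow_fraction: "[k] \<cdot>\<^bsub>localization R I\<^esub> \<one>\<^bsub>localization R I\<^esub> = fraction R I ([k] \<cdot> \<one>) \<one>"
  for k :: nat
proof (induction k)
  case 0
  interpret L: cring "localization R I" by (rule cring_localization)
  have "\<zero>\<^bsub>localization R I\<^esub> = fraction R I \<zero> \<one>" by (simp add: localization_def)
  then show ?case by simp
next
  case (Suc k)
  interpret L: cring "localization R I" by (rule cring_localization)
  have one: "\<one> \<in> carrier R - I" using one_notin by simp
  have "[Suc k] \<cdot>\<^bsub>localization R I\<^esub> \<one>\<^bsub>localization R I\<^esub> =
      fraction R I ([k] \<cdot> \<one>) \<one> \<oplus>\<^bsub>localization R I\<^esub> fraction R I \<one> \<one>"
    using Suc by (simp add: L.add.nat_pow_Suc) (simp add: localization_def)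
  also have "\<dots> = fraction R I ([Suc k] \<cdot> \<one>) \<one>"
    using one by (simp add: add_fraction add.nat_pow_Suc)
  finally show ?case .
qed

text \<open>
  Positive integers in the prime would vanish in the residue field.
\<close>

lemma residue_characteristic_zero:
  fixes k :: nat
  assumes "characteristic_zero (residue_field R I)" "k > 0"
  shows "[k] \<cdot> \<one> \<notin> I"
proof
  assume k: "[k] \<cdot> \<one> \<in> I"
  interpret L: cring "localization R I" by (rule cring_localization)
  have IR: "I \<subseteq> carrier R" using Icarr by blast
  interpret E: ideal "extended_ideal R I I" "localization R I"
    by (rule extended_ideal_is_ideal[OF IR])
  let ?E = "extended_ideal R I I" and ?L = "localization R I"
  have "[j] \<cdot>\<^bsub>residue_field R I\<^esub> \<one>\<^bsub>residue_field R I\<^esub> = ?E +>\<^bsub>?L\<^esub> ([j] \<cdot>\<^bsub>?L\<^esub> \<one>\<^bsub>?L\<^esub>)" for j :: nat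
  proof (induction j)
    case 0
    have "?E +>\<^bsub>?L\<^esub> \<zero>\<^bsub>?L\<^esub> = ?E"
      using E.zero_closed by (rule E.a_rcos_const)
    then show ?case
      by (simp add: residue_field_def FactRing_def add_pow_def nat_pow_def)
  next
    case (Suc j)
    have "[Suc j] \<cdot>\<^bsub>residue_field R I\<^esub> \<one>\<^bsub>residue_field R I\<^esub> =
        [j] \<cdot>\<^bsub>residue_field R I\<^esub> \<one>\<^bsub>residue_field R I\<^esub> \<oplus>\<^bsub>residue_field R I\<^esub> \<one>\<^bsub>residue_field R I\<^esub>"
      by (simp add: add_pow_def nat_pow_def)
    also have "\<dots> = (?E +>\<^bsub>?L\<^esub> ([j] \<cdot>\<^bsub>?L\<^esub> \<one>\<^bsub>?L\<^esub>)) <+>\<^bsub>?L\<^esub> (?E +>\<^bsub>?L\<^esub> \<one>\<^bsub>?L\<^esub>)"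
      unfolding Suc by (simp add: residue_field_def FactRing_def)
    also have "\<dots> = ?E +>\<^bsub>?L\<^esub> ([j] \<cdot>\<^bsub>?L\<^esub> \<one>\<^bsub>?L\<^esub> \<oplus>\<^bsub>?L\<^esub> \<one>\<^bsub>?L\<^esub>)"
      by (rule E.a_rcos_sum) auto
    finally show ?case by (simp add: L.add.nat_pow_Suc)
  qed
  then have "[k] \<cdot>\<^bsub>residue_field R I\<^esub> \<one>\<^bsub>residue_field R I\<^esub> = ?E +>\<^bsub>?L\<^esub> fraction R I ([k] \<cdot> \<one>) \<one>"
    unfolding add_pow_fraction by simp
  also have "\<dots> = ?E"
    using fraction_mem_extended_ideal[OF IR k] by (rule E.a_rcos_const)
  also have "\<dots> = \<zero>\<^bsub>residue_field R I\<^esub>"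
    by (simp add: residue_field_def FactRing_def)
  finally show False
    using assms unfolding characteristic_zero_def by blast
qed

end

text \<open>
  Local divisibility is a total preorder, so a finite family has a least element.  The denominator
  \<open>s\<close> is chosen uniformly for the family.
\<close>

lemma (in primeideal) exists_least_divisible:
  assumes comparable: "\<And>a b. a \<in> carrier R \<Longrightarrow> b \<in> carrier R \<Longrightarrow>
      \<exists>s\<in>carrier R - I. \<exists>c\<in>carrier R. s \<otimes> a = c \<otimes> b \<or> s \<otimes> b = c \<otimes> a"
    and "finite C" "C \<noteq> {}" "\<And>m. f m \<in> carrier R"
  shows "\<exists>m1\<in>C. \<exists>s\<in>carrier R - I. \<forall>m\<in>C. \<exists>e\<in>carrier R. s \<otimes> f m = e \<otimes> f m1"
  using assms(2,3)
proof (induction C rule: finite_ne_induct)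
  case (singleton x)
  then show ?case
    using one_notin assms(4) by (auto intro!: bexI[of _ \<one>])
next
  case (insert x C)
  note [simp] = assms(4)
  obtain m1 s where m1: "m1 \<in> C" "s \<in> carrier R - I"
    "\<forall>m\<in>C. \<exists>e\<in>carrier R. s \<otimes> f m = e \<otimes> f m1"
    using insert.IH by blast
  obtain t c where t: "t \<in> carrier R - I" "c \<in> carrier R"
    "t \<otimes> f x = c \<otimes> f m1 \<or> t \<otimes> f m1 = c \<otimes> f x"
    using comparable[of "f x" "f m1"] by auto
  have [simp]: "s \<in> carrier R" "t \<in> carrier R" using m1(2) t(1) by auto
  have st: "s \<otimes> t \<in> carrier R - I" by (rule compl_mult[OF m1(2) t(1)])
  from t(3) show ?case
  proof
    assume eq: "t \<otimes> f x = c \<otimes> f m1"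
    have "\<exists>e\<in>carrier R. s \<otimes> t \<otimes> f m = e \<otimes> f m1" if "m \<in> insert x C" for m
    proof (cases "m = x")
      case True
      have "s \<otimes> t \<otimes> f x = (s \<otimes> c) \<otimes> f m1" using eq t(2) by (simp add: m_assoc)
      then show ?thesis unfolding True by (rule bexI) (simp add: t(2))
    next
      case False
      with that have "m \<in> C" by simp
      from bspec[OF m1(3) this] obtain e where e: "e \<in> carrier R" "s \<otimes> f m = e \<otimes> f m1" ..
      have "s \<otimes> t \<otimes> f m = t \<otimes> (s \<otimes> f m)" by (simp add: m_ac)
      also have "\<dots> = (t \<otimes> e) \<otimes> f m1" using e by (simp add: m_assoc)
      finally show ?thesis by (rule bexI) (simp add: e(1))
    qed
    then show ?thesis using m1(1) st by blast
  next
    assume eq: "t \<otimes> f m1 = c \<otimes> f x"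
    have "\<exists>e\<in>carrier R. s \<otimes> t \<otimes> f m = e \<otimes> f x" if "m \<in> insert x C" for m
    proof (cases "m = x")
      case True
      then show ?thesis by (intro bexI[of _ "s \<otimes> t"]) simp_all
    next
      case False
      with that have "m \<in> C" by simp
      from bspec[OF m1(3) this] obtain e where e: "e \<in> carrier R" "s \<otimes> f m = e \<otimes> f m1" ..
      have "s \<otimes> t \<otimes> f m = t \<otimes> (s \<otimes> f m)" by (simp add: m_ac)
      also have "\<dots> = e \<otimes> (t \<otimes> f m1)" using e by (simp add: m_lcomm)
      also have "\<dots> = (e \<otimes> c) \<otimes> f x" using eq e(1) t(2) by (simp add: m_assoc)
      finally show ?thesis by (rule bexI) (simp add: e(1) t(2))
    qed
    then show ?thesis using st by blast
  qed
qed

section \<open>Algebraic elements modulo a prime\<close>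

lemma (in ideal) add_in: "a \<in> I \<Longrightarrow> b \<in> I \<Longrightarrow> a \<oplus> b \<in> I"
  using additive_subgroup.a_closed[OF additive_subgroup_axioms] .

lemma (in ideal) finsum_in: "finite S \<Longrightarrow> (\<And>k. k \<in> S \<Longrightarrow> f k \<in> I) \<Longrightarrow> finsum R f S \<in> I"
proof (induction S rule: finite_induct)
  case empty
  then show ?case by (simp add: zero_closed)
next
  case (insert k S)
  have "finsum R f (insert k S) = f k \<oplus> finsum R f S"
    using insert Icarr by (intro finsum_insert) auto
  also have "\<dots> \<in> I" using insert by (intro add_in) auto
  finally show ?case .
qed

lemma (in ideal) add_pow_in: "a \<in> I \<Longrightarrow> [k] \<cdot> a \<in> I" for k :: nat
  by (induction k) (auto simp: zero_closed add.nat_pow_Suc intro: add_in)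

context ideal begin

lemma cancel_right: "a \<in> carrier R \<Longrightarrow> b \<in> I \<Longrightarrow> a \<oplus> b \<in> I \<Longrightarrow> a \<in> I"
proof -
  assume a: "a \<in> carrier R" and b: "b \<in> I" and ab: "a \<oplus> b \<in> I"
  have "(a \<oplus> b) \<oplus> \<ominus> b \<in> I"
    using ab b by blast
  moreover have "(a \<oplus> b) \<oplus> \<ominus> b = a"
    using a Icarr[OF b] by (simp add: a_assoc r_neg)
  ultimately show "a \<in> I" by simp
qed

lemma cancel_left: "a \<in> carrier R \<Longrightarrow> b \<in> I \<Longrightarrow> b \<oplus> a \<in> I \<Longrightarrow> a \<in> I"
  using cancel_right[of a b] Icarr[of b] by (simp add: a_comm)

end

lemma (in primeideal) pow_notin: "a \<in> carrier R \<Longrightarrow> a \<notin> I \<Longrightarrow> a [^] (k::nat) \<notin> I"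
proof (induction k)
  case (Suc k)
  then show ?case using I_prime[of "a [^] k" a] by auto
qed (simp add: one_notin)

context cring begin

text \<open>
  The elements \<open>\<Sum>i<d. b\<^sub>i y\<^sup>i\<close> with coefficients in \<open>B\<close>; an element may have several such
  representations.
\<close>

primrec poly_below :: "'a set \<Rightarrow> 'a \<Rightarrow> nat \<Rightarrow> 'a set" where
  "poly_below B y 0 = {\<zero>}"
| "poly_below B y (Suc d) = {b \<otimes> y [^] d \<oplus> w |b w. b \<in> B \<and> w \<in> poly_below B y d}"

text \<open>
  Asking for a leading coefficient outside \<open>P\<close> is the same as asking for some coefficient outside
  \<open>P\<close>, since leading terms in \<open>P\<close> can be dropped from a relation.
\<close>

definition algebraic_mod :: "'a set \<Rightarrow> 'a set \<Rightarrow> 'a \<Rightarrow> bool" where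
  "algebraic_mod P B y \<longleftrightarrow> (\<exists>d. \<exists>b\<in>B - P. \<exists>w\<in>poly_below B y d. b \<otimes> y [^] d \<oplus> w \<in> P)"

lemma poly_below_coeff_mono: "B \<subseteq> C \<Longrightarrow> poly_below B y d \<subseteq> poly_below C y d"
  by (induction d) fastforce+

lemma algebraic_mod_mono: "algebraic_mod P B y \<Longrightarrow> B \<subseteq> C \<Longrightarrow> algebraic_mod P C y"
  unfolding algebraic_mod_def using poly_below_coeff_mono[of B C y] by blast

context
  fixes B :: "'a set" and y :: 'a
  assumes B: "subring B R" and y [simp]: "y \<in> carrier R"
begin

lemma coeff_carrier: "b \<in> B \<Longrightarrow> b \<in> carrier R"
  using subringE(1)[OF B] by blast

lemma poly_below_SucI: "b \<in> B \<Longrightarrow> w \<in> poly_below B y d \<Longrightarrow> b \<otimes> y [^] d \<oplus> w \<in> poly_below B y (Suc d)"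
  by auto

lemma poly_below_SucE:
  assumes "v \<in> poly_below B y (Suc d)"
  obtains b w where "b \<in> B" "w \<in> poly_below B y d" "v = b \<otimes> y [^] d \<oplus> w"
  using assms by auto

lemma poly_below_carrier: "w \<in> poly_below B y d \<Longrightarrow> w \<in> carrier R"
  by (induction d arbitrary: w) (use coeff_carrier in auto)

lemma poly_below_Suc: "w \<in> poly_below B y d \<Longrightarrow> w \<in> poly_below B y (Suc d)"
  using poly_below_SucI[OF subringE(2)[OF B], of w d] poly_below_carrier[of w d] by simp

lemma poly_below_mono: "d \<le> e \<Longrightarrow> w \<in> poly_below B y d \<Longrightarrow> w \<in> poly_below B y e"
  by (induction e rule: dec_induct) (use poly_below_Suc in auto)

lemma poly_below_zero: "\<zero> \<in> poly_below B y d"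
  using poly_below_mono[of 0 d \<zero>] by simp

lemma poly_below_add:
  "v \<in> poly_below B y d \<Longrightarrow> w \<in> poly_below B y d \<Longrightarrow> v \<oplus> w \<in> poly_below B y d"
proof (induction d arbitrary: v w)
  case (Suc d)
  from Suc.prems(1) obtain b v' where v: "b \<in> B" "v' \<in> poly_below B y d" "v = b \<otimes> y [^] d \<oplus> v'"
    by (rule poly_below_SucE)
  from Suc.prems(2) obtain c w' where w: "c \<in> B" "w' \<in> poly_below B y d" "w = c \<otimes> y [^] d \<oplus> w'"
    by (rule poly_below_SucE)
  have "v \<oplus> w = (b \<oplus> c) \<otimes> y [^] d \<oplus> (v' \<oplus> w')"
    using v w coeff_carrier poly_below_carrier[of _ d] by (simp add: l_distr a_ac)
  then show ?case
    using poly_below_SucI[OF subringE(7)[OF B v(1) w(1)] Suc.IH[OF v(2) w(2)]] by simp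
qed simp

lemma poly_below_smult: "b \<in> B \<Longrightarrow> w \<in> poly_below B y d \<Longrightarrow> b \<otimes> w \<in> poly_below B y d"
proof (induction d arbitrary: w)
  case (Suc d)
  from Suc.prems(2) obtain c w' where w: "c \<in> B" "w' \<in> poly_below B y d" "w = c \<otimes> y [^] d \<oplus> w'"
    by (rule poly_below_SucE)
  have "b \<otimes> w = (b \<otimes> c) \<otimes> y [^] d \<oplus> b \<otimes> w'"
    using w Suc.prems(1) coeff_carrier poly_below_carrier[of _ d] by (simp add: r_distr m_assoc)
  then show ?case
    using poly_below_SucI[OF subringE(6)[OF B Suc.prems(1) w(1)] Suc.IH[OF Suc.prems(1) w(2)]] by simp
qed (use coeff_carrier in simp)

lemma poly_below_minus:
  "v \<in> poly_below B y d \<Longrightarrow> w \<in> poly_below B y d \<Longrightarrow> v \<ominus> w \<in> poly_below B y d"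
proof -
  assume v: "v \<in> poly_below B y d" and w: "w \<in> poly_below B y d"
  have "\<ominus> \<one> \<otimes> w \<in> poly_below B y d"
    by (rule poly_below_smult[OF subringE(5)[OF B subringE(3)[OF B]] w])
  moreover have "\<ominus> \<one> \<otimes> w = \<ominus> w"
    using poly_below_carrier[OF w] by (simp add: l_minus)
  ultimately show ?thesis
    unfolding minus_eq using poly_below_add[OF v] by simp
qed

lemma poly_below_shift: "w \<in> poly_below B y d \<Longrightarrow> y \<otimes> w \<in> poly_below B y (Suc d)"
proof (induction d arbitrary: w)
  case 0
  then show ?case using poly_below_zero[of "Suc 0"] by simp
next
  case (Suc d)
  from Suc.prems obtain c w' where w: "c \<in> B" "w' \<in> poly_below B y d" "w = c \<otimes> y [^] d \<oplus> w'"
    by (rule poly_below_SucE)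
  have "y \<otimes> w = c \<otimes> y [^] Suc d \<oplus> y \<otimes> w'"
    using w coeff_carrier poly_below_carrier[of _ d] by (simp add: r_distr m_ac)
  then show ?case
    using poly_below_SucI[OF w(1) Suc.IH[OF w(2)]] by simp
qed

lemma poly_below_shift_pow: "w \<in> poly_below B y d \<Longrightarrow> y [^] k \<otimes> w \<in> poly_below B y (d + k)"
proof (induction k)
  case 0
  then show ?case using poly_below_carrier[of w d] by simp
next
  case (Suc k)
  have "y [^] Suc k \<otimes> w = y \<otimes> (y [^] k \<otimes> w)"
    using poly_below_carrier[OF Suc.prems] by (simp add: m_ac)
  then show ?case
    using poly_below_shift[OF Suc.IH[OF Suc.prems]] by simp
qed

lemma poly_below_const: "b \<in> B \<Longrightarrow> b \<in> poly_below B y (Suc 0)"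
  using poly_below_SucI[of b \<zero> 0] coeff_carrier[of b] by simp

text \<open>
  Here \<open>z\<close> and \<open>z x\<close> play the role of the leading powers of divisor and dividend; the leading terms
  cancel.
\<close>

lemma elimination_step:
  assumes [simp]: "g \<in> carrier R" "u \<in> carrier R" "x \<in> carrier R" "z \<in> carrier R"
    "U \<in> carrier R" "G \<in> carrier R"
  shows "g \<otimes> (u \<otimes> (z \<otimes> x) \<oplus> U) \<ominus> u \<otimes> x \<otimes> (g \<otimes> z \<oplus> G) = g \<otimes> U \<ominus> u \<otimes> (x \<otimes> G)"
proof -
  have "(v \<oplus> a) \<ominus> (v \<oplus> b) = a \<ominus> b"
    if [simp]: "v \<in> carrier R" "a \<in> carrier R" "b \<in> carrier R" for v a b
  proof -
    have "(v \<oplus> a) \<ominus> (v \<oplus> b) = (v \<oplus> \<ominus> v) \<oplus> (a \<oplus> \<ominus> b)"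
      by (simp add: minus_eq minus_add a_ac del: r_neg r_neg1 r_neg2 l_neg)
    then show ?thesis by (simp add: minus_eq r_neg)
  qed
  note this[of "u \<otimes> x \<otimes> (g \<otimes> z)" "g \<otimes> U" "u \<otimes> (x \<otimes> G)"]
  moreover have "g \<otimes> (u \<otimes> (z \<otimes> x)) = u \<otimes> x \<otimes> (g \<otimes> z)"
    by (simp add: m_ac)
  moreover have "u \<otimes> x \<otimes> (g \<otimes> z \<oplus> G) = u \<otimes> x \<otimes> (g \<otimes> z) \<oplus> u \<otimes> (x \<otimes> G)"
    by (simp add: r_distr m_assoc)
  ultimately show ?thesis by (simp add: r_distr)
qed

lemma collect_quotient:
  assumes [simp]: "h \<in> carrier R" "v \<in> carrier R" "w \<in> carrier R" "t \<in> carrier R" "G \<in> carrier R"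
  shows "h \<otimes> (v \<ominus> w \<otimes> G) \<ominus> t \<otimes> G = h \<otimes> v \<ominus> (h \<otimes> w \<oplus> t) \<otimes> G"
  by (simp add: minus_eq r_distr l_distr r_minus minus_add m_assoc a_assoc)

text \<open>
  Division with remainder by a divisor whose leading coefficient \<open>g\<close> need not be a unit, hence only
  up to a power of \<open>g\<close>.  The leading coefficient of the quotient is recorded because it has to be
  seen to lie outside a prime.
\<close>

lemma pseudo_division:
  assumes g: "g \<in> B" and G': "G' \<in> poly_below B y b"
    and u: "u \<in> B" and U': "U' \<in> poly_below B y (b + d)"
  shows "\<exists>k::nat. \<exists>T'\<in>poly_below B y d.
    g [^] Suc k \<otimes> (u \<otimes> y [^] (b + d) \<oplus> U') \<ominus>
      (g [^] k \<otimes> u \<otimes> y [^] d \<oplus> T') \<otimes> (g \<otimes> y [^] b \<oplus> G') \<in> poly_below B y b"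
  using u U'
proof (induction d arbitrary: u U')
  case (0 u U')
  note [simp] = coeff_carrier[OF g] coeff_carrier[OF 0(1)] poly_below_carrier[OF G']
    poly_below_carrier[OF 0(2)]
  have "g \<otimes> U' \<ominus> u \<otimes> G' \<in> poly_below B y b"
    using 0 g G' by (auto intro!: poly_below_minus poly_below_smult)
  also have "g \<otimes> U' \<ominus> u \<otimes> G' =
    g [^] Suc 0 \<otimes> (u \<otimes> y [^] (b + 0) \<oplus> U') \<ominus>
      (g [^] (0::nat) \<otimes> u \<otimes> y [^] (0::nat) \<oplus> \<zero>) \<otimes> (g \<otimes> y [^] b \<oplus> G')"
  proof -
    have "g \<otimes> U' \<ominus> u \<otimes> G' = g \<otimes> (u \<otimes> y [^] b \<oplus> U') \<ominus> u \<otimes> (g \<otimes> y [^] b \<oplus> G')"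
      using elimination_step[of g u \<one> "y [^] b" U' G'] by simp
    then show ?thesis by simp
  qed
  finally show ?case
    by (intro exI[of _ "0::nat"] bexI[of _ \<zero>]) simp_all
next
  case (Suc d u U')
  note [simp] = coeff_carrier[OF g] coeff_carrier[OF Suc.prems(1)] poly_below_carrier[OF G']
    poly_below_carrier[OF Suc.prems(2)]
  \<comment> \<open>One elimination step lowers the degree of the dividend.\<close>
  define U1 where "U1 = g \<otimes> U' \<ominus> u \<otimes> (y [^] Suc d \<otimes> G')"
  have U1_eq: "U1 = g \<otimes> (u \<otimes> y [^] (b + Suc d) \<oplus> U') \<ominus> u \<otimes> y [^] Suc d \<otimes> (g \<otimes> y [^] b \<oplus> G')"
    unfolding U1_def nat_pow_mult[OF y, symmetric] by (rule elimination_step[symmetric]) simp_all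
  have "U1 \<in> poly_below B y (Suc (b + d))"
    unfolding U1_def using Suc.prems g poly_below_shift_pow[OF G', of "Suc d"]
    by (auto intro!: poly_below_minus poly_below_smult simp del: nat_pow_Suc poly_below.simps)
  then obtain u1 U1' where U1': "u1 \<in> B" "U1' \<in> poly_below B y (b + d)" "U1 = u1 \<otimes> y [^] (b + d) \<oplus> U1'"
    by (rule poly_below_SucE)
  from Suc.IH[OF U1'(1,2)] obtain k :: nat and T'' where T'': "T'' \<in> poly_below B y d"
    and rem: "g [^] Suc k \<otimes> U1 \<ominus> (g [^] k \<otimes> u1 \<otimes> y [^] d \<oplus> T'') \<otimes> (g \<otimes> y [^] b \<oplus> G') \<in> poly_below B y b"
    unfolding U1'(3) by blast
  define T' where "T' = g [^] k \<otimes> u1 \<otimes> y [^] d \<oplus> T''"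
  have gk: "g [^] k \<in> B"
    by (induction k) (use g subringE(3,6)[OF B] in auto)
  have T': "T' \<in> poly_below B y (Suc d)"
    unfolding T'_def using subringE(6)[OF B gk U1'(1)] T'' by (rule poly_below_SucI)
  note [simp] = poly_below_carrier[OF T'] coeff_carrier[OF gk]
  have "g [^] Suc k \<otimes> U1 \<ominus> T' \<otimes> (g \<otimes> y [^] b \<oplus> G') =
    g [^] Suc (Suc k) \<otimes> (u \<otimes> y [^] (b + Suc d) \<oplus> U') \<ominus>
      (g [^] Suc k \<otimes> u \<otimes> y [^] Suc d \<oplus> T') \<otimes> (g \<otimes> y [^] b \<oplus> G')"
  proof -
    let ?v = "u \<otimes> y [^] (b + Suc d) \<oplus> U'" and ?G = "g \<otimes> y [^] b \<oplus> G'"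
    have "g [^] Suc k \<otimes> (g \<otimes> ?v) = g [^] Suc (Suc k) \<otimes> ?v"
      by (simp add: m_ac)
    moreover have "g [^] Suc k \<otimes> (u \<otimes> y [^] Suc d) = g [^] Suc k \<otimes> u \<otimes> y [^] Suc d"
      by (simp add: m_ac)
    ultimately show ?thesis
      unfolding U1_eq using collect_quotient[of "g [^] Suc k" "g \<otimes> ?v" "u \<otimes> y [^] Suc d" T' ?G]
      by (simp del: nat_pow_Suc)
  qed
  then show ?case
    using rem T' unfolding T'_def[symmetric] by metis
qed

text \<open>
  This is incomparability of nested primes over a subring with equal traces.  Take an element
  \<open>G\<close> of \<open>Q\<close> outside \<open>P\<close> of least degree and a relation \<open>M\<close> for \<open>y\<close> modulo \<open>P\<close> of least degree.  Whichever
  has the larger degree is divided by the other, and the remainder lies in \<open>P\<close> by minimality of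
  \<open>G\<close>.  Then either \<open>G\<close> lies in \<open>P\<close>, or the quotient is a shorter relation for \<open>y\<close>.
\<close>

lemma agree_on_adjunction_if_algebraic:
  assumes P: "primeideal P R" and Q: "primeideal Q R" and "P \<subseteq> Q"
    and agree: "B \<inter> Q \<subseteq> P" and alg: "algebraic_mod P B y"
  shows "poly_below B y d \<inter> Q \<subseteq> P"
proof (rule ccontr)
  interpret P: primeideal P R by (rule P)
  interpret Q: primeideal Q R by (rule Q)
  assume neg: "\<not> poly_below B y d \<inter> Q \<subseteq> P"
  define e where "e = (LEAST e. \<not> poly_below B y e \<inter> Q \<subseteq> P)"
  have bad: "\<not> poly_below B y e \<inter> Q \<subseteq> P"
    unfolding e_def using neg by (rule LeastI)
  then have "e \<noteq> 0" using P.zero_closed by (intro notI) auto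
  then obtain b where e: "e = Suc b" by (cases e) auto
  have below: "w \<in> P" if "w \<in> poly_below B y b" "w \<in> Q" for w
  proof -
    have "b < e" by (simp add: e)
    then have "poly_below B y b \<inter> Q \<subseteq> P"
      unfolding e_def using not_less_Least by blast
    then show ?thesis using that by blast
  qed
  obtain G where G: "G \<in> poly_below B y (Suc b)" "G \<in> Q" "G \<notin> P"
    using bad unfolding e by blast
  from G(1) obtain g G' where g: "g \<in> B" "G' \<in> poly_below B y b" "G = g \<otimes> y [^] b \<oplus> G'"
    by (rule poly_below_SucE)
  note [simp] = coeff_carrier[OF g(1)] poly_below_carrier[OF g(2)]
  have G_carr [simp]: "G \<in> carrier R" unfolding g(3) by simp
  have "g \<notin> P"
  proof
    assume "g \<in> P"
    then have gP: "g \<otimes> y [^] b \<in> P" by (intro P.I_r_closed) auto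
    then have "G' \<in> Q"
      using G(2) \<open>P \<subseteq> Q\<close> unfolding g(3) by (intro Q.cancel_left[of G' "g \<otimes> y [^] b"]) auto
    then have "G' \<in> P" using below g(2) by blast
    then show False using G(3) gP unfolding g(3) by blast
  qed
  have "b \<noteq> 0"
  proof
    assume "b = 0"
    then have "G = g" using g(2) unfolding g(3) by simp
    then show False using agree g(1) G(2,3) by blast
  qed
  define relation where "relation a \<longleftrightarrow> (\<exists>m\<in>B - P. \<exists>w\<in>poly_below B y a. m \<otimes> y [^] a \<oplus> w \<in> P)" for a :: nat
  define a where "a = (LEAST a. relation a)"
  have "relation a"
    using alg unfolding a_def algebraic_mod_def relation_def[symmetric] by (blast intro: LeastI)
  then obtain m M' where m: "m \<in> B" "m \<notin> P" "M' \<in> poly_below B y a" "m \<otimes> y [^] a \<oplus> M' \<in> P"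
    unfolding relation_def by blast
  define M where "M = m \<otimes> y [^] a \<oplus> M'"
  note [simp] = coeff_carrier[OF m(1)] poly_below_carrier[OF m(3)]
  have M: "M \<in> P" "M \<in> carrier R" using m(4) by (simp_all add: M_def)
  show False
  proof (cases "a \<le> b")
    case True
    then obtain d where d: "b = a + d" using le_Suc_ex by blast
    \<comment> \<open>Divide \<open>G\<close> by the relation \<open>M\<close>: the remainder has degree below \<open>a\<close>.\<close>
    from pseudo_division[OF m(1,3) g(1), of G' d] g(2) obtain k :: nat and T' where
      T': "T' \<in> poly_below B y d"
      "m [^] Suc k \<otimes> G \<ominus> (m [^] k \<otimes> g \<otimes> y [^] d \<oplus> T') \<otimes> M \<in> poly_below B y a"
      unfolding d[symmetric] g(3)[symmetric] M_def[symmetric] by blast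
    define T where "T = m [^] k \<otimes> g \<otimes> y [^] d \<oplus> T'"
    have T: "T \<in> carrier R" using poly_below_carrier[OF T'(1)] by (simp add: T_def)
    have TM: "\<ominus> (T \<otimes> M) \<in> P"
      using M(1) T by (auto intro!: P.a_inv_closed P.I_l_closed)
    let ?W = "m [^] Suc k \<otimes> G \<ominus> T \<otimes> M"
    have "?W \<in> poly_below B y b"
      using poly_below_mono[OF True] T'(2) unfolding T_def by blast
    moreover have "?W \<in> Q"
      unfolding minus_eq using TM \<open>P \<subseteq> Q\<close> G(2) by (intro Q.a_closed Q.I_l_closed) auto
    ultimately have "?W \<in> P" by (rule below)
    then have "m [^] Suc k \<otimes> G \<in> P"
      using TM P.cancel_right[of "m [^] Suc k \<otimes> G" "\<ominus> (T \<otimes> M)"] by (simp add: minus_eq)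
    then show False
      using P.I_prime[of "m [^] Suc k" G] P.pow_notin[of m "Suc k"] m(2) G(3) by auto
  next
    case False
    then obtain d where d: "a = b + d" using le_Suc_ex[of b a] by auto
    \<comment> \<open>Divide the relation by \<open>G\<close>: the quotient is a relation of smaller degree.\<close>
    from pseudo_division[OF g(1,2) m(1), of M' d] m(3) obtain k :: nat and T' where
      T': "T' \<in> poly_below B y d"
      "g [^] Suc k \<otimes> M \<ominus> (g [^] k \<otimes> m \<otimes> y [^] d \<oplus> T') \<otimes> G \<in> poly_below B y b"
      unfolding d[symmetric] g(3)[symmetric] M_def[symmetric] by blast
    define T where "T = g [^] k \<otimes> m \<otimes> y [^] d \<oplus> T'"
    have T: "T \<in> carrier R" using poly_below_carrier[OF T'(1)] by (simp add: T_def)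
    let ?W = "g [^] Suc k \<otimes> M \<ominus> T \<otimes> G"
    have gM: "g [^] Suc k \<otimes> M \<in> P"
      using M(1) by (intro P.I_l_closed) auto
    have "g [^] Suc k \<otimes> M \<in> Q" "\<ominus> (T \<otimes> G) \<in> Q"
      using gM \<open>P \<subseteq> Q\<close> Q.a_inv_closed[OF Q.I_l_closed[OF G(2) T]] by blast+
    then have "?W \<in> Q"
      unfolding minus_eq by (rule additive_subgroup.a_closed[OF Q.additive_subgroup_axioms])
    with T'(2)[folded T_def] have "?W \<in> P" by (rule below)
    then have "\<ominus> (T \<otimes> G) \<in> P"
      unfolding minus_eq using gM T M(2)
      by (intro P.cancel_left[of "\<ominus> (T \<otimes> G)" "g [^] Suc k \<otimes> M"]) auto
    then have "T \<otimes> G \<in> P"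
      using P.a_inv_closed[of "\<ominus> (T \<otimes> G)"] T by simp
    then have "T \<in> P" using P.I_prime[of T G] T G(3) by auto
    moreover have gk: "g [^] k \<in> B"
      by (induction k) (use g(1) subringE(3,6)[OF B] in auto)
    moreover have "g [^] k \<otimes> m \<notin> P"
      using P.I_prime[of "g [^] k" m] P.pow_notin[of g k] \<open>g \<notin> P\<close> m(2) by auto
    ultimately have "relation d"
      unfolding relation_def T_def using T'(1) subringE(6)[OF B gk m(1)] by blast
    moreover have "d < a" using d \<open>b \<noteq> 0\<close> by simp
    ultimately show False using not_less_Least unfolding a_def by blast
  qed
qed

lemma coefficient_in_if_not_algebraic:
  assumes P: "primeideal P R" and nalg: "\<not> algebraic_mod P B y"
    and b: "b \<in> B" and w: "w \<in> poly_below B y d" and in_P: "b \<otimes> y [^] d \<oplus> w \<in> P"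
  shows "b \<in> P" "w \<in> P"
proof -
  interpret P: primeideal P R by (rule P)
  show "b \<in> P"
    using nalg b w in_P unfolding algebraic_mod_def by blast
  then have "b \<otimes> y [^] d \<in> P"
    by (intro P.I_r_closed) auto
  then show "w \<in> P"
    using in_P poly_below_carrier[OF w] P.cancel_left[of w] by blast
qed

text \<open>
  If \<open>y\<close> is transcendental modulo \<open>Q\<close>, then membership in \<open>Q\<close> can be tested on coefficients.
\<close>

lemma agree_on_adjunction_if_not_algebraic:
  assumes P: "primeideal P R" and Q: "primeideal Q R"
    and agree: "B \<inter> Q \<subseteq> P" and nalg: "\<not> algebraic_mod Q B y"
  shows "poly_below B y d \<inter> Q \<subseteq> P"
proof (induction d)
  interpret P: primeideal P R by (rule P)
  case 0
  then show ?case by auto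
next
  interpret P: primeideal P R by (rule P)
  case (Suc d)
  show ?case
  proof
    fix v assume v: "v \<in> poly_below B y (Suc d) \<inter> Q"
    then obtain b w where b: "b \<in> B" "w \<in> poly_below B y d" "v = b \<otimes> y [^] d \<oplus> w"
      by (blast elim: poly_below_SucE)
    with v coefficient_in_if_not_algebraic[OF Q nalg b(1,2)] have "b \<in> Q" "w \<in> Q"
      by auto
    then have "b \<in> P" "w \<in> P" using Suc.IH agree b by blast+
    then show "v \<in> P"
      unfolding b(3) by (intro P.a_closed P.I_r_closed) auto
  qed
qed

end

end

context ordinary_diff_ring begin

lemma der_pow: "y \<in> carrier R \<Longrightarrow> \<delta> (y [^] Suc k) = [Suc k] \<cdot> (y [^] k \<otimes> \<delta> y)"
proof (induction k)
  case (Suc k)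
  have "\<delta> (y [^] Suc (Suc k)) = \<delta> (y [^] Suc k) \<otimes> y \<oplus> y [^] Suc k \<otimes> \<delta> y"
    using Suc.prems der_mult[of "y [^] Suc k" y] by simp
  also have "\<dots> = [Suc k] \<cdot> (y [^] k \<otimes> \<delta> y) \<otimes> y \<oplus> y [^] Suc k \<otimes> \<delta> y"
    using Suc by simp
  also have "[Suc k] \<cdot> (y [^] k \<otimes> \<delta> y) \<otimes> y = [Suc k] \<cdot> (y [^] Suc k \<otimes> \<delta> y)"
    using Suc.prems by (subst add_pow_ldistr) (auto simp: m_ac)
  also have "[Suc k] \<cdot> (y [^] Suc k \<otimes> \<delta> y) \<oplus> y [^] Suc k \<otimes> \<delta> y = [Suc (Suc k)] \<cdot> (y [^] Suc k \<otimes> \<delta> y)"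
    using Suc.prems by (simp add: add.nat_pow_Suc)
  finally show ?case .
qed (simp add: der_one)

text \<open>
  The element \<open>s\<close> is the formal derivative of the polynomial \<open>w\<close> with respect to \<open>y\<close>.
\<close>

lemma der_poly_below:
  assumes B: "subring B R" and C: "subring C R" and "B \<subseteq> C" and y: "y \<in> C"
    and der_B: "\<And>b. b \<in> B \<Longrightarrow> \<delta> b \<in> C"
    and w: "w \<in> poly_below B y d"
  shows "\<exists>s\<in>poly_below B y (d - 1). \<exists>t\<in>C. \<delta> w = s \<otimes> \<delta> y \<oplus> t"
  using w
proof (induction d arbitrary: w)
  case 0
  then show ?case
    using subringE(1,2)[OF C] y by (auto simp: der_zero intro!: bexI[of _ \<zero>])
next
  case (Suc d)
  have y' [simp]: "y \<in> carrier R" using subringE(1)[OF C] y by blast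
  note Bc = coeff_carrier[OF B y'] and Cc = subsetD[OF subringE(1)[OF C]]
  from Suc.prems obtain b v where b: "b \<in> B" "v \<in> poly_below B y d" "w = b \<otimes> y [^] d \<oplus> v"
    by auto
  have [simp]: "b \<in> carrier R" "v \<in> carrier R" using b Bc poly_below_carrier[OF B y'] by auto
  obtain s t where st: "s \<in> poly_below B y (d - 1)" "t \<in> C" "\<delta> v = s \<otimes> \<delta> y \<oplus> t"
    using Suc.IH[OF b(2)] by blast
  have [simp]: "s \<in> carrier R" "t \<in> carrier R" using st Cc poly_below_carrier[OF B y'] by auto
  have pow: "y [^] k \<in> C" for k :: nat
    by (induction k) (use y subringE(3,6)[OF C] in auto)
  have t': "\<delta> b \<otimes> y [^] d \<oplus> t \<in> C"
    using subringE(6,7)[OF C] der_B[OF b(1)] pow st(2) by blast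
  have dw: "\<delta> w = (\<delta> b \<otimes> y [^] d \<oplus> b \<otimes> \<delta> (y [^] d)) \<oplus> (s \<otimes> \<delta> y \<oplus> t)"
    unfolding b(3) using st(3) by (simp add: der_add der_mult)
  show ?case
  proof (cases d)
    case 0
    have "\<delta> w = s \<otimes> \<delta> y \<oplus> (\<delta> b \<otimes> y [^] d \<oplus> t)"
      unfolding dw by (simp add: 0 der_one a_ac)
    moreover have "s \<in> poly_below B y (Suc d - 1)" using st(1) 0 by simp
    ultimately show ?thesis using t' by blast
  next
    case (Suc d')
    let ?s = "([d] \<cdot> \<one> \<otimes> b) \<otimes> y [^] d' \<oplus> s"
    have "[k] \<cdot> \<one> \<in> B" for k :: nat
      by (induction k) (use subringE(2,3,7)[OF B] in \<open>auto simp: add.nat_pow_Suc\<close>)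
    then have "?s \<in> poly_below B y d"
      using poly_below_SucI[OF B y' subringE(6)[OF B _ b(1)]] st(1) unfolding Suc diff_Suc_1
      by blast
    moreover have "b \<otimes> \<delta> (y [^] d) = (([d] \<cdot> \<one> \<otimes> b) \<otimes> y [^] d') \<otimes> \<delta> y"
    proof -
      have "b \<otimes> \<delta> (y [^] d) = b \<otimes> ([d] \<cdot> (\<one> \<otimes> (y [^] d' \<otimes> \<delta> y)))"
        unfolding Suc by (simp only: der_pow[OF y']) simp
      also have "\<dots> = b \<otimes> ([d] \<cdot> \<one> \<otimes> (y [^] d' \<otimes> \<delta> y))"
        by (subst add_pow_ldistr) simp_all
      finally show ?thesis by (simp add: m_ac)
    qed
    then have "\<delta> w = ?s \<otimes> \<delta> y \<oplus> (\<delta> b \<otimes> y [^] d \<oplus> t)"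
      unfolding dw by (simp add: l_distr a_ac)
    ultimately show ?thesis using t' unfolding diff_Suc_1 by blast
  qed
qed

text \<open>
  Differentiating a relation of least degree for \<open>y\<close> gives a relation of degree one for \<open>\<delta> y\<close>; its
  leading coefficient, the separant, lies outside \<open>P\<close> by minimality and characteristic zero.
\<close>

lemma algebraic_mod_der:
  assumes B: "subring B R" and C: "subring C R" and "B \<subseteq> C" and y: "y \<in> C"
    and der_B: "\<And>b. b \<in> B \<Longrightarrow> \<delta> b \<in> C"
    and P: "primeideal P R" and der_P: "\<And>a. a \<in> P \<Longrightarrow> \<delta> a \<in> P"
    and char: "\<And>k::nat. k > 0 \<Longrightarrow> [k] \<cdot> \<one> \<notin> P"
    and alg: "algebraic_mod P B y"
  shows "algebraic_mod P C (\<delta> y)"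
proof -
  interpret P: primeideal P R by (rule P)
  have y' [simp]: "y \<in> carrier R" using subringE(1)[OF C] y by blast
  define relation where "relation a \<longleftrightarrow> (\<exists>m\<in>B - P. \<exists>w\<in>poly_below B y a. m \<otimes> y [^] a \<oplus> w \<in> P)" for a :: nat
  define a where "a = (LEAST a. relation a)"
  have "relation a"
    using alg unfolding a_def algebraic_mod_def relation_def[symmetric] by (blast intro: LeastI)
  then obtain m w where m: "m \<in> B" "m \<notin> P" "w \<in> poly_below B y a" "m \<otimes> y [^] a \<oplus> w \<in> P"
    unfolding relation_def by blast
  have mc [simp]: "m \<in> carrier R" using coeff_carrier[OF B y'] m(1) .
  have "a \<noteq> 0"
  proof
    assume "a = 0"
    then show False using m by simp
  qed
  then obtain a' where a': "a = Suc a'" by (cases a) auto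
  obtain s t where st: "s \<in> poly_below B y a'" "t \<in> C" "\<delta> w = s \<otimes> \<delta> y \<oplus> t"
    using der_poly_below[OF B C \<open>B \<subseteq> C\<close> y der_B m(3)] a' by auto
  have [simp]: "s \<in> carrier R" "t \<in> carrier R" "w \<in> carrier R"
    using st(1,2) m(3) subringE(1)[OF C] poly_below_carrier[OF B y'] by auto
  define c where "c = [a] \<cdot> \<one> \<otimes> m"
  have "[k] \<cdot> \<one> \<in> B" for k :: nat
    by (induction k) (use subringE(2,3,7)[OF B] in \<open>auto simp: add.nat_pow_Suc\<close>)
  then have cB: "c \<in> B" unfolding c_def using subringE(6)[OF B _ m(1)] by blast
  have cP: "c \<notin> P"
    unfolding c_def using P.I_prime[of "[a] \<cdot> \<one>" m] char[of a] m(2) \<open>a \<noteq> 0\<close> by auto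
  have [simp]: "c \<in> carrier R" by (simp add: c_def)
  \<comment> \<open>The separant; membership in \<open>P\<close> would make it a relation of smaller degree.\<close>
  define \<sigma> where "\<sigma> = c \<otimes> y [^] a' \<oplus> s"
  have "\<sigma> \<notin> P"
  proof
    assume "\<sigma> \<in> P"
    then have "relation a'"
      unfolding relation_def \<sigma>_def using cB cP st(1) by blast
    then show False
      using not_less_Least[of a' relation] a' unfolding a_def by simp
  qed
  have pow: "y [^] k \<in> C" for k :: nat
    by (induction k) (use y subringE(3,6)[OF C] in auto)
  have pbC: "v \<in> poly_below B y d \<Longrightarrow> v \<in> C" for v d
  proof (induction d arbitrary: v)
    case 0
    then show ?case using subringE(2)[OF C] by simp
  next
    case (Suc d)
    then obtain b v' where "b \<in> B" "v' \<in> poly_below B y d" "v = b \<otimes> y [^] d \<oplus> v'"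
      by auto
    then show ?case
      using Suc.IH[of v'] subringE(7)[OF C subringE(6)[OF C _ pow[of d]]] \<open>B \<subseteq> C\<close> by blast
  qed
  have \<sigma>C: "\<sigma> \<in> C"
    unfolding \<sigma>_def using subringE(6,7)[OF C] pow pbC[OF st(1)] cB \<open>B \<subseteq> C\<close> by blast
  have [simp]: "\<sigma> \<in> carrier R" by (simp add: \<sigma>_def)
  define t' where "t' = \<delta> m \<otimes> y [^] a \<oplus> t"
  have t'C: "t' \<in> C"
    unfolding t'_def using subringE(6,7)[OF C] pow st(2) der_B[OF m(1)] by blast
  have "m \<otimes> \<delta> (y [^] a) = c \<otimes> y [^] a' \<otimes> \<delta> y"
  proof -
    have "m \<otimes> \<delta> (y [^] a) = m \<otimes> ([a] \<cdot> (\<one> \<otimes> (y [^] a' \<otimes> \<delta> y)))"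
      unfolding a' by (simp only: der_pow[OF y']) simp
    also have "\<dots> = m \<otimes> ([a] \<cdot> \<one> \<otimes> (y [^] a' \<otimes> \<delta> y))"
      by (subst add_pow_ldistr) simp_all
    finally show ?thesis by (simp add: c_def m_ac)
  qed
  then have "\<delta> (m \<otimes> y [^] a \<oplus> w) = \<sigma> \<otimes> \<delta> y [^] Suc 0 \<oplus> t'"
    using st(3) by (simp add: der_add der_mult \<sigma>_def t'_def l_distr a_ac)
  with der_P[OF m(4)] have "\<sigma> \<otimes> \<delta> y [^] Suc 0 \<oplus> t' \<in> P"
    by simp
  then show ?thesis
    unfolding algebraic_mod_def
    using \<sigma>C \<open>\<sigma> \<notin> P\<close> poly_below_const[OF C der_closed[OF y'] t'C] by blast
qed

end

section \<open>Polynomials in a set of variables\<close>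

text \<open>
  Used below to see that the product of two maximal monomials arises in only one way.
\<close>

lemma multiset_sum_extremal:
  fixes a b c d :: "nat multiset"
  assumes "a \<le> c" "b \<le> d" "a + b = c + d"
  shows "a = c"
proof (rule ccontr)
  assume "a \<noteq> c"
  with assms(1) have "a < c" by simp
  then have "a + b < c + d" using assms(2) by (rule add_less_le_mono)
  with assms(3) show False by simp
qed

context ordinary_diff_ring begin

lemma mpoly_set_mono: "T \<subseteq> T' \<Longrightarrow> F \<in> mpoly_set T \<Longrightarrow> F \<in> mpoly_set T'"
  by (rotate_tac, induction rule: indexed_pset.induct) (auto intro: indexed_pset.intros)

text \<open>
  Differentiation can enlarge the set of variables by one derivative.
\<close>

lemma mpoly_der_in:
  assumes "F \<in> mpoly_set T" "T \<subseteq> T'" "\<And>a b. (a, b) \<in> T \<Longrightarrow> (a, Suc b) \<in> T'"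
  shows "mpoly_der R F \<in> mpoly_set T'"
  using assms(1)
proof (induction rule: indexed_pset.induct)
  case (indexed_const k)
  then show ?case by (simp add: mpoly_der_const indexed_pset.indexed_const)
next
  case (indexed_padd Q Q')
  then show ?case
    by (simp add: mpoly_der_padd mpoly_set_carrier_coeff[of _ T] indexed_pset.indexed_padd)
next
  case (indexed_pmult Q v)
  obtain a b where v: "v = (a, b)" by (cases v)
  have "Q \<in> mpoly_set T'" by (rule mpoly_set_mono[OF assms(2) indexed_pmult(1)])
  then show ?case
    using indexed_pmult assms(2,3) unfolding v
    by (auto simp: mpoly_der_pmult mpoly_set_carrier_coeff[of Q T]
        intro!: indexed_pset.indexed_padd indexed_pset.indexed_pmult)
qed

lemma mpoly_set_finite_vars:
  assumes "F \<in> mpoly_set T"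
  obtains T0 where "finite T0" "T0 \<subseteq> T" "F \<in> mpoly_set T0"
proof -
  have "\<exists>T0. finite T0 \<and> T0 \<subseteq> T \<and> F \<in> mpoly_set T0"
    using assms
  proof (induction rule: indexed_pset.induct)
    case (indexed_const k)
    then show ?case by (intro exI[of _ "{}"]) (auto intro: indexed_pset.intros)
  next
    case (indexed_padd P Q)
    then obtain S S' where "finite S" "S \<subseteq> T" "P \<in> mpoly_set S" "finite S'" "S' \<subseteq> T" "Q \<in> mpoly_set S'"
      by blast
    then show ?case
      by (intro exI[of _ "S \<union> S'"]) (auto intro!: indexed_pset.intros intro: mpoly_set_mono)
  next
    case (indexed_pmult P i)
    then obtain S where "finite S" "S \<subseteq> T" "P \<in> mpoly_set S" by blast
    then show ?case using indexed_pmult(2)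
      by (intro exI[of _ "insert i S"]) (auto intro!: indexed_pset.intros intro: mpoly_set_mono)
  qed
  then show ?thesis using that by blast
qed

lemma mpoly_set_support:
  assumes "F \<in> mpoly_set T"
  shows "finite {m. F m \<noteq> \<zero>}" "F m \<noteq> \<zero> \<Longrightarrow> set_mset m \<subseteq> T"
proof -
  have "finite {m. F m \<noteq> \<zero>} \<and> (\<forall>m. F m \<noteq> \<zero> \<longrightarrow> set_mset m \<subseteq> T)"
    using assms
  proof (induction rule: indexed_pset.induct)
    case (indexed_const k)
    have "{m. indexed_const k m \<noteq> \<zero>} \<subseteq> {{#}}" by (auto simp: indexed_const_def)
    then show ?case by (auto intro: finite_subset simp: indexed_const_def)
  next
    case (indexed_padd P Q)
    have "{m. indexed_padd P Q m \<noteq> \<zero>} \<subseteq> {m. P m \<noteq> \<zero>} \<union> {m. Q m \<noteq> \<zero>}"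
      by (auto simp: indexed_padd_def)
    then show ?case
      using indexed_padd.IH by (blast intro: finite_subset[OF _ finite_UnI])
  next
    case (indexed_pmult P i)
    have sub: "{m. indexed_pmult P i m \<noteq> \<zero>} \<subseteq> add_mset i ` {m. P m \<noteq> \<zero>}"
    proof
      fix m assume "m \<in> {m. indexed_pmult P i m \<noteq> \<zero>}"
      then have "i \<in># m" "P (m - {#i#}) \<noteq> \<zero>"
        by (auto simp: indexed_pmult_def split: if_splits)
      then show "m \<in> add_mset i ` {m. P m \<noteq> \<zero>}"
        by (intro image_eqI[of _ _ "m - {#i#}"]) auto
    qed
    show ?case
    proof (intro conjI allI impI)
      show "finite {m. indexed_pmult P i m \<noteq> \<zero>}"
        by (rule finite_subset[OF sub]) (use indexed_pmult.IH in simp)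
      fix m assume "indexed_pmult P i m \<noteq> \<zero>"
      then obtain m' where "m = add_mset i m'" "P m' \<noteq> \<zero>" using sub by blast
      then show "set_mset m \<subseteq> T" using indexed_pmult by auto
    qed
  qed
  then show "finite {m. F m \<noteq> \<zero>}" "F m \<noteq> \<zero> \<Longrightarrow> set_mset m \<subseteq> T" by blast+
qed

lemma monomial_in_indexed_pset:
  "set_mset m \<subseteq> T \<Longrightarrow> k \<in> J \<Longrightarrow> (\<lambda>m'. if m' = m then k else \<zero>) \<in> indexed_pset T J"
proof (induction m)
  case empty
  then show ?case using indexed_pset.indexed_const[of k J T] by (simp add: indexed_const_def)
next
  case (add i m)
  have "(\<lambda>m'. if m' = add_mset i m then k else \<zero>) = indexed_pmult (\<lambda>m'. if m' = m then k else \<zero>) i"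
  proof
    fix m'
    show "(if m' = add_mset i m then k else \<zero>) = indexed_pmult (\<lambda>m'. if m' = m then k else \<zero>) i m'"
      by (cases "i \<in># m'") (auto simp: indexed_pmult_def dest!: multi_member_split)
  qed
  moreover have "indexed_pmult (\<lambda>m'. if m' = m then k else \<zero>) i \<in> indexed_pset T J"
    using add by (intro indexed_pset.indexed_pmult) auto
  ultimately show ?case by (simp only:)
qed

text \<open>
  A function with finite support is the sum of its terms.  The set \<open>J\<close> of coefficients is a parameter
  so that polynomials with coefficients in an ideal are covered.
\<close>

lemma indexed_pset_memI:
  assumes "finite {m. F m \<noteq> \<zero>}" "\<And>m. F m \<noteq> \<zero> \<Longrightarrow> set_mset m \<subseteq> T"
    and "\<And>m. F m \<in> J" "\<zero> \<in> J" "J \<subseteq> carrier R"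
  shows "F \<in> indexed_pset T J"
proof -
  have "(\<lambda>m. if m \<in> S then F m else \<zero>) \<in> indexed_pset T J" if "finite S" "S \<subseteq> {m. F m \<noteq> \<zero>}" for S
    using that
  proof (induction S rule: finite_induct)
    case empty
    then show ?case
      using indexed_pset.indexed_const[OF assms(4), of T] by (simp add: indexed_zero_def)
  next
    case (insert m S)
    have F [simp]: "F m \<in> carrier R" for m using assms(3,5) by blast
    have "(\<lambda>m'. if m' \<in> insert m S then F m' else \<zero>) =
        indexed_padd (\<lambda>m'. if m' = m then F m else \<zero>) (\<lambda>m'. if m' \<in> S then F m' else \<zero>)"
      using insert(2) by (auto simp: indexed_padd_def)
    moreover have "indexed_padd (\<lambda>m'. if m' = m then F m else \<zero>) (\<lambda>m'. if m' \<in> S then F m' else \<zero>) \<in> indexed_pset T J"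
      using insert assms(2,3) by (intro indexed_pset.indexed_padd monomial_in_indexed_pset) auto
    ultimately show ?case by (simp only:)
  qed
  from this[OF assms(1) subset_refl] show ?thesis
    by (rule back_subst[of "\<lambda>F. F \<in> indexed_pset T J"]) auto
qed

lemma indexed_pmult_eq_mult:
  assumes "carrier_coeff P"
  shows "indexed_pmult P v = mpoly_mult R P (indexed_var v)"
proof -
  have "carrier_coeff (indexed_const \<one> :: 'c multiset \<Rightarrow> 'a)"
    by (simp add: carrier_coeff_def indexed_const_def)
  then have "mpoly_mult R P (indexed_var v) = indexed_pmult (mpoly_mult R P (indexed_const \<one>)) v"
    unfolding indexed_var_def using assms by (rule mpoly_mult_pmult[rotated])
  also have "mpoly_mult R P (indexed_const \<one>) = P"
    using assms by (simp add: mpoly_mult_const carrier_coeff_def)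
  finally show ?thesis ..
qed

lemma indexed_var_in: "v \<in> T \<Longrightarrow> indexed_var v \<in> mpoly_set T"
  unfolding indexed_var_def by (intro indexed_pset.intros) auto

context
  fixes n :: nat
begin

private abbreviation "polys \<equiv> diff_poly_ring R n"
private abbreviation "all_vars \<equiv> {..<n} \<times> (UNIV :: nat set)"

interpretation A: ordinary_diff_ring polys
  by (rule ordinary_diff_ring_diff_poly_ring)

lemma diff_poly_ring_simps:
  "carrier polys = mpoly_set all_vars" "monoid.mult polys = mpoly_mult R" "\<one>\<^bsub>polys\<^esub> = indexed_const \<one>"
  "\<zero>\<^bsub>polys\<^esub> = indexed_const \<zero>" "ring.add polys = indexed_padd" "der polys = mpoly_der R"
  by (simp_all add: diff_poly_ring_def)

lemma in_carrier: "T \<subseteq> all_vars \<Longrightarrow> F \<in> mpoly_set T \<Longrightarrow> F \<in> carrier polys"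
  using mpoly_set_mono[of T all_vars F] by (simp add: diff_poly_ring_simps)

lemma indexed_var_in_carrier: "v \<in> all_vars \<Longrightarrow> indexed_var v \<in> carrier polys"
  unfolding diff_poly_ring_simps by (rule indexed_var_in)

lemma subring_mpoly_set:
  assumes "T \<subseteq> all_vars"
  shows "subring (mpoly_set T) polys"
proof (rule A.subringI)
  show "mpoly_set T \<subseteq> carrier polys" using in_carrier[OF assms] by blast
  show "\<one>\<^bsub>polys\<^esub> \<in> mpoly_set T" by (auto simp: diff_poly_ring_simps intro: indexed_pset.intros)
next
  fix F assume F: "F \<in> mpoly_set T"
  have neg: "(\<lambda>m. F m \<otimes> \<ominus> \<one>) \<in> mpoly_set T"
    using F by (rule mpoly_set_scale) simp
  have "F m \<in> carrier R" for m
    using mpoly_set_carrier_coeff[OF F] by (simp add: carrier_coeff_def)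
  then have "(\<lambda>m. F m \<otimes> \<ominus> \<one>) \<oplus>\<^bsub>polys\<^esub> F = \<zero>\<^bsub>polys\<^esub>"
    by (auto simp: diff_poly_ring_simps indexed_padd_def indexed_zero_def r_minus l_neg)
  then have "\<ominus>\<^bsub>polys\<^esub> F = (\<lambda>m. F m \<otimes> \<ominus> \<one>)"
    using in_carrier[OF assms F] in_carrier[OF assms neg] by (intro A.minus_equality)
  with neg show "\<ominus>\<^bsub>polys\<^esub> F \<in> mpoly_set T" by simp
next
  fix F G assume "F \<in> mpoly_set T" "G \<in> mpoly_set T"
  then show "F \<otimes>\<^bsub>polys\<^esub> G \<in> mpoly_set T" "F \<oplus>\<^bsub>polys\<^esub> G \<in> mpoly_set T"
    by (auto simp: diff_poly_ring_simps mpoly_set_mult intro: indexed_pset.intros)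
qed

lemma mpoly_set_insert_subset:
  assumes "insert y T \<subseteq> all_vars" "F \<in> mpoly_set (insert y T)"
  shows "\<exists>d. F \<in> A.poly_below (mpoly_set T) (indexed_var y) d"
proof -
  have T: "T \<subseteq> all_vars" and y: "indexed_var y \<in> carrier polys"
    using assms(1) indexed_var_in_carrier by blast+
  note B = subring_mpoly_set[OF T]
  show ?thesis
    using assms(2)
  proof (induction rule: indexed_pset.induct)
    case (indexed_const k)
    then show ?case
      using A.poly_below_const[OF B y indexed_pset.indexed_const] by blast
  next
    case (indexed_padd P Q)
    then obtain d e where "P \<in> A.poly_below (mpoly_set T) (indexed_var y) d"
      "Q \<in> A.poly_below (mpoly_set T) (indexed_var y) e" by blast
    then have "P \<in> A.poly_below (mpoly_set T) (indexed_var y) (max d e)"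
      "Q \<in> A.poly_below (mpoly_set T) (indexed_var y) (max d e)"
      by (auto intro: A.poly_below_mono[OF B y _, rotated])
    from A.poly_below_add[OF B y this] show ?case
      by (auto simp: diff_poly_ring_simps)
  next
    case (indexed_pmult P i)
    then obtain d where P: "P \<in> A.poly_below (mpoly_set T) (indexed_var y) d" by blast
    have Pc: "P \<in> carrier polys" by (rule A.poly_below_carrier[OF B y P])
    then have "indexed_pmult P i = P \<otimes>\<^bsub>polys\<^esub> indexed_var i"
      by (simp add: diff_poly_ring_simps indexed_pmult_eq_mult mpoly_set_carrier_coeff)
    also have "\<dots> = indexed_var i \<otimes>\<^bsub>polys\<^esub> P"
      by (rule A.m_comm[OF Pc indexed_var_in_carrier]) (use indexed_pmult(2) assms(1) in blast)
    finally have eq: "indexed_pmult P i = indexed_var i \<otimes>\<^bsub>polys\<^esub> P" .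
    show ?case
    proof (cases "i = y")
      case True
      then show ?thesis unfolding eq using A.poly_below_shift[OF B y P] by blast
    next
      case False
      then have "indexed_var i \<in> mpoly_set T" using indexed_pmult(2) by (auto intro: indexed_var_in)
      then show ?thesis unfolding eq using A.poly_below_smult[OF B y _ P] by blast
    qed
  qed
qed

lemma indexed_const_hom: "ring_hom_ring R polys indexed_const"
proof (rule ring_hom_ringI2)
  show "ring R" by (rule ring_axioms)
  show "ring polys" by (rule A.ring_axioms)
  show "indexed_const \<in> ring_hom R polys"
  proof (rule ring_hom_memI)
    fix x y assume x: "x \<in> carrier R" and y: "y \<in> carrier R"
    show "indexed_const x \<in> carrier polys"
      using x by (auto simp: diff_poly_ring_simps intro: indexed_pset.intros)
    have "carrier_coeff (indexed_const x :: diff_monomial \<Rightarrow> 'a)"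
      using x by (simp add: carrier_coeff_def indexed_const_def)
    then show "indexed_const (x \<otimes> y) = indexed_const x \<otimes>\<^bsub>polys\<^esub> indexed_const y"
      using y by (auto simp: diff_poly_ring_simps mpoly_mult_const) (auto simp: indexed_const_def)
    show "indexed_const (x \<oplus> y) = indexed_const x \<oplus>\<^bsub>polys\<^esub> indexed_const y"
      by (auto simp: diff_poly_ring_simps indexed_padd_def indexed_const_def)
  qed (simp add: diff_poly_ring_simps)
qed

section \<open>Contraction and independent variables\<close>

definition contraction :: "(diff_monomial \<Rightarrow> 'a) set \<Rightarrow> 'a set" where
  "contraction P = {r \<in> carrier R. indexed_const r \<in> P}"

lemma contraction_in_diff_Spec:
  assumes "P \<in> diff_Spec polys"
  shows "contraction P \<in> diff_Spec R"
proof -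
  interpret h: ring_hom_ring R polys indexed_const by (rule indexed_const_hom)
  have "primeideal P polys" and der: "\<And>F. F \<in> P \<Longrightarrow> mpoly_der R F \<in> P"
    using assms by (auto simp: diff_Spec_def diff_poly_ring_simps)
  then have "primeideal (contraction P) R"
    unfolding contraction_def by (intro h.primeideal_vimage is_cring)
  moreover have "\<delta> a \<in> contraction P" if "a \<in> contraction P" for a
    using that der[of "indexed_const a"] by (auto simp: contraction_def mpoly_der_const)
  ultimately show ?thesis by (auto simp: diff_Spec_def)
qed

lemma contraction_mono: "P \<subseteq> Q \<Longrightarrow> contraction P \<subseteq> contraction Q"
  by (auto simp: contraction_def)

lemma add_pow_one_notin:
  fixes k :: nat
  assumes "P \<in> diff_Spec polys" "standard_diff_ring R" "k > 0"
  shows "[k] \<cdot>\<^bsub>polys\<^esub> \<one>\<^bsub>polys\<^esub> \<notin> P"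
proof -
  have const: "[k] \<cdot>\<^bsub>polys\<^esub> \<one>\<^bsub>polys\<^esub> = indexed_const ([k] \<cdot> \<one>)"
  proof (induction k)
    case (Suc k)
    then show ?case
      by (simp add: A.add.nat_pow_Suc add.nat_pow_Suc)
        (auto simp: diff_poly_ring_simps indexed_padd_def indexed_const_def)
  qed (simp add: diff_poly_ring_simps)
  have p: "contraction P \<in> diff_Spec R"
    by (rule contraction_in_diff_Spec[OF assms(1)])
  then interpret p: primeideal "contraction P" R by (simp add: diff_Spec_def)
  have "characteristic_zero (residue_field R (contraction P))"
    using assms(2) p unfolding standard_diff_ring_def by blast
  from p.residue_characteristic_zero[OF this assms(3)] have "[k] \<cdot> \<one> \<notin> contraction P" .
  then show ?thesis unfolding const contraction_def by simp
qed

text \<open>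
  For \<open>T = I \<times> UNIV\<close> this says that the indeterminates with index in \<open>I\<close> are differentially
  independent over \<open>R\<close> modulo \<open>P\<close>.
\<close>

definition independent_mod :: "(diff_monomial \<Rightarrow> 'a) set \<Rightarrow> (nat \<times> nat) set \<Rightarrow> bool" where
  "independent_mod P T \<longleftrightarrow> (\<forall>F\<in>mpoly_set T \<inter> P. \<forall>m. F m \<in> contraction P)"

lemma independent_mod_antimono: "independent_mod P T' \<Longrightarrow> T \<subseteq> T' \<Longrightarrow> independent_mod P T"
  unfolding independent_mod_def using mpoly_set_mono by blast

lemma mem_if_coefficients_in_contraction:
  assumes P: "ideal P polys" and T: "T \<subseteq> all_vars"
    and F: "F \<in> mpoly_set T" "\<And>m. F m \<in> contraction P"
  shows "F \<in> P"
proof -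
  interpret P: ideal P polys by (rule P)
  have "\<zero> \<in> contraction P"
    using P.zero_closed by (simp add: contraction_def diff_poly_ring_simps)
  then have "F \<in> indexed_pset T (contraction P)"
    using F(2) mpoly_set_support[OF F(1)]
    by (intro indexed_pset_memI) (auto simp: contraction_def)
  then show ?thesis
  proof (induction rule: indexed_pset.induct)
    case (indexed_const k)
    then show ?case by (simp add: contraction_def)
  next
    case (indexed_padd F G)
    then show ?case using P.add_in[of F G] by (simp add: diff_poly_ring_simps)
  next
    case (indexed_pmult F i)
    have "indexed_var i \<in> carrier polys"
      using indexed_pmult(2) T indexed_var_in_carrier by blast
    then have "F \<otimes>\<^bsub>polys\<^esub> indexed_var i \<in> P"
      using indexed_pmult(3) by (intro P.I_r_closed)
    moreover have "carrier_coeff F"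
      using P.Icarr[OF indexed_pmult(3)] by (simp add: diff_poly_ring_simps mpoly_set_carrier_coeff)
    ultimately show ?case
      by (simp add: diff_poly_ring_simps indexed_pmult_eq_mult)
  qed
qed

text \<open>
  For independent variables the trace of \<open>Q\<close> consists of the polynomials with coefficients in the
  contraction.
\<close>

lemma agree_if_independent_mod:
  assumes "ideal P polys" "T \<subseteq> all_vars" "independent_mod Q T" "contraction Q \<subseteq> contraction P"
  shows "mpoly_set T \<inter> Q \<subseteq> P"
  using mem_if_coefficients_in_contraction[OF assms(1,2)] assms(3,4)
  unfolding independent_mod_def by blast

lemma independent_mod_empty:
  assumes "primeideal P polys"
  shows "independent_mod P {}"
  unfolding independent_mod_def
proof (intro ballI allI)
  interpret P: primeideal P polys by (rule assms)
  fix F m assume F: "F \<in> mpoly_set {} \<inter> P"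
  have c: "F m \<in> carrier R" for m
    using F mpoly_set_carrier_coeff[of F] by (auto simp: carrier_coeff_def)
  have "F m = indexed_const (F {#}) m" for m
    using F mpoly_set_support(2)[of F "{}" m] by (auto simp: indexed_const_def)
  then have "F = indexed_const (F {#})" ..
  then have "indexed_const (F {#}) \<in> P" using F by simp
  moreover have "F m = \<zero>" if "m \<noteq> {#}" using F mpoly_set_support(2)[of F "{}" m] that by auto
  ultimately show "F m \<in> contraction P"
    using P.zero_closed c by (cases "m = {#}") (auto simp: contraction_def diff_poly_ring_simps)
qed

text \<open>
  Adjoining a transcendental variable keeps independence, because a relation in \<open>P\<close> has its
  coefficients with respect to \<open>y\<close> in \<open>P\<close>.
\<close>

lemma independent_mod_insert:
  assumes P: "primeideal P polys" and T: "insert y T \<subseteq> all_vars" and ind: "independent_mod P T"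
    and nalg: "\<not> A.algebraic_mod P (mpoly_set T) (indexed_var y)"
  shows "independent_mod P (insert y T)"
  unfolding independent_mod_def
proof
  interpret P: primeideal P polys by (rule P)
  interpret h: ring_hom_ring R polys indexed_const by (rule indexed_const_hom)
  interpret p: primeideal "contraction P" R
    unfolding contraction_def by (rule h.primeideal_vimage[OF is_cring P])
  have T': "T \<subseteq> all_vars" and y: "indexed_var y \<in> carrier polys"
    using T indexed_var_in_carrier by blast+
  note B = subring_mpoly_set[OF T']
  have monomial: "\<forall>m. (b \<otimes>\<^bsub>polys\<^esub> indexed_var y [^]\<^bsub>polys\<^esub> d) m \<in> contraction P"
    if b: "b \<in> carrier polys" "\<forall>m. b m \<in> contraction P" for b and d :: nat
  proof (induction d)
    case 0
    then show ?case using b by simp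
  next
    case (Suc d)
    let ?b = "b \<otimes>\<^bsub>polys\<^esub> indexed_var y [^]\<^bsub>polys\<^esub> d"
    have bc: "?b \<in> carrier polys" using b(1) y by simp
    have "b \<otimes>\<^bsub>polys\<^esub> indexed_var y [^]\<^bsub>polys\<^esub> Suc d = ?b \<otimes>\<^bsub>polys\<^esub> indexed_var y"
      using b(1) y by (simp add: A.m_assoc)
    also have "\<dots> = indexed_pmult ?b y"
      using bc by (simp add: diff_poly_ring_simps(1,2) indexed_pmult_eq_mult mpoly_set_carrier_coeff)
    finally show ?case
      using Suc p.zero_closed by (simp add: indexed_pmult_def)
  qed
  have below: "\<forall>m. F m \<in> contraction P"
    if "F \<in> A.poly_below (mpoly_set T) (indexed_var y) d" "F \<in> P" for F d
    using that
  proof (induction d arbitrary: F)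
    case 0
    then show ?case using p.zero_closed by (simp add: diff_poly_ring_simps indexed_const_def)
  next
    case (Suc d)
    from Suc.prems(1) obtain b w where b: "b \<in> mpoly_set T"
      "w \<in> A.poly_below (mpoly_set T) (indexed_var y) d"
      "F = b \<otimes>\<^bsub>polys\<^esub> indexed_var y [^]\<^bsub>polys\<^esub> d \<oplus>\<^bsub>polys\<^esub> w"
      by auto
    have in_P: "b \<in> P" "w \<in> P"
      using A.coefficient_in_if_not_algebraic[OF B y P nalg b(1,2)] Suc.prems(2) b(3) by auto
    then have "\<forall>m. b m \<in> contraction P"
      using ind b(1) unfolding independent_mod_def by blast
    then have "\<forall>m. (b \<otimes>\<^bsub>polys\<^esub> indexed_var y [^]\<^bsub>polys\<^esub> d) m \<in> contraction P"
      using monomial in_carrier[OF T' b(1)] by blast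
    moreover have "\<forall>m. w m \<in> contraction P" using Suc.IH b(2) in_P(2) by blast
    ultimately show ?case
      unfolding b(3) using p.add_in by (simp add: diff_poly_ring_simps(5) indexed_padd_def)
  qed
  fix F assume F: "F \<in> mpoly_set (insert y T) \<inter> P"
  then obtain d where "F \<in> A.poly_below (mpoly_set T) (indexed_var y) d"
    using mpoly_set_insert_subset[OF T] by blast
  then show "\<forall>m. F m \<in> contraction P"
    using below F by blast
qed

lemma diff_Spec_primeideal: "P \<in> diff_Spec polys \<Longrightarrow> primeideal P polys"
  by (simp add: diff_Spec_def)

text \<open>
  The only place where divisibility in \<open>R\<close> matters: a relation modulo \<open>P\<close>, divided by a
  coefficient that divides all the others, is a nontrivial relation modulo the larger prime \<open>Q\<close>.
\<close>

lemma independent_mod_subset: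
  assumes arith: "Delta_arithmetical R" and P: "P \<in> diff_Spec polys" and Q: "Q \<in> diff_Spec polys"
    and "P \<subseteq> Q" and T: "T \<subseteq> all_vars" and ind: "independent_mod Q T"
  shows "independent_mod P T"
proof (rule ccontr)
  let ?q = "contraction Q"
  have q: "?q \<in> diff_Spec R" by (rule contraction_in_diff_Spec[OF Q])
  interpret q: primeideal ?q R using q by (simp add: diff_Spec_def)
  interpret p: primeideal "contraction P" R
    using contraction_in_diff_Spec[OF P] by (simp add: diff_Spec_def)
  interpret P: primeideal P polys by (rule diff_Spec_primeideal[OF P])
  assume "\<not> independent_mod P T"
  then obtain F m0 where F: "F \<in> mpoly_set T" "F \<in> P" and m0: "F m0 \<notin> contraction P"
    unfolding independent_mod_def by blast
  define C where "C = {m. F m \<noteq> \<zero>}"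
  have Fc: "F m \<in> carrier R" for m
    using mpoly_set_carrier_coeff[OF F(1)] by (simp add: carrier_coeff_def)
  have "F m0 \<noteq> \<zero>" using m0 p.zero_closed by metis
  then have "m0 \<in> C" by (simp add: C_def)
  have "principalideal (extended_ideal R ?q (Idl {a, b})) (localization R ?q)"
    if "a \<in> carrier R" "b \<in> carrier R" for a b
    using arith q that unfolding Delta_arithmetical_def by simp
  then have "\<exists>s\<in>carrier R - ?q. \<exists>c\<in>carrier R. s \<otimes> a = c \<otimes> b \<or> s \<otimes> b = c \<otimes> a"
    if "a \<in> carrier R" "b \<in> carrier R" for a b
    using q.principal_extension_comparable that by blast
  then obtain m1 s where m1: "m1 \<in> C" "s \<in> carrier R - ?q"
    and "\<forall>m\<in>C. \<exists>e\<in>carrier R. s \<otimes> F m = e \<otimes> F m1"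
    using q.exists_least_divisible[of C F] mpoly_set_support(1)[OF F(1)] \<open>m0 \<in> C\<close> Fc
    unfolding C_def by blast
  then obtain e where e: "\<And>m. m \<in> C \<Longrightarrow> e m \<in> carrier R \<and> s \<otimes> F m = e m \<otimes> F m1"
    by metis
  have sR: "s \<in> carrier R" and "s \<notin> ?q" using m1(2) by auto
  \<comment> \<open>Up to the factor \<open>s\<close>, \<open>E\<close> is \<open>F\<close> divided by \<open>F m1\<close>; its coefficient \<open>s\<close> at \<open>m1\<close> lies outside the contraction of \<open>Q\<close>.\<close>
  define E where "E m = (if m = m1 then s else if m \<in> C then e m else \<zero>)" for m
  have Ec: "E m \<in> carrier R" for m
    using e sR by (simp add: E_def)
  have eq: "F m \<otimes> s = E m \<otimes> F m1" for m
  proof (cases "m \<in> C")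
    case True
    then show ?thesis using e[OF True] sR Fc by (auto simp: E_def m_comm)
  next
    case False
    then have "F m = \<zero>" "m \<noteq> m1" using m1(1) by (auto simp: C_def)
    then show ?thesis using False sR Fc by (simp add: E_def)
  qed
  have E: "E \<in> mpoly_set T"
  proof (rule indexed_pset_memI)
    have "{m. E m \<noteq> \<zero>} \<subseteq> C" using m1(1) by (auto simp: E_def)
    then show "finite {m. E m \<noteq> \<zero>}" "\<And>m. E m \<noteq> \<zero> \<Longrightarrow> set_mset m \<subseteq> T"
      using mpoly_set_support[OF F(1)] unfolding C_def by (blast intro: finite_subset)+
  qed (use Ec in auto)
  have EA: "E \<in> carrier polys" and FA: "F \<in> carrier polys" using in_carrier[OF T] E F(1) by auto
  have const: "indexed_const r \<in> carrier polys" if "r \<in> carrier R" for r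
    using that by (auto simp: diff_poly_ring_simps intro: indexed_pset.intros)
  have "E \<otimes>\<^bsub>polys\<^esub> indexed_const (F m1) = F \<otimes>\<^bsub>polys\<^esub> indexed_const s"
    using EA FA eq sR Fc by (simp add: diff_poly_ring_simps mpoly_mult_const mpoly_set_carrier_coeff)
  also have "\<dots> \<in> P"
    by (rule P.I_r_closed[OF F(2) const[OF sR]])
  finally have "E \<in> P \<or> indexed_const (F m1) \<in> P"
    using P.I_prime EA const[OF Fc] by blast
  moreover have "indexed_const (F m1) \<notin> P"
  proof
    assume "indexed_const (F m1) \<in> P"
    then have "F m1 \<in> contraction P" unfolding contraction_def using Fc by blast
    then have "F m0 \<otimes> s \<in> contraction P" unfolding eq using Ec by (intro p.I_l_closed)
    then have "s \<in> contraction P" using p.I_prime[OF Fc sR] m0 by blast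
    then show False using contraction_mono[OF \<open>P \<subseteq> Q\<close>] \<open>s \<notin> ?q\<close> by blast
  qed
  ultimately have "E \<in> mpoly_set T \<inter> Q" using \<open>P \<subseteq> Q\<close> E by blast
  then have "E m1 \<in> ?q" using ind unfolding independent_mod_def by blast
  then show False using \<open>s \<notin> ?q\<close> by (simp add: E_def)
qed

section \<open>Stabilization of chains in a fibre\<close>

lemma agree_insert_algebraic:
  assumes "primeideal P polys" "primeideal Q polys" "P \<subseteq> Q" "insert y T \<subseteq> all_vars"
    and "mpoly_set T \<inter> Q \<subseteq> P" "A.algebraic_mod P (mpoly_set T) (indexed_var y)"
  shows "mpoly_set (insert y T) \<inter> Q \<subseteq> P"
proof -
  have T: "T \<subseteq> all_vars" and y: "indexed_var y \<in> carrier polys"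
    using assms(4) indexed_var_in_carrier by blast+
  show ?thesis
    using mpoly_set_insert_subset[OF assms(4)]
      A.agree_on_adjunction_if_algebraic[OF subring_mpoly_set[OF T] y assms(1,2,3,5,6)] by blast
qed

lemma agree_union_algebraic:
  assumes "primeideal P polys" "primeideal Q polys" "P \<subseteq> Q" "finite S" "S \<union> T \<subseteq> all_vars"
    and "mpoly_set T \<inter> Q \<subseteq> P" "\<And>y. y \<in> S \<Longrightarrow> A.algebraic_mod P (mpoly_set T) (indexed_var y)"
  shows "mpoly_set (S \<union> T) \<inter> Q \<subseteq> P"
  using assms(4,5,7)
proof (induction S rule: finite_induct)
  case empty
  then show ?case using assms(6) by simp
next
  case (insert y S)
  have "A.algebraic_mod P (mpoly_set (S \<union> T)) (indexed_var y)"
    by (rule A.algebraic_mod_mono[OF insert.prems(2)]) (auto intro: mpoly_set_mono)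
  then show ?case
    using agree_insert_algebraic[OF assms(1-3), of y "S \<union> T"] insert by auto
qed

lemma agree_insert_not_algebraic:
  assumes "primeideal P polys" "primeideal Q polys" "insert y T \<subseteq> all_vars"
    and "mpoly_set T \<inter> Q \<subseteq> P" "\<not> A.algebraic_mod Q (mpoly_set T) (indexed_var y)"
  shows "mpoly_set (insert y T) \<inter> Q \<subseteq> P"
proof -
  have T: "T \<subseteq> all_vars" and y: "indexed_var y \<in> carrier polys"
    using assms(3) indexed_var_in_carrier by blast+
  show ?thesis
    using mpoly_set_insert_subset[OF assms(3)]
      A.agree_on_adjunction_if_not_algebraic[OF subring_mpoly_set[OF T] y assms(1,2,4,5)] by blast
qed

text \<open>
  Adjoin one variable.  If it is algebraic modulo all late members of the chain, then incomparability
  applies.  If it is transcendental modulo one member, that member's trace is determined by coefficients in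
  the smaller subring, where the chain is already stationary.
\<close>

lemma chain_stabilizes_finite_extension:
  fixes c :: "nat \<Rightarrow> (diff_monomial \<Rightarrow> 'a) set"
  assumes prime: "\<And>i. primeideal (c i) polys" and anti: "\<And>i j. i \<le> j \<Longrightarrow> c j \<subseteq> c i"
    and "finite S" "S \<union> T \<subseteq> all_vars"
    and "\<exists>N. \<forall>i\<ge>N. mpoly_set T \<inter> c N \<subseteq> c i"
  shows "\<exists>N. \<forall>i\<ge>N. mpoly_set (S \<union> T) \<inter> c N \<subseteq> c i"
  using assms(3,4)
proof (induction S rule: finite_induct)
  case empty
  then show ?case using assms(5) by simp
next
  case (insert y S)
  then obtain N where N: "\<And>i. i \<ge> N \<Longrightarrow> mpoly_set (S \<union> T) \<inter> c N \<subseteq> c i" by auto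
  have vars: "insert y (S \<union> T) \<subseteq> all_vars" using insert.prems by simp
  show ?case
  proof (cases "\<forall>i\<ge>N. A.algebraic_mod (c i) (mpoly_set (S \<union> T)) (indexed_var y)")
    case True
    then have "mpoly_set (insert y (S \<union> T)) \<inter> c N \<subseteq> c i" if "i \<ge> N" for i
      using agree_insert_algebraic[OF prime prime anti[OF that] vars N[OF that]] that by blast
    then show ?thesis by auto
  next
    case False
    then obtain M where M: "M \<ge> N" "\<not> A.algebraic_mod (c M) (mpoly_set (S \<union> T)) (indexed_var y)"
      by blast
    have "mpoly_set (insert y (S \<union> T)) \<inter> c M \<subseteq> c i" if "i \<ge> M" for i
    proof -
      have "mpoly_set (S \<union> T) \<inter> c M \<subseteq> c i"
        using N[OF le_trans[OF M(1) that]] anti[OF M(1)] by blast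
      then show ?thesis by (rule agree_insert_not_algebraic[OF prime prime vars _ M(2)])
    qed
    then show ?thesis by auto
  qed
qed

section \<open>The differential rank of a prime\<close>

text \<open>
  The empty set is independent, so this is the maximum of a nonempty finite set.
\<close>

definition diff_rank :: "(diff_monomial \<Rightarrow> 'a) set \<Rightarrow> nat" where
  "diff_rank P = Max {card I |I. I \<subseteq> {..<n} \<and> independent_mod P (I \<times> UNIV)}"

lemma finite_ranks: "finite {card I |I. I \<subseteq> {..<n} \<and> independent_mod P (I \<times> UNIV)}"
  by (rule finite_subset[of _ "card ` Pow {..<n}"]) auto

lemma card_le_diff_rank:
  "I \<subseteq> {..<n} \<Longrightarrow> independent_mod P (I \<times> UNIV) \<Longrightarrow> card I \<le> diff_rank P"
  unfolding diff_rank_def using finite_ranks by (intro Max_ge) blast+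

lemma diff_rank_attained:
  assumes "primeideal P polys"
  obtains I where "I \<subseteq> {..<n}" "independent_mod P (I \<times> UNIV)" "card I = diff_rank P"
proof -
  have "{card I |I. I \<subseteq> {..<n} \<and> independent_mod P (I \<times> UNIV)} \<noteq> {}"
    using independent_mod_empty[OF assms] by (auto intro!: exI[of _ "{}"])
  from Max_in[OF finite_ranks this] that show ?thesis
    unfolding diff_rank_def[symmetric] by auto
qed

lemma diff_rank_le: "primeideal P polys \<Longrightarrow> diff_rank P \<le> n"
  using diff_rank_attained[of P] card_mono[of "{..<n}"] by (metis card_lessThan finite_lessThan)

lemma diff_rank_antimono:
  assumes "Delta_arithmetical R" "P \<in> diff_Spec polys" "Q \<in> diff_Spec polys" "P \<subseteq> Q"
  shows "diff_rank Q \<le> diff_rank P"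
proof -
  obtain I where I: "I \<subseteq> {..<n}" "independent_mod Q (I \<times> UNIV)" "card I = diff_rank Q"
    using diff_rank_attained diff_Spec_primeideal[OF assms(3)] by blast
  have "independent_mod P (I \<times> UNIV)"
    using independent_mod_subset[OF assms _ I(2)] I(1) by blast
  then show ?thesis using card_le_diff_rank[OF I(1)] I(3) by metis
qed

text \<open>
  Some derivative of order below \<open>N\<close> is algebraic over the preceding ones, as otherwise all of them
  together would be independent.  Algebraicity then passes to each next derivative.
\<close>

lemma derivatives_eventually_algebraic:
  assumes std: "standard_diff_ring R" and P: "P \<in> diff_Spec polys"
    and I: "I \<subseteq> {..<n}" "k < n" and ind: "independent_mod P (I \<times> UNIV)"
    and dep: "\<not> independent_mod P (I \<times> UNIV \<union> {k} \<times> {..<N})" and "j \<ge> N"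
  shows "A.algebraic_mod P (mpoly_set (I \<times> UNIV \<union> {k} \<times> {..<j})) (indexed_var (k, j))"
proof -
  let ?T = "\<lambda>j. I \<times> UNIV \<union> {k} \<times> {..<j}"
  let ?alg = "\<lambda>j. A.algebraic_mod P (mpoly_set (?T j)) (indexed_var (k, j))"
  have prime: "primeideal P polys" by (rule diff_Spec_primeideal[OF P])
  have T: "?T j \<subseteq> all_vars" for j using I by auto
  have T_Suc: "?T (Suc j) = insert (k, j) (?T j)" for j by auto
  have "independent_mod P (?T M)" if "\<forall>j<M. \<not> ?alg j" for M
    using that
  proof (induction M)
    case 0
    then show ?case using ind by simp
  next
    case (Suc M)
    have "insert (k, M) (?T M) \<subseteq> all_vars" using T[of "Suc M"] T_Suc by simp
    then show ?case
      unfolding T_Suc using Suc by (intro independent_mod_insert[OF prime]) auto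
  qed
  with dep obtain j0 where j0: "j0 < N" "?alg j0" by blast
  have "?alg (j0 + d)" for d
  proof (induction d)
    case (Suc d)
    let ?j = "j0 + d"
    have "A.algebraic_mod P (mpoly_set (?T (Suc ?j))) (\<delta>\<^bsub>polys\<^esub> (indexed_var (k, ?j)))"
    proof (rule A.algebraic_mod_der[OF subring_mpoly_set[OF T] subring_mpoly_set[OF T] _ _ _ prime _ _ Suc])
      show "mpoly_set (?T ?j) \<subseteq> mpoly_set (?T (Suc ?j))"
        using mpoly_set_mono[of "?T ?j" "?T (Suc ?j)"] T_Suc[of ?j] by blast
      show "indexed_var (k, ?j) \<in> mpoly_set (?T (Suc ?j))"
        by (rule indexed_var_in) simp
      show "\<delta>\<^bsub>polys\<^esub> b \<in> mpoly_set (?T (Suc ?j))" if "b \<in> mpoly_set (?T ?j)" for b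
        unfolding diff_poly_ring_simps by (rule mpoly_der_in[OF that]) auto
      show "\<delta>\<^bsub>polys\<^esub> a \<in> P" if "a \<in> P" for a
        using P that by (simp add: diff_Spec_def)
      show "[l] \<cdot>\<^bsub>polys\<^esub> \<one>\<^bsub>polys\<^esub> \<notin> P" if "l > 0" for l :: nat
        by (rule add_pow_one_notin[OF P std that])
    qed
    then show ?case
      by (simp add: diff_poly_ring_simps mpoly_der_var)
  qed (use j0 in simp)
  from this[of "j - j0"] show ?thesis using j0(1) \<open>j \<ge> N\<close> by simp
qed

text \<open>
  A maximal independent set \<open>I\<close> for \<open>P\<close> would remain maximal for \<open>P'\<close>.  All members of the chain
  then contain relations of a common order bound \<open>N\<close> for the remaining indeterminates, and the
  chain is determined by its traces on finitely many variables over those with index in \<open>I\<close>.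
\<close>

lemma diff_rank_jump:
  assumes arith: "Delta_arithmetical R" and std: "standard_diff_ring R"
    and P': "P' \<in> diff_Spec polys" and c: "descending_chain (diff_Spec polys) P P' c"
    and fibre: "\<And>i. contraction (c i) = contraction P"
  shows "diff_rank P < diff_rank P'"
proof (rule ccontr)
  assume le: "\<not> ?thesis"
  have cS: "c i \<in> diff_Spec polys" "P' \<subseteq> c i" "c (Suc i) \<subset> c i" and c0: "c 0 = P" for i
    using c unfolding descending_chain_def by blast+
  note prime = diff_Spec_primeideal[OF cS(1)]
  have anti: "c j \<subseteq> c i" if "i \<le> j" for i j
    using lift_Suc_antimono_le[of c, OF _ that] cS(3) by blast
  obtain I where I: "I \<subseteq> {..<n}" "independent_mod P (I \<times> UNIV)" "card I = diff_rank P"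
    using diff_rank_attained prime[of 0] c0 by metis
  have IV: "I \<times> UNIV \<subseteq> all_vars" using I(1) by auto
  have ind: "independent_mod (c i) (I \<times> UNIV)" for i
    using independent_mod_subset[OF arith cS(1) cS(1) anti[of 0 i] IV] I(2) c0 by simp
  have "\<exists>N. \<not> independent_mod P' (I \<times> UNIV \<union> {k} \<times> {..<N})" if k: "k < n" "k \<notin> I" for k
  proof -
    have "card (insert k I) = Suc (diff_rank P)"
      using I k finite_subset[OF I(1)] by simp
    then have "\<not> independent_mod P' (insert k I \<times> UNIV)"
      using card_le_diff_rank[of "insert k I" P'] le I(1) k(1) by auto
    then obtain F m where F: "F \<in> mpoly_set (insert k I \<times> UNIV)" "F \<in> P'" "F m \<notin> contraction P'"
      unfolding independent_mod_def by blast
    obtain T0 where T0: "finite T0" "T0 \<subseteq> insert k I \<times> UNIV" "F \<in> mpoly_set T0"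
      using mpoly_set_finite_vars[OF F(1)] by blast
    have "snd v < Suc (Max (snd ` T0))" if "v \<in> T0" for v
      using Max_ge[of "snd ` T0" "snd v"] T0(1) that by (simp add: less_Suc_eq_le)
    then have "T0 \<subseteq> I \<times> UNIV \<union> {k} \<times> {..<Suc (Max (snd ` T0))}"
      using T0(2) by fastforce
    then have "F \<in> mpoly_set (I \<times> UNIV \<union> {k} \<times> {..<Suc (Max (snd ` T0))})"
      using T0(3) by (rule mpoly_set_mono)
    then show ?thesis using F(2,3) unfolding independent_mod_def by blast
  qed
  then obtain N' where N': "\<And>k. k < n \<Longrightarrow> k \<notin> I \<Longrightarrow> \<not> independent_mod P' (I \<times> UNIV \<union> {k} \<times> {..<N' k})"
    by metis
  (* a common order bound; the inserted 0 covers n = 0 *)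
  define N where "N = Max (insert 0 (N' ` {..<n}))"
  have dep: "\<not> independent_mod (c i) (I \<times> UNIV \<union> {k} \<times> {..<N})" if k: "k < n" "k \<notin> I" for k i
  proof
    assume "independent_mod (c i) (I \<times> UNIV \<union> {k} \<times> {..<N})"
    moreover have "I \<times> UNIV \<union> {k} \<times> {..<N} \<subseteq> all_vars"
      using IV k(1) by auto
    ultimately have "independent_mod P' (I \<times> UNIV \<union> {k} \<times> {..<N})"
      using independent_mod_subset[OF arith P' cS(1) cS(2)] by blast
    moreover have "N' k \<le> N" unfolding N_def using k(1) by (intro Max_ge) auto
    then have "I \<times> UNIV \<union> {k} \<times> {..<N' k} \<subseteq> I \<times> UNIV \<union> {k} \<times> {..<N}" by auto
    ultimately show False using N'[OF k] independent_mod_antimono by blast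
  qed
  let ?T = "\<lambda>M. {..<n} \<times> {..<M} \<union> I \<times> (UNIV :: nat set)"
  have TV: "?T M \<subseteq> all_vars" for M using I(1) by auto
  have "\<forall>i\<ge>0. mpoly_set (I \<times> UNIV) \<inter> c 0 \<subseteq> c i"
    using agree_if_independent_mod[OF primeideal.axioms(1)[OF prime] IV ind] fibre by blast
  then obtain i0 where i0: "\<And>i. i \<ge> i0 \<Longrightarrow> mpoly_set (?T N) \<inter> c i0 \<subseteq> c i"
    using chain_stabilizes_finite_extension[of c, OF prime anti _ TV] by blast
  have agree: "mpoly_set (?T (N + M)) \<inter> c i0 \<subseteq> c (Suc i0)" for M
  proof (induction M)
    case 0
    then show ?case using i0[of "Suc i0"] by simp
  next
    case (Suc M)
    let ?S = "({..<n} - I) \<times> {N + M}"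
    have "A.algebraic_mod (c (Suc i0)) (mpoly_set (?T (N + M))) (indexed_var y)" if y: "y \<in> ?S" for y
    proof -
      obtain k where k: "y = (k, N + M)" "k < n" "k \<notin> I" using y by auto
      have "A.algebraic_mod (c (Suc i0)) (mpoly_set (I \<times> UNIV \<union> {k} \<times> {..<N + M})) (indexed_var y)"
        unfolding k(1)
        by (rule derivatives_eventually_algebraic[OF std cS(1) I(1) k(2) ind dep[OF k(2,3)]]) simp
      moreover have "mpoly_set (I \<times> UNIV \<union> {k} \<times> {..<N + M}) \<subseteq> mpoly_set (?T (N + M))"
        using mpoly_set_mono[of "I \<times> UNIV \<union> {k} \<times> {..<N + M}" "?T (N + M)"] k(2) by blast
      ultimately show ?thesis by (rule A.algebraic_mod_mono)
    qed
    moreover have "?S \<union> ?T (N + M) = ?T (N + Suc M)" by (auto simp: less_Suc_eq)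
    moreover have "finite ?S" by simp
    ultimately show ?case
      using agree_union_algebraic[OF prime prime psubset_imp_subset[OF cS(3)], of ?S "?T (N + M)" i0]
        Suc.IH TV[of "N + Suc M"] by metis
  qed
  have "c i0 \<subseteq> c (Suc i0)"
  proof
    fix F assume F: "F \<in> c i0"
    then have "F \<in> mpoly_set all_vars"
      using ideal.Icarr[OF primeideal.axioms(1)[OF prime]] by (simp add: diff_poly_ring_simps)
    then obtain T0 where T0: "finite T0" "T0 \<subseteq> all_vars" "F \<in> mpoly_set T0"
      by (rule mpoly_set_finite_vars)
    have "snd v < N + Suc (Max (snd ` T0))" if "v \<in> T0" for v
      using Max_ge[of "snd ` T0" "snd v"] T0(1) that by (simp add: less_Suc_eq_le trans_le_add2)
    then have "T0 \<subseteq> ?T (N + Suc (Max (snd ` T0)))"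
      using T0(2) by fastforce
    then have "F \<in> mpoly_set (?T (N + Suc (Max (snd ` T0))))"
      using T0(3) by (rule mpoly_set_mono)
    then show "F \<in> c (Suc i0)" using agree F by blast
  qed
  then show False using cS(3) by blast
qed

section \<open>Extension of primes\<close>

text \<open>
  The kernel of the map to the polynomials over the quotient of \<open>R\<close> by \<open>p\<close> that sends the variables in \<open>T\<close> to zero.
\<close>

definition extension :: "'a set \<Rightarrow> (nat \<times> nat) set \<Rightarrow> (diff_monomial \<Rightarrow> 'a) set" where
  "extension p T = {F \<in> carrier polys. \<forall>m. set_mset m \<inter> T = {} \<longrightarrow> F m \<in> p}"

lemma coefficient_closed: "F \<in> carrier polys \<Longrightarrow> F m \<in> carrier R"
  using mpoly_set_carrier_coeff[of F] by (simp add: diff_poly_ring_simps carrier_coeff_def)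

lemma a_inv_coeff: "F \<in> carrier polys \<Longrightarrow> (\<ominus>\<^bsub>polys\<^esub> F) m = \<ominus> F m"
proof -
  assume F: "F \<in> carrier polys"
  have "\<ominus>\<^bsub>polys\<^esub> F \<oplus>\<^bsub>polys\<^esub> F = \<zero>\<^bsub>polys\<^esub>" using F by (rule A.l_neg)
  then have "(\<ominus>\<^bsub>polys\<^esub> F) m \<oplus> F m = \<zero>"
    by (simp add: diff_poly_ring_simps indexed_padd_def indexed_zero_def fun_eq_iff)
  then have "\<ominus> F m = (\<ominus>\<^bsub>polys\<^esub> F) m"
    using F coefficient_closed A.a_inv_closed[OF F] by (intro minus_equality) auto
  then show ?thesis by simp
qed

lemma ideal_extension:
  assumes p: "ideal p R"
  shows "ideal (extension p T) polys"
proof -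
  interpret p: ideal p R by (rule p)
  show ?thesis
  proof (rule idealI)
    show "ring polys" by (rule A.ring_axioms)
    show "subgroup (extension p T) (add_monoid polys)"
    proof (rule A.add.subgroupI)
      show "extension p T \<subseteq> carrier polys" by (auto simp: extension_def)
      have "\<zero>\<^bsub>polys\<^esub> m \<in> p" for m
        using p.zero_closed by (simp add: diff_poly_ring_simps indexed_zero_def)
      then have "\<zero>\<^bsub>polys\<^esub> \<in> extension p T" unfolding extension_def using A.zero_closed by blast
      then show "extension p T \<noteq> {}" by blast
    next
      fix F assume F: "F \<in> extension p T"
      then have "F \<in> carrier polys" by (simp add: extension_def)
      then show "\<ominus>\<^bsub>polys\<^esub> F \<in> extension p T"
        using F A.a_inv_closed[of F] p.a_inv_closed unfolding extension_def
        by (simp add: a_inv_coeff)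
    next
      fix F G assume F: "F \<in> extension p T" and G: "G \<in> extension p T"
      have "F \<oplus>\<^bsub>polys\<^esub> G \<in> carrier polys" using F G A.a_closed by (auto simp: extension_def)
      moreover have "(F \<oplus>\<^bsub>polys\<^esub> G) m \<in> p" if "set_mset m \<inter> T = {}" for m
        using F G that p.add_in by (auto simp: extension_def diff_poly_ring_simps indexed_padd_def)
      ultimately show "F \<oplus>\<^bsub>polys\<^esub> G \<in> extension p T" by (simp add: extension_def)
    qed
  next
    fix F G assume F: "F \<in> extension p T" and G: "G \<in> carrier polys"
    have FA: "F \<in> carrier polys" using F by (simp add: extension_def)
    have "(G \<otimes>\<^bsub>polys\<^esub> F) m \<in> p" if m: "set_mset m \<inter> T = {}" for m
    proof -
      have "G k \<otimes> F (m - k) \<in> p" for k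
      proof -
        have "set_mset (m - k) \<inter> T = {}" using m by (auto dest: in_diffD)
        then have "F (m - k) \<in> p" using F by (simp add: extension_def)
        then show ?thesis using coefficient_closed[OF G] by (intro p.I_l_closed)
      qed
      then show ?thesis
        unfolding diff_poly_ring_simps mpoly_mult_def
        by (intro p.finsum_in finite_submultisets)
    qed
    then show 1: "G \<otimes>\<^bsub>polys\<^esub> F \<in> extension p T"
      using FA G by (simp add: extension_def)
    show "F \<otimes>\<^bsub>polys\<^esub> G \<in> extension p T"
      using 1 A.m_comm[OF FA G] by simp
  qed
qed

text \<open>
  Monomials are compared through an encoding of variables as natural numbers, since multisets over
  a linear order are linearly ordered compatibly with addition.
\<close>

lemma maximal_monomial:
  fixes p :: "'a set"
  assumes "\<zero> \<in> p" "F \<in> carrier polys" "F \<notin> extension p T"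
  obtains m where "set_mset m \<inter> T = {}" "F m \<notin> p"
    "\<And>k. set_mset k \<inter> T = {} \<Longrightarrow> F k \<notin> p \<Longrightarrow> image_mset prod_encode k \<le> image_mset prod_encode m"
proof -
  define B where "B = {m. set_mset m \<inter> T = {} \<and> F m \<notin> p}"
  have "B \<subseteq> {m. F m \<noteq> \<zero>}" using assms(1) by (auto simp: B_def)
  then have fin: "finite B"
    using mpoly_set_support(1)[of F all_vars] assms(2) finite_subset by (auto simp: diff_poly_ring_simps)
  have ne: "B \<noteq> {}" using assms(2,3) by (auto simp: B_def extension_def)
  let ?k = "image_mset prod_encode :: diff_monomial \<Rightarrow> nat multiset"
  have "Max (?k ` B) \<in> ?k ` B" using fin ne by (intro Max_in) auto
  then obtain m where m: "m \<in> B" "Max (?k ` B) = ?k m" by blast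
  have "?k k \<le> ?k m" if "k \<in> B" for k
    unfolding m(2)[symmetric] using fin that by (intro Max_ge) auto
  with m(1) that show ?thesis unfolding B_def by blast
qed

text \<open>
  The product of the maximal monomials of \<open>F\<close> and \<open>G\<close> with coefficient outside \<open>p\<close> has coefficient
  outside \<open>p\<close> in the product, as in the usual proof that polynomial rings over domains are domains.
\<close>

lemma primeideal_extension:
  assumes p: "primeideal p R"
  shows "primeideal (extension p T) polys"
proof (rule primeidealI)
  interpret p: primeideal p R by (rule p)
  show "ideal (extension p T) polys" by (rule ideal_extension[OF p.is_ideal])
  show "cring polys" by (rule A.is_cring)
  have "\<one>\<^bsub>polys\<^esub> {#} \<notin> p" using p.one_notin by (simp add: diff_poly_ring_simps indexed_const_def)
  then have "\<one>\<^bsub>polys\<^esub> \<notin> extension p T" unfolding extension_def by force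
  then show "carrier polys \<noteq> extension p T" using A.one_closed by metis
  fix F G assume F: "F \<in> carrier polys" and G: "G \<in> carrier polys" and FG: "F \<otimes>\<^bsub>polys\<^esub> G \<in> extension p T"
  show "F \<in> extension p T \<or> G \<in> extension p T"
  proof (rule ccontr)
    assume no: "\<not> ?thesis"
    obtain m where m: "set_mset m \<inter> T = {}" "F m \<notin> p"
      "\<And>k. set_mset k \<inter> T = {} \<Longrightarrow> F k \<notin> p \<Longrightarrow> image_mset prod_encode k \<le> image_mset prod_encode m"
      by (rule maximal_monomial[OF p.zero_closed F]) (use no in blast)+
    obtain l where l: "set_mset l \<inter> T = {}" "G l \<notin> p"
      "\<And>k. set_mset k \<inter> T = {} \<Longrightarrow> G k \<notin> p \<Longrightarrow> image_mset prod_encode k \<le> image_mset prod_encode l"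
      by (rule maximal_monomial[OF p.zero_closed G]) (use no in blast)+
    note [simp] = coefficient_closed[OF F] coefficient_closed[OF G]
    have avoid: "set_mset (m + l) \<inter> T = {}" using m(1) l(1) by auto
    let ?S = "{k. k \<subseteq># m + l} - {m}"
    have rest: "F k \<otimes> G (m + l - k) \<in> p" if k: "k \<in> ?S" for k
    proof (rule ccontr)
      assume notin: "F k \<otimes> G (m + l - k) \<notin> p"
      then have kp: "F k \<notin> p" "G (m + l - k) \<notin> p"
        using p.I_r_closed[of "F k" "G (m + l - k)"] p.I_l_closed[of "G (m + l - k)" "F k"] by auto
      have sub: "k \<subseteq># m + l" using k by simp
      have "set_mset (m + l - k) \<subseteq> set_mset (m + l)" by (meson in_diffD subsetI)
      then have "set_mset k \<inter> T = {}" "set_mset (m + l - k) \<inter> T = {}"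
        using avoid set_mset_mono[OF sub] by blast+
      then have le: "image_mset prod_encode k \<le> image_mset prod_encode m"
        "image_mset prod_encode (m + l - k) \<le> image_mset prod_encode l"
        using m(3) l(3) kp by blast+
      have "image_mset prod_encode k + image_mset prod_encode (m + l - k) = image_mset prod_encode (k + (m + l - k))"
        by simp
      also have "k + (m + l - k) = m + l" using sub by simp
      finally have "image_mset prod_encode k = image_mset prod_encode m"
        by (intro multiset_sum_extremal[OF le]) simp
      then have "image_mset prod_decode (image_mset prod_encode k) =
          image_mset prod_decode (image_mset prod_encode m)"
        by (rule arg_cong)
      then have "k = m" by (simp add: multiset.map_comp comp_def)
      with k show False by simp
    qed
    have "(F \<otimes>\<^bsub>polys\<^esub> G) (m + l) = finsum R (\<lambda>k. F k \<otimes> G (m + l - k)) (insert m ?S)"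
      unfolding diff_poly_ring_simps mpoly_mult_def by (rule arg_cong[of _ _ "finsum R _"]) auto
    also have "\<dots> = F m \<otimes> G (m + l - m) \<oplus> finsum R (\<lambda>k. F k \<otimes> G (m + l - k)) ?S"
      using finite_submultisets by (intro finsum_insert) auto
    finally have coeff: "(F \<otimes>\<^bsub>polys\<^esub> G) (m + l) =
        F m \<otimes> G (m + l - m) \<oplus> finsum R (\<lambda>k. F k \<otimes> G (m + l - k)) ?S" .
    have "F m \<otimes> G l \<oplus> finsum R (\<lambda>k. F k \<otimes> G (m + l - k)) ?S \<in> p"
    proof -
      have "(F \<otimes>\<^bsub>polys\<^esub> G) (m + l) \<in> p"
        using FG avoid unfolding extension_def by blast
      moreover have "m + l - m = l" by simp
      ultimately show ?thesis
        using coeff by simp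
    qed
    moreover have "finsum R (\<lambda>k. F k \<otimes> G (m + l - k)) ?S \<in> p"
      using finite_submultisets rest by (intro p.finsum_in) auto
    ultimately have "F m \<otimes> G l \<in> p" by (intro p.cancel_right[of "F m \<otimes> G l"]) auto
    then show False using p.I_prime[of "F m" "G l"] m(2) l(2) by auto
  qed
qed

lemma extension_in_diff_Spec:
  assumes p: "p \<in> diff_Spec R" and T: "\<And>i j. (i, j) \<in> T \<Longrightarrow> (i, Suc j) \<in> T"
  shows "extension p T \<in> diff_Spec polys"
proof -
  have prime: "primeideal p R" and der: "\<And>a. a \<in> p \<Longrightarrow> \<delta> a \<in> p"
    using p by (auto simp: diff_Spec_def)
  interpret p: primeideal p R by (rule prime)
  have "mpoly_der R F \<in> extension p T" if F: "F \<in> extension p T" for F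
  proof -
    have FA: "F \<in> carrier polys" using F by (simp add: extension_def)
    then have "mpoly_der R F \<in> carrier polys" using A.der_closed by (simp add: diff_poly_ring_simps)
    moreover have "mpoly_der R F m \<in> p" if m: "set_mset m \<inter> T = {}" for m
    proof -
      have "der_term F m v \<in> p" if v: "v \<in> der_index m" for v
      proof -
        obtain i j where ij: "v = (i, j)" by (cases v)
        then have "(i, Suc j) \<in># m" using v by (simp add: der_index_def)
        then have "(i, j) \<notin> T" using m T by blast
        then have "set_mset (m - {#(i, Suc j)#} + {#(i, j)#}) \<inter> T = {}"
          using m by (auto dest: in_diffD)
        then have "F (m - {#(i, Suc j)#} + {#(i, j)#}) \<in> p"
          using F unfolding extension_def by blast
        then show ?thesis
          unfolding der_term_def ij prod.case by (rule p.add_pow_in)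
      qed
      then have "finsum R (der_term F m) (der_index m) \<in> p"
        using finite_der_index by (intro p.finsum_in)
      moreover have "\<delta> (F m) \<in> p" using F m der by (simp add: extension_def)
      ultimately show ?thesis unfolding mpoly_der_alt by (intro p.add_in)
    qed
    ultimately show ?thesis by (simp add: extension_def)
  qed
  then show ?thesis
    using primeideal_extension[OF prime] by (simp add: diff_Spec_def diff_poly_ring_simps)
qed

lemma extension_strict_mono:
  assumes "p \<subset> q" "q \<subseteq> carrier R" "\<zero> \<in> q"
  shows "extension p {} \<subset> extension q {}"
proof -
  obtain r where r: "r \<in> q" "r \<notin> p" using assms(1) by blast
  have "indexed_const r \<in> carrier polys"
    using r(1) assms(2) by (auto simp: diff_poly_ring_simps intro: indexed_pset.intros)
  moreover have "indexed_const r m \<in> q" for m :: diff_monomial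
    using r(1) assms(3) by (simp add: indexed_const_def)
  ultimately have "indexed_const r \<in> extension q {}" by (simp add: extension_def)
  moreover have "indexed_const r {#} \<notin> p" using r(2) by (simp add: indexed_const_def)
  then have "indexed_const r \<notin> extension p {}" unfolding extension_def by force
  moreover have "extension p {} \<subseteq> extension q {}" using assms(1) unfolding extension_def by blast
  ultimately show ?thesis by blast
qed

lemma extension_strict_mono_vars:
  assumes p: "primeideal p R" and "T \<subset> T'" "T' \<subseteq> all_vars"
  shows "extension p T \<subset> extension p T'"
proof -
  interpret p: primeideal p R by (rule p)
  obtain v where v: "v \<in> T'" "v \<notin> T" using assms(2) by blast
  have coeff: "indexed_var v m = (if m = {#v#} then \<one> else \<zero>)" for m
    by (cases "v \<in># m") (auto simp: indexed_var_def indexed_pmult_def indexed_const_def dest!: multi_member_split)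
  have "indexed_var v \<in> carrier polys"
    using v(1) assms(3) by (intro indexed_var_in_carrier) blast
  moreover have "indexed_var v m \<in> p" if "set_mset m \<inter> T' = {}" for m
    using that v(1) p.zero_closed by (auto simp: coeff)
  ultimately have "indexed_var v \<in> extension p T'" by (simp add: extension_def)
  moreover have "indexed_var v {#v#} \<notin> p" using p.one_notin by (simp add: coeff)
  then have "indexed_var v \<notin> extension p T" using v(2) unfolding extension_def by force
  moreover have "extension p T \<subseteq> extension p T'" using assms(2) unfolding extension_def by blast
  ultimately show ?thesis by blast
qed

text \<open>
  From the prime killing the first \<open>k + 1\<close> indeterminates to the one killing the first \<open>k\<close>
  there is a descending sequence: the \<open>i\<close>-th term kills only the derivatives of order at least \<open>i\<close> of
  the indeterminate with index \<open>k\<close>.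
\<close>

lemma extension_ladder:
  assumes p: "p \<in> diff_Spec R" and "l \<le> n"
  shows "gap_chain (diff_Spec polys) 1 l (extension p ({..<n - l} \<times> UNIV))"
  using assms(2)
proof (induction l)
  case 0
  show ?case using extension_in_diff_Spec[OF p, of "{..<n} \<times> UNIV"] by simp
next
  case (Suc l)
  have prime: "primeideal p R" using p by (simp add: diff_Spec_def)
  define k where "k = n - Suc l"
  have k: "k < n" "n - l = Suc k" using Suc.prems by (auto simp: k_def)
  let ?T = "\<lambda>i::nat. {..<k} \<times> UNIV \<union> {k} \<times> {i..}"
  have top: "?T 0 = {..<Suc k} \<times> (UNIV :: nat set)" by (auto simp: less_Suc_eq)
  have all: "?T i \<subseteq> all_vars" for i using k(1) by auto
  have "extension p (?T i) \<in> diff_Spec polys" for i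
    using p by (rule extension_in_diff_Spec) auto
  moreover have "extension p ({..<k} \<times> UNIV) \<subseteq> extension p (?T i)" for i
    unfolding extension_def by blast
  moreover have "extension p (?T (Suc i)) \<subset> extension p (?T i)" for i
  proof (rule extension_strict_mono_vars[OF prime _ all])
    have "(k, i) \<in> ?T i - ?T (Suc i)" by simp
    moreover have "?T (Suc i) \<subseteq> ?T i" by auto
    ultimately show "?T (Suc i) \<subset> ?T i" by blast
  qed
  ultimately have chain: "descending_chain (diff_Spec polys) (extension p (?T 0))
      (extension p ({..<k} \<times> UNIV)) (\<lambda>i. extension p (?T i))"
    unfolding descending_chain_def by blast
  then have "gap_ge (diff_Spec polys) 1 (extension p (?T 0)) (extension p ({..<k} \<times> UNIV))"
    unfolding One_nat_def gap_ge_Suc_iff by auto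
  moreover have "extension p ({..<k} \<times> UNIV) \<subset> extension p (?T 0)"
  proof (rule extension_strict_mono_vars[OF prime _ all])
    have "(k, 0) \<in> ?T 0" "(k, 0) \<notin> {..<k} \<times> UNIV" by simp_all
    then show "{..<k} \<times> UNIV \<subset> ?T 0" using Un_upper1 by (metis psubsetI)
  qed
  moreover have "extension p ({..<k} \<times> UNIV) \<in> diff_Spec polys"
    using p by (rule extension_in_diff_Spec) simp
  moreover have "gap_chain (diff_Spec polys) 1 l (extension p (?T 0))"
    using Suc k(2) unfolding top by simp
  ultimately show ?case
    unfolding k_def[symmetric] gap_chain.simps by blast
qed

section \<open>The fibration of the differential spectra\<close>

lemma spectral_fibration_diff_poly_ring:
  assumes "Delta_arithmetical R" "standard_diff_ring R"
  shows "spectral_fibration (diff_Spec polys) (diff_Spec R) contraction (\<lambda>p. extension p {}) (diff_rank) n"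
proof
  fix P Q P' c
  assume P: "P \<in> diff_Spec polys"
  show "contraction P \<in> diff_Spec R" by (rule contraction_in_diff_Spec[OF P])
  show "diff_rank P \<le> n" by (rule diff_rank_le[OF diff_Spec_primeideal[OF P]])
  show "contraction P \<subseteq> contraction Q" if "P \<subseteq> Q" by (rule contraction_mono[OF that])
  show "diff_rank Q \<le> diff_rank P" if "Q \<in> diff_Spec polys" "P \<subseteq> Q"
    by (rule diff_rank_antimono[OF assms(1) P that])
next
  fix P P' c
  assume "P' \<in> diff_Spec polys" "descending_chain (diff_Spec polys) P P' c" "\<And>i. contraction (c i) = contraction P"
  then show "diff_rank P < diff_rank P'"
    by (rule diff_rank_jump[OF assms])
next
  fix p q assume p: "p \<in> diff_Spec R"
  show "extension p {} \<in> diff_Spec polys" by (rule extension_in_diff_Spec[OF p]) simp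
  show "gap_chain (diff_Spec polys) 1 n (extension p {})"
    using extension_ladder[OF p order_refl] by simp
  assume q: "q \<in> diff_Spec R" and "p \<subset> q"
  then interpret q: primeideal q R by (simp add: diff_Spec_def)
  show "extension p {} \<subset> extension q {}"
    using \<open>p \<subset> q\<close> q.Icarr q.zero_closed by (intro extension_strict_mono) auto
qed

end

end

theorem corollary45:
  fixes R :: "('a, 'm) diff_ring_scheme"
  assumes "ordinary_diff_ring R"
    and "diff_Spec R \<noteq> {}"
    and "standard_diff_ring R"
    and "diff_type R \<noteq> \<infinity>"
    and "diff_type R = 0 \<or> diff_dim R \<noteq> \<infinity>"
    and "Delta_arithmetical R"
  shows "J_ring R"
  using assms(1,2,4,5)
proof (rule J_ring_if_spectral_fibration)
  fix n
  interpret ordinary_diff_ring R by (rule assms(1))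
  show "\<exists>contr ext rank. spectral_fibration (diff_Spec (diff_poly_ring R n)) (diff_Spec R) contr ext rank n"
    using spectral_fibration_diff_poly_ring[OF assms(6,3)] by blast
qed

end
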